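(* Let $G$ be a critical graph. Then $G$ has a $\{K_{1,1}, K_{1,2}, C_m : m\ge 3\}$-factor and $\min(G,K_{1,2}) = |V(G)| - 2\mu_f(G)$. In particular, $\min(G, K_{1,2}) \le \frac{1}{5} |V(G)|$ and $\alpha(G)\le \frac{3}{5}|V(G)|$ for all $\Delta(G)\ge 2$.
   Context: All graphs are finite and simple. $\Delta(G)$ is the maximum degree. The edge-chromatic number $\chi'(G)$ is the minimum number of matchings needed to cover $E(G)$. For an integer $k\ge 2$, a graph $G$ is $k$-critical if $\Delta(G)=k$, $\chi'(G)=k+1$ and $\chi'(H)\le k$ for each proper subgraph $H$ of $G$; $G$ is critical if it is $k$-critical for some $k\ge 2$. $K_{1,i}$ is the star with $i$ edges and $C_m$ is the circuit (connected 2-regular graph) on $m$ vertices. A $\{K_{1,1}, K_{1,2}, C_m : m\ge 3\}$-factor of $G$ is a spanning subgraph each of whose components is isomorphic to $K_{1,1}$, $K_{1,2}$, or $C_m$ for some $m\ge 3$. If $G$ has such a factor, $\min(G,K_{1,2})$ denotes the minimum, over all $\{K_{1,1}, K_{1,2}, C_m : m\ge 3\}$-factors $F$ of $G$, of the number of components of $F$ isomorphic to $K_{1,2}$. A fractional matching of $G$ is a function $f:E(G)\to[0,1]$ such that for every vertex $v$ the sum of $f(e)$ over the edges $e$ incident to $v$ is at most $1$; $\mu_f(G)$ is the supremum of $\sum_{e\in E(G)} f(e)$ over all fractional matchings $f$. $\alpha(G)$ is the maximum cardinality of an independent set of vertices. *)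

theory Defs
  imports Complex_Main
begin

record 'a graph =
  verts :: "'a set"
  edges :: "'a set set"

definition sgraph :: "'a graph \<Rightarrow> bool" where
  "sgraph G \<longleftrightarrow> finite (verts G) \<and> (\<forall>e\<in>edges G. e \<subseteq> verts G \<and> card e = 2)"

definition degree :: "'a graph \<Rightarrow> 'a \<Rightarrow> nat" where
  "degree G v = card {e \<in> edges G. v \<in> e}"

text \<open>Inserting \<open>0\<close> only serves to make the maximum meaningful for the graph without vertices.\<close>

definition max_degree :: "'a graph \<Rightarrow> nat" where
  "max_degree G = Max (insert 0 (degree G ` verts G))"

definition subgraph :: "'a graph \<Rightarrow> 'a graph \<Rightarrow> bool" where
  "subgraph H G \<longleftrightarrow> sgraph H \<and> verts H \<subseteq> verts G \<and> edges H \<subseteq> edges G"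

definition matching :: "'a graph \<Rightarrow> 'a set set \<Rightarrow> bool" where
  "matching G M \<longleftrightarrow> M \<subseteq> edges G \<and> (\<forall>e\<in>M. \<forall>e'\<in>M. e \<noteq> e' \<longrightarrow> e \<inter> e' = {})"

definition chromatic_index :: "'a graph \<Rightarrow> nat" where
  "chromatic_index G =
     (LEAST k. \<exists>\<M>. finite \<M> \<and> card \<M> = k \<and> (\<forall>M\<in>\<M>. matching G M) \<and> edges G \<subseteq> \<Union>\<M>)"

definition k_critical :: "nat \<Rightarrow> 'a graph \<Rightarrow> bool" where
  "k_critical k G \<longleftrightarrow>
     sgraph G \<and> max_degree G = k \<and> chromatic_index G = k + 1 \<and>
     (\<forall>H. subgraph H G \<and> H \<noteq> G \<longrightarrow> chromatic_index H \<le> k)"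

definition critical :: "'a graph \<Rightarrow> bool" where
  "critical G \<longleftrightarrow> (\<exists>k\<ge>2. k_critical k G)"

definition isomorphic :: "'a graph \<Rightarrow> 'b graph \<Rightarrow> bool" where
  "isomorphic G H \<longleftrightarrow>
     (\<exists>\<phi>. bij_betw \<phi> (verts G) (verts H) \<and>
          (\<forall>u\<in>verts G. \<forall>v\<in>verts G. {u, v} \<in> edges G \<longleftrightarrow> {\<phi> u, \<phi> v} \<in> edges H))"

text \<open>\<open>reachable G u v\<close>: there is a walk in \<open>G\<close> from \<open>u\<close> to \<open>v\<close>.\<close>

definition reachable :: "'a graph \<Rightarrow> 'a \<Rightarrow> 'a \<Rightarrow> bool" where
  "reachable G = (\<lambda>u v. {u, v} \<in> edges G)\<^sup>*\<^sup>*"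

definition connected_graph :: "'a graph \<Rightarrow> bool" where
  "connected_graph G \<longleftrightarrow> verts G \<noteq> {} \<and> (\<forall>u\<in>verts G. \<forall>v\<in>verts G. reachable G u v)"

definition induced_subgraph :: "'a graph \<Rightarrow> 'a set \<Rightarrow> 'a graph" where
  "induced_subgraph G S = \<lparr>verts = S, edges = {e \<in> edges G. e \<subseteq> S}\<rparr>"

definition components :: "'a graph \<Rightarrow> 'a graph set" where
  "components G = (\<lambda>v. induced_subgraph G {w \<in> verts G. reachable G v w}) ` verts G"

text \<open>\<open>star i\<close> is $K_{1,i}$, with centre \<open>0\<close> and leaves \<open>1, \<dots>, i\<close>.\<close>

definition star :: "nat \<Rightarrow> nat graph" where
  "star i = \<lparr>verts = {0..i}, edges = {{0, j} | j. j \<in> {1..i}}\<rparr>"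

text \<open>The circuit $C_m$ is, up to isomorphism, the connected 2-regular graph on \<open>m\<close> vertices;
  \<open>circuit m H\<close> says that \<open>H\<close> is such a graph.\<close>

definition circuit :: "nat \<Rightarrow> 'a graph \<Rightarrow> bool" where
  "circuit m H \<longleftrightarrow>
     sgraph H \<and> connected_graph H \<and> (\<forall>v\<in>verts H. degree H v = 2) \<and> card (verts H) = m"

text \<open>\<open>star_circuit_factor F G\<close>: \<open>F\<close> is a $\{K_{1,1}, K_{1,2}, C_m : m \ge 3\}$-factor
  of \<open>G\<close>.\<close>

definition star_circuit_factor :: "'a graph \<Rightarrow> 'a graph \<Rightarrow> bool" where
  "star_circuit_factor F G \<longleftrightarrow>
     subgraph F G \<and> verts F = verts G \<and>
     (\<forall>C\<in>components F. isomorphic C (star 1) \<or> isomorphic C (star 2) \<or> (\<exists>m\<ge>3. circuit m C))"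

text \<open>The number $\min(G, K_{1,2})$; it is meaningful only if \<open>G\<close> has a factor as above.\<close>

definition min_K12 :: "'a graph \<Rightarrow> nat" where
  "min_K12 G =
     (LEAST n. \<exists>F. star_circuit_factor F G \<and> n = card {C \<in> components F. isomorphic C (star 2)})"

definition fractional_matching :: "'a graph \<Rightarrow> ('a set \<Rightarrow> real) \<Rightarrow> bool" where
  "fractional_matching G f \<longleftrightarrow>
     (\<forall>e\<in>edges G. 0 \<le> f e \<and> f e \<le> 1) \<and>
     (\<forall>v\<in>verts G. (\<Sum>e\<in>{e \<in> edges G. v \<in> e}. f e) \<le> 1)"

definition fractional_matching_number :: "'a graph \<Rightarrow> real" where
  "fractional_matching_number G = (SUP f\<in>Collect (fractional_matching G). \<Sum>e\<in>edges G. f e)"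

definition independent_set :: "'a graph \<Rightarrow> 'a set \<Rightarrow> bool" where
  "independent_set G I \<longleftrightarrow> I \<subseteq> verts G \<and> (\<forall>u\<in>I. \<forall>v\<in>I. {u, v} \<notin> edges G)"

definition independence_number :: "'a graph \<Rightarrow> nat" where
  "independence_number G = Max (card ` Collect (independent_set G))"

end

theory Submission
  imports Defs "HOL-Combinatorics.Transposition"
begin

text \<open>Everything follows from the expansion property \<open>2|X| \<le> 3|N(X)|\<close> of vertex sets \<open>X\<close> of a
  critical graph, a form of Woodall's bound on the independence number.

  For the expansion property every vertex \<open>y\<close> of \<open>N(X)\<close> distributes a charge of at most \<open>3\<close> among
  its neighbours in \<open>X\<close> so that each vertex of \<open>X\<close> receives at least \<open>2\<close>. A vertex of degree \<open>d\<close>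
  with \<open>2d > k\<close> takes \<open>2/d\<close> from each neighbour and the rest is shared equally by the other
  neighbours in \<open>X\<close>. That this suffices rests on Kempe-chain arguments in colourings of
  \<open>G - xy\<close>: if \<open>q(y)\<close> is the number of colours not leading from \<open>y\<close> to a vertex of large degree,
  then \<open>x\<close> has \<open>q(y)\<close> neighbours \<open>z \<noteq> y\<close> with \<open>q(z) \<le> d(x) - q(y)\<close>. Taking \<open>y\<close> with \<open>q(y)\<close>
  maximal, the sum of \<open>1/q(y)\<close> over the neighbours \<open>y\<close> of \<open>x\<close> is at least \<open>2\<close>.

  An independent set \<open>I\<close> maximizing \<open>|I| - |N(I)|\<close> then yields both sides of the duality. By Hall's
  theorem \<open>I\<close> is mapped onto \<open>N(I)\<close> along edges with fibres of size \<open>1\<close> or \<open>2\<close> and the remaining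
  vertices are permuted along edges; this is a factor with at most \<open>|I| - |N(I)|\<close> components
  $K_{1,2}$. Conversely, the fractional vertex cover with weights \<open>0\<close> on \<open>I\<close>, \<open>1\<close> on \<open>N(I)\<close> and
  \<open>1/2\<close> elsewhere bounds $\mu_f$ from above, and every factor bounds it from below.\<close>

section \<open>Kempe chains\<close>

text \<open>The obstacle is a vertex \<open>x\<close> with 2d(x) <= k: taking 2/d(x) from every
  neighbour may overdraw a neighbour \<open>y\<close> that has many such vertices. Call a neighbour
  \<open>w\<close> of \<open>y\<close> large if d(w) + d(x) + d(y) >= 2k + 2. Two vertices of degree
  at most k/2 are never large for each other, because d(y) <= k; so the small neighbours of
  \<open>y\<close> are among its at most q(y) neighbours that are not large. The share of
  \<open>x\<close> is therefore bounded below by an expression affine in 1/q(y). No bound for a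
  single \<open>y\<close> suffices, and the sum of 1/q(y) is exactly what the colourings have to
  control.

  To compare q(y) with q(z) for two neighbours of \<open>x\<close>, the uncoloured edge is slid back
  and forth between \<open>{x, y}\<close> and \<open>{x, z}\<close>, each position allowing Kempe
  changes that the other forbids.

  The ratio in 2|I| <= 3|N(I)| is the one that both constants require: it is equivalent to 5(|I| -
  |N(I)|) <= |I| + |N(I)|, and for independent \<open>I\<close> the right side is at most
  |V|.\<close>

text \<open>A path component has only two ends. If \<open>x\<close> reached \<open>w\<close>, a
  shortest walk between them would never turn back, so its vertex set would be closed under
  \<open>R\<close> and contain \<open>y\<close>; but then \<open>y\<close> would be an interior
  vertex with two distinct neighbours.\<close>

lemma three_ends_not_connected:
  fixes R :: "'a \<Rightarrow> 'a \<Rightarrow> bool"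
  assumes sym: "\<And>u v. R u v \<Longrightarrow> R v u"
    and two: "\<And>v p q r. R v p \<Longrightarrow> R v q \<Longrightarrow> R v r \<Longrightarrow> p = q \<or> q = r \<or> p = r"
    and end_x: "\<And>p q. R x p \<Longrightarrow> R x q \<Longrightarrow> p = q"
    and end_y: "\<And>p q. R y p \<Longrightarrow> R y q \<Longrightarrow> p = q"
    and end_w: "\<And>p q. R w p \<Longrightarrow> R w q \<Longrightarrow> p = q"
    and neq: "x \<noteq> y" "x \<noteq> w" "y \<noteq> w"
    and xy: "R\<^sup>*\<^sup>* x y"
  shows "\<not> R\<^sup>*\<^sup>* x w"
proof
  assume "R\<^sup>*\<^sup>* x w"
  then have "\<exists>n. (R ^^ n) x w"
    by (simp add: rtranclp_power)
  define n where "n = (LEAST n. (R ^^ n) x w)"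
  have n: "(R ^^ n) x w"
    unfolding n_def using \<open>\<exists>n. (R ^^ n) x w\<close> by (rule LeastI_ex)
  have least: "\<not> (R ^^ m) x w" if "m < n" for m
    using that not_less_Least unfolding n_def by blast
  obtain f where f: "f 0 = x" "f n = w" "\<And>i. i < n \<Longrightarrow> R (f i) (f (Suc i))"
    using n by (auto simp: relpowp_fun_conv)
  have npos: "n > 0"
    using f neq by (cases n) auto
  \<comment> \<open>Otherwise two steps could be cut out of the walk, against the minimality of
    \<open>n\<close>.\<close>
  have turn: "f (i - 1) \<noteq> f (i + 1)" if i: "0 < i" "i < n" for i
  proof
    assume eq: "f (i - 1) = f (i + 1)"
    have "(R ^^ (i - 1)) x (f (i - 1))"
      unfolding relpowp_fun_conv using f i by (intro exI[of _ f]) auto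
    moreover have "(R ^^ (n - (i + 1))) (f (i + 1)) w"
      unfolding relpowp_fun_conv using f i by (intro exI[of _ "\<lambda>j. f (i + 1 + j)"]) auto
    ultimately have "(R ^^ (i - 1 + (n - (i + 1)))) x w"
      using eq by (auto simp: relpowp_add)
    then show False
      using least[of "i - 1 + (n - (i + 1))"] i by auto
  qed
  have nbr: "R (f i) (f (i + 1))" "R (f i) (f (i - 1))" if "0 < i" "i < n" for i
    using f(3)[of i] f(3)[of "i - 1"] that sym by auto
  have closed: "v \<in> f ` {0..n}" if "u \<in> f ` {0..n}" "R u v" for u v
  proof -
    obtain i where i: "i \<le> n" "u = f i"
      using \<open>u \<in> f ` {0..n}\<close> by auto
    consider "i = 0" | "i = n" | "0 < i" "i < n"
      using i by linarith
    then show ?thesis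
    proof cases
      case 1
      then have "v = f 1"
        using end_x[of v "f 1"] f(1) f(3)[of 0] i that npos by auto
      then show ?thesis using npos by auto
    next
      case 2
      then have "v = f (n - 1)"
        using end_w[of v "f (n - 1)"] f(2) f(3)[of "n - 1"] i that npos sym by auto
      then show ?thesis using npos by auto
    next
      case 3
      then have "v = f (i + 1) \<or> v = f (i - 1)"
        using two[of "f i" "f (i + 1)" "f (i - 1)" v] nbr[OF 3] turn[OF 3] i that by auto
      then show ?thesis using 3 by auto
    qed
  qed
  from xy have "y \<in> f ` {0..n}"
  proof (induction rule: rtranclp_induct)
    case base
    then show ?case using f(1) by force
  next
    case (step u v)
    then show ?case using closed by blast
  qed
  then obtain i where i: "i \<le> n" "y = f i"
    by auto
  then have "i \<noteq> 0" "i \<noteq> n"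
    using f(1,2) neq by metis+
  then have "0 < i" "i < n"
    using i by auto
  then show False
    using end_y[of "f (i + 1)" "f (i - 1)"] nbr[of i] turn[of i] i by auto
qed

definition edge_coloring :: "nat \<Rightarrow> 'a set set \<Rightarrow> ('a set \<Rightarrow> nat) \<Rightarrow> bool" where
  "edge_coloring k F \<phi> \<longleftrightarrow>
     (\<forall>e\<in>F. \<phi> e < k) \<and> (\<forall>e\<in>F. \<forall>f\<in>F. e \<noteq> f \<longrightarrow> e \<inter> f \<noteq> {} \<longrightarrow> \<phi> e \<noteq> \<phi> f)"

definition missing :: "nat \<Rightarrow> 'a set set \<Rightarrow> ('a set \<Rightarrow> nat) \<Rightarrow> 'a \<Rightarrow> nat set" where
  "missing k F \<phi> v = {c. c < k \<and> (\<forall>e\<in>F. v \<in> e \<longrightarrow> \<phi> e \<noteq> c)}"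

definition kempe_adj :: "'a set set \<Rightarrow> ('a set \<Rightarrow> nat) \<Rightarrow> nat \<Rightarrow> nat \<Rightarrow> 'a \<Rightarrow> 'a \<Rightarrow> bool" where
  "kempe_adj F \<phi> a b u v \<longleftrightarrow> {u, v} \<in> F \<and> \<phi> {u, v} \<in> {a, b}"

lemma edge_coloring_eq:
  assumes "edge_coloring k F \<phi>" "{v, p} \<in> F" "{v, q} \<in> F" "\<phi> {v, p} = \<phi> {v, q}"
  shows "p = q"
proof -
  have "\<phi> {v, p} \<noteq> \<phi> {v, q}" if "{v, p} \<noteq> {v, q}"
    using assms(1-3) that unfolding edge_coloring_def by simp
  then have "{v, p} = {v, q}"
    using assms(4) by auto
  then show ?thesis by (auto simp: doubleton_eq_iff)
qed

lemma finite_missing [simp]: "finite (missing k F \<phi> v)"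
  unfolding missing_def by simp

lemma card_missing:
  assumes "edge_coloring k F \<phi>" "finite F"
  shows "card (missing k F \<phi> v) + card {e \<in> F. v \<in> e} = k"
proof -
  have inj: "inj_on \<phi> {e \<in> F. v \<in> e}"
    using assms(1) unfolding edge_coloring_def inj_on_def by blast
  have eq: "{..<k} = missing k F \<phi> v \<union> \<phi> ` {e \<in> F. v \<in> e}"
    using assms(1) unfolding edge_coloring_def missing_def by auto
  have "card {..<k} = card (missing k F \<phi> v) + card (\<phi> ` {e \<in> F. v \<in> e})"
    unfolding eq using assms(2) by (intro card_Un_disjoint) (auto simp: missing_def)
  then show ?thesis
    using card_image[OF inj] by simp
qed

text \<open>An edge coloured \<open>a\<close> or \<open>b\<close> has both ends in the chain
  \<open>C\<close> or none, and the transposition fixes all other colours. So either end of an edge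
  may decide whether it is swapped, and properness can be checked at a common vertex.\<close>

lemma kempe_swap:
  fixes a b :: nat and w :: 'a
  assumes col: "edge_coloring k F \<phi>" and ab: "a < k" "b < k"
    and two: "\<And>e. e \<in> F \<Longrightarrow> card e = 2"
  defines "C \<equiv> {v. (kempe_adj F \<phi> a b)\<^sup>*\<^sup>* w v}"
  obtains \<phi>' where "edge_coloring k F \<phi>'"
    "\<And>e v. e \<in> F \<Longrightarrow> v \<in> e \<Longrightarrow> v \<in> C \<Longrightarrow> \<phi>' e = transpose a b (\<phi> e)"
    "\<And>e v. e \<in> F \<Longrightarrow> v \<in> e \<Longrightarrow> v \<notin> C \<Longrightarrow> \<phi>' e = \<phi> e"
proof -
  define \<phi>' where "\<phi>' e = (if e \<inter> C \<noteq> {} then transpose a b (\<phi> e) else \<phi> e)" for e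
  have closed: "e \<subseteq> C" if "e \<in> F" "v \<in> e" "v \<in> C" "\<phi> e \<in> {a, b}" for e v
  proof
    fix u assume "u \<in> e"
    show "u \<in> C"
    proof (cases "u = v")
      case False
      then have "e = {v, u}"
        using two[OF \<open>e \<in> F\<close>] \<open>u \<in> e\<close> \<open>v \<in> e\<close> by (auto simp: card_2_iff)
      then have "kempe_adj F \<phi> a b v u"
        using that unfolding kempe_adj_def by simp
      then show ?thesis
        using that(3) unfolding C_def by (simp add: rtranclp.rtrancl_into_rtrancl)
    qed (use that in simp)
  qed
  have in_C: "\<phi>' e = transpose a b (\<phi> e)" if "v \<in> e" "v \<in> C" for e v
    using that unfolding \<phi>'_def by auto
  have notin_C: "\<phi>' e = \<phi> e" if "e \<in> F" "v \<in> e" "v \<notin> C" for e v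
    using that closed[of e] unfolding \<phi>'_def by (auto simp: transpose_def)
  have inj: "transpose a b i = transpose a b j \<longleftrightarrow> i = j" for i j
    by (metis transpose_involutory)
  have "edge_coloring k F \<phi>'"
    unfolding edge_coloring_def
  proof (intro conjI ballI impI)
    fix e assume "e \<in> F"
    then show "\<phi>' e < k"
      using col ab unfolding edge_coloring_def \<phi>'_def by (auto simp: transpose_def)
  next
    fix e f assume ef: "e \<in> F" "f \<in> F" "e \<noteq> f" "e \<inter> f \<noteq> {}"
    then obtain v where v: "v \<in> e" "v \<in> f" by auto
    have "\<phi> e \<noteq> \<phi> f"
      using col ef unfolding edge_coloring_def by auto
    then show "\<phi>' e \<noteq> \<phi>' f"
      using in_C[OF v(1)] in_C[OF v(2)] notin_C[OF ef(1) v(1)] notin_C[OF ef(2) v(2)] inj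
      by (cases "v \<in> C") auto
  qed
  then show thesis
    using that in_C notin_C by blast
qed

section \<open>Edge sets that become \<open>k\<close>-colourable when any one edge is
  removed\<close>

locale edge_critical =
  fixes E :: "'a set set" and k :: nat
  assumes finite_E: "finite E" and card_edge: "e \<in> E \<Longrightarrow> card e = 2"
    and no_coloring: "\<not> edge_coloring k E \<phi>"
    and coloring_minus: "e \<in> E \<Longrightarrow> \<exists>\<phi>. edge_coloring k (E - {e}) \<phi>"
    and degree_le: "card {e \<in> E. v \<in> e} \<le> k"
begin

definition deg :: "'a \<Rightarrow> nat" where
  "deg v = card {e \<in> E. v \<in> e}"

text \<open>The standing situation of all colour arguments. The uncoloured edge is a parameter
  because it gets moved; the value of \<open>\<phi>\<close> on it is arbitrary, so statements about
  colours have to exclude \<open>{x, y}\<close>.\<close>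

definition st :: "'a \<Rightarrow> 'a \<Rightarrow> ('a set \<Rightarrow> nat) \<Rightarrow> bool" where
  "st x y \<phi> \<longleftrightarrow> {x, y} \<in> E \<and> edge_coloring k (E - {{x, y}}) \<phi>"

definition M :: "'a \<Rightarrow> 'a \<Rightarrow> ('a set \<Rightarrow> nat) \<Rightarrow> 'a \<Rightarrow> nat set" where
  "M x y \<phi> v = missing k (E - {{x, y}}) \<phi> v"

lemma edge_neq: "{x, y} \<in> E \<Longrightarrow> x \<noteq> y"
  using card_edge by fastforce

lemma st_sym: "st x y \<phi> \<Longrightarrow> st y x \<phi>"
  unfolding st_def by (simp add: insert_commute)

lemma M_sym: "M x y \<phi> v = M y x \<phi> v"
  unfolding M_def by (simp add: insert_commute)

lemma M_I: "c < k \<Longrightarrow> (\<And>u. {v, u} \<in> E \<Longrightarrow> {v, u} \<noteq> {x, y} \<Longrightarrow> \<phi> {v, u} \<noteq> c) \<Longrightarrow> c \<in> M x y \<phi> v"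
proof -
  assume c: "c < k" and *: "\<And>u. {v, u} \<in> E \<Longrightarrow> {v, u} \<noteq> {x, y} \<Longrightarrow> \<phi> {v, u} \<noteq> c"
  have "\<phi> e \<noteq> c" if e: "e \<in> E - {{x, y}}" "v \<in> e" for e
  proof -
    obtain u where "e = {v, u}"
      using card_edge[of e] e by (auto simp: card_2_iff)
    then show ?thesis using * e by auto
  qed
  then show "c \<in> M x y \<phi> v"
    using c unfolding M_def missing_def by auto
qed

lemma M_D: "c \<in> M x y \<phi> v \<Longrightarrow> {v, u} \<in> E \<Longrightarrow> {v, u} \<noteq> {x, y} \<Longrightarrow> \<phi> {v, u} \<noteq> c"
  unfolding M_def missing_def by auto

lemma M_less: "c \<in> M x y \<phi> v \<Longrightarrow> c < k"
  unfolding M_def missing_def by auto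

lemma M_subset: "M x y \<phi> v \<subseteq> {..<k}"
  using M_less by auto

lemma finite_M [simp]: "finite (M x y \<phi> v)"
  unfolding M_def by simp

lemma not_M_obtain:
  assumes "c < k" "c \<notin> M x y \<phi> v"
  obtains u where "{v, u} \<in> E" "{v, u} \<noteq> {x, y}" "\<phi> {v, u} = c"
  using assms M_I[of c v x y \<phi>] by auto

lemma st_color_less: "st x y \<phi> \<Longrightarrow> e \<in> E \<Longrightarrow> e \<noteq> {x, y} \<Longrightarrow> \<phi> e < k"
  unfolding st_def edge_coloring_def by auto

lemma st_eq:
  assumes "st x y \<phi>" "{v, p} \<in> E" "{v, q} \<in> E" "{v, p} \<noteq> {x, y}" "{v, q} \<noteq> {x, y}"
    "\<phi> {v, p} = \<phi> {v, q}"
  shows "p = q"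
  using assms edge_coloring_eq[of k "E - {{x, y}}" \<phi> v p q] unfolding st_def by auto

text \<open>The uncoloured edge counts in the degree of its ends but uses no colour there, hence
  \<open>k + 1\<close> for \<open>x\<close> and \<open>y\<close>.\<close>

lemma card_M:
  assumes "st x y \<phi>"
  shows "card (M x y \<phi> x) + deg x = k + 1" "card (M x y \<phi> y) + deg y = k + 1"
    "v \<noteq> x \<Longrightarrow> v \<noteq> y \<Longrightarrow> card (M x y \<phi> v) + deg v = k"
proof -
  have *: "card (M x y \<phi> v) + card {e \<in> E - {{x, y}}. v \<in> e} = k" for v
    unfolding M_def using assms finite_E by (intro card_missing) (auto simp: st_def)
  have E: "{x, y} \<in> E"
    using assms by (simp add: st_def)
  have **: "deg v = card {e \<in> E - {{x, y}}. v \<in> e} + 1" if "v \<in> {x, y}" for v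
  proof -
    have "{e \<in> E. v \<in> e} = insert {x, y} {e \<in> E - {{x, y}}. v \<in> e}"
      using that E by auto
    then show ?thesis
      unfolding deg_def using finite_E by simp
  qed
  show "card (M x y \<phi> x) + deg x = k + 1" "card (M x y \<phi> y) + deg y = k + 1"
    using *[of x] *[of y] **[of x] **[of y] by auto
  show "card (M x y \<phi> v) + deg v = k" if "v \<noteq> x" "v \<noteq> y"
  proof -
    have "{e \<in> E - {{x, y}}. v \<in> e} = {e \<in> E. v \<in> e}"
      using that by auto
    then show ?thesis using *[of v] unfolding deg_def by simp
  qed
qed

lemma M_nonempty:
  assumes "st x y \<phi>"
  obtains a where "a \<in> M x y \<phi> x"
proof -
  have "card (M x y \<phi> x) > 0"
    using card_M(1)[OF assms] degree_le[of x] unfolding deg_def by linarith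
  then show thesis using that by (metis card_gt_0_iff ex_in_conv)
qed

text \<open>A colour missing at both ends could be given to \<open>{x, y}\<close>, which would
  colour all of \<open>E\<close>.\<close>

lemma M_disjoint:
  assumes "st x y \<phi>"
  shows "M x y \<phi> x \<inter> M x y \<phi> y = {}"
proof (rule ccontr)
  assume "M x y \<phi> x \<inter> M x y \<phi> y \<noteq> {}"
  then obtain c where c: "c \<in> M x y \<phi> x" "c \<in> M x y \<phi> y" by auto
  have "edge_coloring k E (\<phi>({x, y} := c))"
    unfolding edge_coloring_def
  proof (intro conjI ballI impI)
    fix e assume "e \<in> E"
    then show "(\<phi>({x, y} := c)) e < k"
      using st_color_less[OF assms] M_less[OF c(1)] by auto
  next
    fix e f assume "e \<in> E" "f \<in> E" "e \<noteq> f" "e \<inter> f \<noteq> {}"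
    then show "(\<phi>({x, y} := c)) e \<noteq> (\<phi>({x, y} := c)) f"
      using assms c unfolding M_def missing_def st_def edge_coloring_def by auto
  qed
  then show False using no_coloring by simp
qed

text \<open>If the chain from \<open>x\<close> avoided \<open>y\<close>, swapping it would make
  \<open>b\<close> missing at both ends of the uncoloured edge, against
  \<open>M_disjoint\<close>.\<close>

lemma kempe_linked:
  assumes st: "st x y \<phi>" and a: "a \<in> M x y \<phi> x" and b: "b \<in> M x y \<phi> y"
  shows "(kempe_adj (E - {{x, y}}) \<phi> a b)\<^sup>*\<^sup>* x y"
proof (rule ccontr)
  let ?F = "E - {{x, y}}"
  assume *: "\<not> ?thesis"
  have col: "edge_coloring k ?F \<phi>"
    using st by (simp add: st_def)
  obtain \<phi>' where \<phi>': "edge_coloring k ?F \<phi>'"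
    "\<And>e v. e \<in> ?F \<Longrightarrow> v \<in> e \<Longrightarrow> v \<in> {v. (kempe_adj ?F \<phi> a b)\<^sup>*\<^sup>* x v} \<Longrightarrow> \<phi>' e = transpose a b (\<phi> e)"
    "\<And>e v. e \<in> ?F \<Longrightarrow> v \<in> e \<Longrightarrow> v \<notin> {v. (kempe_adj ?F \<phi> a b)\<^sup>*\<^sup>* x v} \<Longrightarrow> \<phi>' e = \<phi> e"
    using kempe_swap[OF col M_less[OF a] M_less[OF b], of x] card_edge by blast
  have "b \<in> M x y \<phi>' x"
  proof (rule M_I)
    fix u assume "{x, u} \<in> E" "{x, u} \<noteq> {x, y}"
    then show "\<phi>' {x, u} \<noteq> b"
      using \<phi>'(2)[of "{x, u}" x] M_D[OF a, of u] by (auto simp: transpose_eq_iff)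
  qed (rule M_less[OF b])
  moreover have "b \<in> M x y \<phi>' y"
  proof (rule M_I)
    fix u assume "{y, u} \<in> E" "{y, u} \<noteq> {x, y}"
    then show "\<phi>' {y, u} \<noteq> b"
      using \<phi>'(3)[of "{y, u}" y] M_D[OF b, of u] * by auto
  qed (rule M_less[OF b])
  moreover have "st x y \<phi>'"
    using st \<phi>'(1) by (simp add: st_def)
  ultimately show False
    using M_disjoint by blast
qed

text \<open>The outcome of a change on the chain of \<open>w\<close> when that chain avoids
  \<open>x\<close> and \<open>y\<close>. Whether it passes through some other vertex
  \<open>v\<close> is left open; only the two possible missing sets of \<open>v\<close> are
  recorded.\<close>

definition kempe_swapped where
  "kempe_swapped x y a b w \<phi> \<phi>' \<longleftrightarrow> st x y \<phi>' \<and>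
     (\<forall>e\<in>E. e \<noteq> {x, y} \<longrightarrow>
        (\<phi> e \<notin> {a, b} \<or> x \<in> e \<or> y \<in> e \<longrightarrow> \<phi>' e = \<phi> e) \<and>
        (w \<in> e \<longrightarrow> \<phi>' e = transpose a b (\<phi> e))) \<and>
     M x y \<phi>' x = M x y \<phi> x \<and> M x y \<phi>' y = M x y \<phi> y \<and>
     M x y \<phi>' w = transpose a b ` M x y \<phi> w \<and>
     (\<forall>v. M x y \<phi>' v = M x y \<phi> v \<or> M x y \<phi>' v = transpose a b ` M x y \<phi> v)"

lemma kempe_swappedD:
  assumes "kempe_swapped x y a b w \<phi> \<phi>'"
  shows "st x y \<phi>'"
    "\<And>e. e \<in> E \<Longrightarrow> e \<noteq> {x, y} \<Longrightarrow> \<phi> e \<noteq> a \<Longrightarrow> \<phi> e \<noteq> b \<Longrightarrow> \<phi>' e = \<phi> e"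
    "\<And>e. e \<in> E \<Longrightarrow> e \<noteq> {x, y} \<Longrightarrow> x \<in> e \<or> y \<in> e \<Longrightarrow> \<phi>' e = \<phi> e"
    "\<And>e. e \<in> E \<Longrightarrow> e \<noteq> {x, y} \<Longrightarrow> w \<in> e \<Longrightarrow> \<phi>' e = transpose a b (\<phi> e)"
    "M x y \<phi>' x = M x y \<phi> x" "M x y \<phi>' y = M x y \<phi> y"
    "M x y \<phi>' w = transpose a b ` M x y \<phi> w"
    "\<And>v. M x y \<phi>' v = M x y \<phi> v \<or> M x y \<phi>' v = transpose a b ` M x y \<phi> v"
    "\<And>v c. c \<in> M x y \<phi> v \<Longrightarrow> c \<noteq> a \<Longrightarrow> c \<noteq> b \<Longrightarrow> c \<in> M x y \<phi>' v"
    "a \<in> M x y \<phi> w \<Longrightarrow> b \<in> M x y \<phi>' w" "b \<in> M x y \<phi> w \<Longrightarrow> a \<in> M x y \<phi>' w"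
proof -
  note * = assms[unfolded kempe_swapped_def]
  show 8: "M x y \<phi>' v = M x y \<phi> v \<or> M x y \<phi>' v = transpose a b ` M x y \<phi> v" for v
    using * by simp
  show "c \<in> M x y \<phi>' v" if "c \<in> M x y \<phi> v" "c \<noteq> a" "c \<noteq> b" for v c
    using 8[of v] that by (metis image_eqI transpose_apply_other)
  show 7: "M x y \<phi>' w = transpose a b ` M x y \<phi> w"
    using * by simp
  show "a \<in> M x y \<phi> w \<Longrightarrow> b \<in> M x y \<phi>' w" "b \<in> M x y \<phi> w \<Longrightarrow> a \<in> M x y \<phi>' w"
    unfolding 7 by (metis image_eqI transpose_apply_first, metis image_eqI transpose_apply_second)
qed (use assms[unfolded kempe_swapped_def] in force)+

text \<open>By \<open>kempe_linked\<close> the chain of \<open>x\<close> ends in \<open>y\<close>.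
  Missing \<open>a\<close> or \<open>b\<close>, the vertex \<open>w\<close> would be a third end of
  this chain, so by \<open>three_ends_not_connected\<close> its own chain is a different one and can
  be swapped without touching \<open>x\<close> or \<open>y\<close>.\<close>

lemma kempe_swap_away:
  assumes st: "st x y \<phi>" and a: "a \<in> M x y \<phi> x" and b: "b \<in> M x y \<phi> y"
    and w: "w \<noteq> x" "w \<noteq> y" "a \<in> M x y \<phi> w \<or> b \<in> M x y \<phi> w"
  shows "\<exists>\<phi>'. kempe_swapped x y a b w \<phi> \<phi>'"
proof -
  let ?F = "E - {{x, y}}"
  let ?R = "kempe_adj ?F \<phi> a b"
  have col: "edge_coloring k ?F \<phi>" and E: "{x, y} \<in> E"
    using st by (simp_all add: st_def)
  note abk = M_less[OF a] M_less[OF b]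
  have sym: "?R u v \<Longrightarrow> ?R v u" for u v
    unfolding kempe_adj_def by (simp add: insert_commute)
  have two: "p = q \<or> q = r \<or> p = r" if "?R v p" "?R v q" "?R v r" for v p q r
  proof -
    have "\<phi> {v, p} = \<phi> {v, q} \<or> \<phi> {v, q} = \<phi> {v, r} \<or> \<phi> {v, p} = \<phi> {v, r}"
      using that unfolding kempe_adj_def by (metis insertE singletonD)
    then show ?thesis
      using that edge_coloring_eq[OF col] unfolding kempe_adj_def by meson
  qed
  have ends: "p = q" if "a \<in> M x y \<phi> v \<or> b \<in> M x y \<phi> v" "?R v p" "?R v q" for v p q
  proof -
    have "\<phi> {v, p} \<in> {a, b}" "\<phi> {v, q} \<in> {a, b}" "{v, p} \<in> ?F" "{v, q} \<in> ?F"
      using that(2,3) unfolding kempe_adj_def by blast+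
    moreover have "\<phi> {v, p} \<noteq> c" "\<phi> {v, q} \<noteq> c" if "c \<in> M x y \<phi> v" for c
      using M_D[OF that] calculation(3,4) by blast+
    ultimately have "\<phi> {v, p} = \<phi> {v, q}"
      using that(1) by (metis insertE singletonD)
    then show ?thesis
      using that(2,3) edge_coloring_eq[OF col, of v p q] unfolding kempe_adj_def by simp
  qed
  have "\<not> ?R\<^sup>*\<^sup>* x w"
  proof (rule three_ends_not_connected[where y = y])
    show "?R u v \<Longrightarrow> ?R v u" for u v by (rule sym)
    show "?R v p \<Longrightarrow> ?R v q \<Longrightarrow> ?R v r \<Longrightarrow> p = q \<or> q = r \<or> p = r" for v p q r by (rule two)
    show "?R x p \<Longrightarrow> ?R x q \<Longrightarrow> p = q" for p q using ends[of x] a by blast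
    show "?R y p \<Longrightarrow> ?R y q \<Longrightarrow> p = q" for p q using ends[of y] b by blast
    show "?R w p \<Longrightarrow> ?R w q \<Longrightarrow> p = q" for p q using ends[of w] w(3) by blast
  qed (use w edge_neq[OF E] kempe_linked[OF st a b] in auto)
  moreover have symcl: "?R\<^sup>*\<^sup>* v u" if "?R\<^sup>*\<^sup>* u v" for u v
    using that by (induction rule: rtranclp_induct) (auto intro: converse_rtranclp_into_rtranclp sym)
  ultimately have nx: "\<not> ?R\<^sup>*\<^sup>* w x" and ny: "\<not> ?R\<^sup>*\<^sup>* w y"
    using kempe_linked[OF st a b] by (blast, blast intro: rtranclp_trans)
  obtain \<phi>' where \<phi>': "edge_coloring k ?F \<phi>'"
    "\<And>e v. e \<in> ?F \<Longrightarrow> v \<in> e \<Longrightarrow> v \<in> {v. ?R\<^sup>*\<^sup>* w v} \<Longrightarrow> \<phi>' e = transpose a b (\<phi> e)"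
    "\<And>e v. e \<in> ?F \<Longrightarrow> v \<in> e \<Longrightarrow> v \<notin> {v. ?R\<^sup>*\<^sup>* w v} \<Longrightarrow> \<phi>' e = \<phi> e"
    using kempe_swap[OF col abk, of w] card_edge by blast
  have tr: "transpose a b ` missing k ?F \<psi> v = missing k ?F \<psi>' v"
    if "\<And>e. e \<in> ?F \<Longrightarrow> v \<in> e \<Longrightarrow> \<psi>' e = transpose a b (\<psi> e)" for \<psi> \<psi>' v
  proof -
    have lt: "transpose a b c < k \<longleftrightarrow> c < k" for c
      using abk by (auto simp: transpose_def)
    have "c \<in> missing k ?F \<psi>' v \<longleftrightarrow> transpose a b c \<in> missing k ?F \<psi> v" for c
      unfolding missing_def using that lt by (auto simp: transpose_eq_iff)
    moreover have "c \<in> transpose a b ` A \<longleftrightarrow> transpose a b c \<in> A" for c A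
      by (metis image_iff transpose_involutory)
    ultimately show ?thesis
      by blast
  qed
  have M_in: "M x y \<phi>' v = transpose a b ` M x y \<phi> v" if "?R\<^sup>*\<^sup>* w v" for v
    unfolding M_def using tr[of v \<phi>' \<phi>] \<phi>'(2)[of _ v] that by simp
  have M_out: "M x y \<phi>' v = M x y \<phi> v" if "\<not> ?R\<^sup>*\<^sup>* w v" for v
    unfolding M_def missing_def using \<phi>'(3)[of _ v] that by auto
  have other: "\<phi>' e = \<phi> e" if "e \<in> E" "e \<noteq> {x, y}" "\<phi> e \<noteq> a" "\<phi> e \<noteq> b" for e
  proof -
    have "e \<noteq> {}"
      using card_edge[OF that(1)] by auto
    then obtain v where "v \<in> e"
      by auto
    then show ?thesis
      using \<phi>'(2)[of e v] \<phi>'(3)[of e v] that by (cases "?R\<^sup>*\<^sup>* w v") auto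
  qed
  have xy: "\<phi>' e = \<phi> e" if "e \<in> E" "e \<noteq> {x, y}" "x \<in> e \<or> y \<in> e" for e
    using \<phi>'(3)[of e x] \<phi>'(3)[of e y] that nx ny by auto
  have at_w: "\<phi>' e = transpose a b (\<phi> e)" if "e \<in> E" "e \<noteq> {x, y}" "w \<in> e" for e
    using \<phi>'(2)[of e w] that by auto
  have "st x y \<phi>'"
    using E \<phi>'(1) by (simp add: st_def)
  moreover have "M x y \<phi>' v = M x y \<phi> v \<or> M x y \<phi>' v = transpose a b ` M x y \<phi> v" for v
    using M_in M_out by blast
  moreover have "M x y \<phi>' w = transpose a b ` M x y \<phi> w"
    by (rule M_in) simp
  ultimately have "kempe_swapped x y a b w \<phi> \<phi>'"
    unfolding kempe_swapped_def using M_out[OF nx] M_out[OF ny] other xy at_w by simp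
  then show ?thesis by blast
qed

lemma st_proper:
  assumes st: "st x y \<phi>" and "e \<in> E" "f \<in> E" "e \<noteq> {x, y}" "f \<noteq> {x, y}" "e \<noteq> f" "v \<in> e" "v \<in> f"
  shows "\<phi> e \<noteq> \<phi> f"
proof -
  have "e \<inter> f \<noteq> {}" "e \<in> E - {{x, y}}" "f \<in> E - {{x, y}}"
    using assms by auto
  then show ?thesis
    using st \<open>e \<noteq> f\<close> unfolding st_def edge_coloring_def by simp
qed

lemma M_D2: "c \<in> M x y \<phi> u \<Longrightarrow> {v, u} \<in> E \<Longrightarrow> {v, u} \<noteq> {x, y} \<Longrightarrow> \<phi> {v, u} \<noteq> c"
  using M_D[of c x y \<phi> u v] by (simp add: insert_commute)

lemma M_image: "M x y \<phi> v = {..<k} - \<phi> ` {e \<in> E - {{x, y}}. v \<in> e}"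
  unfolding M_def missing_def by auto

lemma M_other:
  assumes "\<And>e. e \<in> E \<Longrightarrow> v \<in> e \<Longrightarrow> e \<noteq> {x, y} \<longleftrightarrow> e \<noteq> {x', y'}"
    "\<And>e. e \<in> E \<Longrightarrow> v \<in> e \<Longrightarrow> e \<noteq> {x, y} \<Longrightarrow> \<phi>' e = \<phi> e"
  shows "M x' y' \<phi>' v = M x y \<phi> v"
  using assms unfolding M_def missing_def by (intro Collect_cong) auto

section \<open>Fans\<close>

text \<open>The elementary fan step. The same colours occur at \<open>x\<close> before and after it,
  while \<open>c\<close> stops being missing at \<open>y\<close> and becomes missing at
  \<open>z\<close>. Doing it again with \<open>y\<close> and \<open>z\<close> exchanged undoes it,
  up to the arbitrary value on the uncoloured edge.\<close>

lemma shift: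
  assumes st: "st x y \<phi>" and c: "c \<in> M x y \<phi> y" and z: "{x, z} \<in> E" "z \<noteq> y" "\<phi> {x, z} = c"
  defines "\<phi>' \<equiv> \<phi>({x, y} := c)"
  shows "st x z \<phi>'" "M x z \<phi>' x = M x y \<phi> x" "M x z \<phi>' y = M x y \<phi> y - {c}"
    "M x z \<phi>' z = insert c (M x y \<phi> z)"
    "\<And>v. v \<noteq> x \<Longrightarrow> v \<noteq> y \<Longrightarrow> v \<noteq> z \<Longrightarrow> M x z \<phi>' v = M x y \<phi> v"
    "\<phi>' {x, y} = c" "\<And>e. e \<noteq> {x, y} \<Longrightarrow> \<phi>' e = \<phi> e"
proof -
  have E: "{x, y} \<in> E"
    using st by (simp add: st_def)
  have ne: "x \<noteq> y" "x \<noteq> z"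
    using E z edge_neq by auto
  have xzy: "{x, z} \<noteq> {x, y}"
    using z(2) by (auto simp: doubleton_eq_iff)
  note ck = M_less[OF c]
  have col: "edge_coloring k (E - {{x, y}}) \<phi>"
    using st by (simp add: st_def)
  have proper: "\<phi> e \<noteq> \<phi> f" if "e \<in> E" "f \<in> E" "e \<noteq> {x, y}" "f \<noteq> {x, y}" "e \<noteq> f" "v \<in> e" "v \<in> f" for e f v
    using st_proper[OF st that] .
  have cy: "\<phi> e \<noteq> c" if "e \<in> E" "e \<noteq> {x, y}" "y \<in> e" for e
    using c that unfolding M_def missing_def by auto
  have cx: "\<phi> e \<noteq> c" if "e \<in> E" "e \<noteq> {x, y}" "x \<in> e" "e \<noteq> {x, z}" for e
    using proper[of e "{x, z}" x] that z xzy by auto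
  have cz: "\<phi> e \<noteq> c" if "e \<in> E" "e \<noteq> {x, y}" "z \<in> e" "e \<noteq> {x, z}" for e
    using proper[of e "{x, z}" z] that z xzy by auto
  show st': "st x z \<phi>'"
    unfolding st_def edge_coloring_def
  proof (intro conjI ballI impI)
    fix e assume "e \<in> E - {{x, z}}"
    then show "\<phi>' e < k"
      using st_color_less[OF st] ck unfolding \<phi>'_def by auto
  next
    fix e f assume ef: "e \<in> E - {{x, z}}" "f \<in> E - {{x, z}}" "e \<noteq> f" "e \<inter> f \<noteq> {}"
    then obtain v where v: "v \<in> e" "v \<in> f" by auto
    consider "e = {x, y}" | "f = {x, y}" | "e \<noteq> {x, y}" "f \<noteq> {x, y}" by auto
    then show "\<phi>' e \<noteq> \<phi>' f"
    proof cases
      case 1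
      then have "\<phi> f \<noteq> c"
        using v ef cx[of f] cy[of f] by auto
      then show ?thesis using 1 ef unfolding \<phi>'_def by auto
    next
      case 2
      then have "\<phi> e \<noteq> c"
        using v ef cx[of e] cy[of e] by auto
      then show ?thesis using 2 ef unfolding \<phi>'_def by auto
    next
      case 3
      then show ?thesis
        using proper[of e f v] ef v unfolding \<phi>'_def by auto
    qed
  qed (rule z)
  show "\<phi>' {x, y} = c" "\<And>e. e \<noteq> {x, y} \<Longrightarrow> \<phi>' e = \<phi> e"
    unfolding \<phi>'_def by auto
  have \<phi>'_eq: "\<phi>' e = (if e = {x, y} then c else \<phi> e)" for e
    unfolding \<phi>'_def by simp
  let ?R = "\<lambda>v. {e \<in> E. v \<in> e \<and> e \<noteq> {x, y} \<and> e \<noteq> {x, z}}"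
  have R: "\<phi>' ` ?R v = \<phi> ` ?R v" for v
    by (rule image_cong) (auto simp: \<phi>'_eq)
  have "{e \<in> E - {{x, z}}. x \<in> e} = insert {x, y} (?R x)"
    "{e \<in> E - {{x, y}}. x \<in> e} = insert {x, z} (?R x)"
    using E z xzy by auto
  then show "M x z \<phi>' x = M x y \<phi> x"
    unfolding M_image by (simp only: image_insert R) (simp add: \<phi>'_eq z)
  have "{e \<in> E - {{x, z}}. y \<in> e} = insert {x, y} (?R y)" "{e \<in> E - {{x, y}}. y \<in> e} = ?R y"
    using E z xzy ne by auto
  then show "M x z \<phi>' y = M x y \<phi> y - {c}"
    unfolding M_image by (simp only: image_insert R) (auto simp add: \<phi>'_eq z)
  have "{e \<in> E - {{x, z}}. z \<in> e} = ?R z" "{e \<in> E - {{x, y}}. z \<in> e} = insert {x, z} (?R z)"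
    using E z xzy ne by auto
  moreover have "c \<notin> \<phi> ` ?R z"
    using cz by auto
  ultimately show "M x z \<phi>' z = insert c (M x y \<phi> z)"
    unfolding M_image using ck z(3) by (simp only: image_insert R) auto
  show "M x z \<phi>' v = M x y \<phi> v" if "v \<noteq> x" "v \<noteq> y" "v \<noteq> z" for v
    using that by (intro M_other) (auto simp: \<phi>'_eq)
qed

lemma recolor:
  assumes st: "st x y \<phi>" and uv: "{u, v} \<in> E" "{u, v} \<noteq> {x, y}"
    and c: "c \<in> M x y \<phi> u" "c \<in> M x y \<phi> v"
  defines "\<phi>' \<equiv> \<phi>({u, v} := c)"
  shows "st x y \<phi>'" "\<phi> {u, v} \<in> M x y \<phi>' u" "\<phi> {u, v} \<in> M x y \<phi>' v"
    "\<And>d w. d \<in> M x y \<phi> w \<Longrightarrow> d \<noteq> c \<Longrightarrow> d \<in> M x y \<phi>' w"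
    "\<And>w. w \<noteq> u \<Longrightarrow> w \<noteq> v \<Longrightarrow> M x y \<phi>' w = M x y \<phi> w"
    "\<phi>' {u, v} = c" "\<And>e. e \<noteq> {u, v} \<Longrightarrow> \<phi>' e = \<phi> e"
proof -
  note ck = M_less[OF c(1)]
  have E: "{x, y} \<in> E" and col: "edge_coloring k (E - {{x, y}}) \<phi>"
    using st by (auto simp add: st_def)
  have proper: "\<phi> e \<noteq> \<phi> f" if "e \<in> E" "f \<in> E" "e \<noteq> {x, y}" "f \<noteq> {x, y}" "e \<noteq> f" "v \<in> e" "v \<in> f" for e f v
    using st_proper[OF st that] .
  have cu: "\<phi> e \<noteq> c" if "e \<in> E" "e \<noteq> {x, y}" "u \<in> e \<or> v \<in> e" for e
    using c that unfolding M_def missing_def by auto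
  have \<phi>'_eq: "\<phi>' e = (if e = {u, v} then c else \<phi> e)" for e
    unfolding \<phi>'_def by simp
  have ne: "u \<noteq> v"
    using uv edge_neq by auto
  have iff: "d \<in> M p q \<psi> v \<longleftrightarrow> d < k \<and> (\<forall>e. e \<in> E \<longrightarrow> e \<noteq> {p, q} \<longrightarrow> v \<in> e \<longrightarrow> \<psi> e \<noteq> d)" for d p q \<psi> v
    unfolding M_def missing_def by auto
  show "st x y \<phi>'"
    unfolding st_def edge_coloring_def
  proof (intro conjI ballI impI)
    fix e assume "e \<in> E - {{x, y}}"
    then show "\<phi>' e < k"
      using st_color_less[OF st] ck unfolding \<phi>'_def by auto
  next
    fix e f assume ef: "e \<in> E - {{x, y}}" "f \<in> E - {{x, y}}" "e \<noteq> f" "e \<inter> f \<noteq> {}"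
    then obtain w where w: "w \<in> e" "w \<in> f" by auto
    consider "e = {u, v}" | "f = {u, v}" | "e \<noteq> {u, v}" "f \<noteq> {u, v}" by auto
    then show "\<phi>' e \<noteq> \<phi>' f"
    proof cases
      case 1
      then have "\<phi> f \<noteq> c" using w ef cu[of f] by auto
      then show ?thesis using 1 ef by (auto simp: \<phi>'_eq)
    next
      case 2
      then have "\<phi> e \<noteq> c" using w ef cu[of e] by auto
      then show ?thesis using 2 ef by (auto simp: \<phi>'_eq)
    next
      case 3
      then show ?thesis
        using proper[of e f w] ef w by (auto simp: \<phi>'_eq)
    qed
  qed (rule E)
  have pk: "\<phi> {u, v} < k"
    using st_color_less[OF st uv] .
  have pc: "\<phi> {u, v} \<noteq> c"
    using cu[of "{u, v}"] uv by simp
  have "\<phi>' e \<noteq> \<phi> {u, v}" if "e \<in> E" "e \<noteq> {x, y}" "w \<in> e" "w = u \<or> w = v" for e w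
    using that proper[of e "{u, v}" w] uv pc by (auto simp: \<phi>'_eq)
  then show "\<phi> {u, v} \<in> M x y \<phi>' u" "\<phi> {u, v} \<in> M x y \<phi>' v"
    unfolding iff using pk by auto
  show "d \<in> M x y \<phi>' w" if "d \<in> M x y \<phi> w" "d \<noteq> c" for d w
    using that unfolding iff \<phi>'_eq by auto
  show "M x y \<phi>' w = M x y \<phi> w" if "w \<noteq> u" "w \<noteq> v" for w
    using that by (intro M_other) (auto simp: \<phi>'_eq)
qed (auto simp: \<phi>'_def)

text \<open>Moving the uncoloured edge to \<open>{y, w}\<close> loses no missing colour at
  \<open>y\<close> or at \<open>w\<close>, and there \<open>M_disjoint\<close> applies to these two
  vertices.\<close>

lemma fan_disjoint_aux:
  assumes st: "st x y \<phi>" and a: "a \<in> M x y \<phi> x" and w: "{y, w} \<in> E" "w \<noteq> x" "\<phi> {y, w} = a"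
  shows "M x y \<phi> w \<inter> M x y \<phi> y = {}"
proof -
  note s = shift[OF st_sym[OF st] _ w, unfolded M_sym[of y x], OF a]
  show ?thesis
    using M_disjoint[OF s(1)] s(2,4) by auto
qed

text \<open>If \<open>w\<close> and \<open>x\<close> both missed \<open>g\<close>, a swap at
  \<open>w\<close> with a colour \<open>e\<close> missing at \<open>y\<close> would make
  \<open>w\<close> and \<open>y\<close> both miss \<open>e\<close>, with \<open>{y, w}\<close> still
  coloured \<open>a\<close>. The degree bound then counts three disjoint missing sets inside
  \<open>k\<close> colours.\<close>

lemma fan_disjoint:
  assumes st: "st x y \<phi>" and a: "a \<in> M x y \<phi> x" and w: "{y, w} \<in> E" "w \<noteq> x" "\<phi> {y, w} = a"
  shows "M x y \<phi> w \<inter> M x y \<phi> y = {}" "M x y \<phi> w \<inter> M x y \<phi> x = {}"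
    "deg w + deg x + deg y \<ge> 2 * k + 2"
proof -
  show 1: "M x y \<phi> w \<inter> M x y \<phi> y = {}"
    using fan_disjoint_aux[OF assms] .
  have wy: "w \<noteq> y"
    using edge_neq w by auto
  show 2: "M x y \<phi> w \<inter> M x y \<phi> x = {}"
  proof (rule ccontr)
    assume "M x y \<phi> w \<inter> M x y \<phi> x \<noteq> {}"
    then obtain g where g: "g \<in> M x y \<phi> w" "g \<in> M x y \<phi> x" by auto
    obtain e where e: "e \<in> M x y \<phi> y"
      using M_nonempty[OF st_sym[OF st]] M_sym by metis
    obtain \<phi>' where "kempe_swapped x y g e w \<phi> \<phi>'"
      using kempe_swap_away[OF st g(2) e w(2) wy] g(1) by blast
    note \<phi>' = kempe_swappedD[OF this]
    have "\<phi>' {y, w} = a"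
      using \<phi>'(3)[of "{y, w}"] w by (auto simp: doubleton_eq_iff)
    moreover have "e \<in> M x y \<phi>' w"
      using \<phi>'(10) g(1) .
    ultimately show False
      using fan_disjoint_aux[OF \<phi>'(1) _ w(1,2)] a e \<phi>'(5,6) by auto
  qed
  have "card (M x y \<phi> w \<union> (M x y \<phi> x \<union> M x y \<phi> y)) \<le> card {..<k}"
    using M_subset by (intro card_mono) auto
  moreover have "card (M x y \<phi> w \<union> (M x y \<phi> x \<union> M x y \<phi> y)) =
      card (M x y \<phi> w) + (card (M x y \<phi> x) + card (M x y \<phi> y))"
    using 1 2 M_disjoint[OF st] by (subst card_Un_disjoint; (subst card_Un_disjoint)?) auto
  ultimately show "deg w + deg x + deg y \<ge> 2 * k + 2"
    using card_M(1,2)[OF st] card_M(3)[OF st, of w] w(2) wy by simp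
qed

text \<open>With \<open>{y, w}\<close> uncoloured instead, a common colour \<open>g\<close> is
  missing at an end of the uncoloured edge, so at \<open>v\<close> it can be exchanged for a colour
  \<open>e\<close> missing at \<open>y\<close>. After the edge is moved back, \<open>v\<close> and
  \<open>y\<close> both miss \<open>e\<close>, while \<open>{y, v}\<close> still has the colour
  \<open>b\<close> missing at \<open>x\<close>; this contradicts
  \<open>fan_disjoint\<close>.\<close>

lemma fan_disjoint_pair:
  assumes st: "st x y \<phi>" and ab: "a \<in> M x y \<phi> x" "b \<in> M x y \<phi> x"
    and w: "{y, w} \<in> E" "w \<noteq> x" "\<phi> {y, w} = a" and v: "{y, v} \<in> E" "v \<noteq> x" "\<phi> {y, v} = b"
    and ne: "w \<noteq> v"
  shows "M x y \<phi> w \<inter> M x y \<phi> v = {}"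
proof (rule ccontr)
  assume "M x y \<phi> w \<inter> M x y \<phi> v \<noteq> {}"
  then obtain g where g: "g \<in> M x y \<phi> w" "g \<in> M x y \<phi> v" by auto
  obtain e where e: "e \<in> M x y \<phi> y"
    using M_nonempty[OF st_sym[OF st]] M_sym by metis
  have neq: "w \<noteq> y" "v \<noteq> y" "x \<noteq> y"
    using edge_neq w v st unfolding st_def by auto
  have yvyx: "{y, v} \<noteq> {x, y}" "{y, w} \<noteq> {x, y}" "{y, v} \<noteq> {y, w}" "{y, x} \<noteq> {y, w}" "{y, v} \<noteq> {y, x}"
    using v w neq ne by (auto simp: doubleton_eq_iff)
  have "a \<noteq> b"
    using st_eq[OF st w(1) v(1)] yvyx w v ne by auto
  \<comment> \<open>Since \<open>b\<close> is none of the swapped colours \<open>e\<close> and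
    \<open>g\<close>, it stays missing at \<open>x\<close> during the swap.\<close>
  have be: "b \<noteq> e"
    using M_D[OF e v(1) yvyx(1)] v by auto
  have bg: "b \<noteq> g"
    using M_D[OF g(2), of y] v yvyx by (auto simp: insert_commute)
  define \<phi>1 where "\<phi>1 = \<phi>({y, x} := a)"
  note s = shift[OF st_sym[OF st] _ w, unfolded M_sym[of y x], OF ab(1), folded \<phi>1_def]
  have e1: "e \<in> M y w \<phi>1 y" and g1: "g \<in> M y w \<phi>1 w" "g \<in> M y w \<phi>1 v"
    using s(2,4) s(5)[of v] e g neq ne v by auto
  obtain \<phi>2 where "kempe_swapped y w e g v \<phi>1 \<phi>2"
      using kempe_swap_away[OF s(1) e1 g1(1) neq(2) ne[symmetric]] g1(2) by blast
    note \<phi>2 = kempe_swappedD[OF this]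
  have E: "{y, x} \<in> E"
    using st unfolding st_def by (simp add: insert_commute)
  have e2: "e \<in> M y w \<phi>2 v"
    using \<phi>2(11) g1(2) .
  have "b \<in> M y w \<phi>1 x"
    using s(3) ab \<open>a \<noteq> b\<close> by auto
  then have b2: "b \<in> M y w \<phi>2 x"
    using \<phi>2(9)[of b x] be bg by simp
  have a2: "a \<in> M y w \<phi>2 w" "\<phi>2 {y, x} = a"
    using \<phi>2(3)[of "{y, x}"] E yvyx \<phi>2(6) s(4,6) by auto
  define \<phi>3 where "\<phi>3 = \<phi>2({y, w} := a)"
  note t = shift[OF \<phi>2(1) a2(1) E w(2)[symmetric] a2(2), folded \<phi>3_def]
  have "\<phi>3 {y, v} = b"
    using t(7)[of "{y, v}"] \<phi>2(3)[of "{y, v}"] s(7)[of "{y, v}"] yvyx v by auto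
  moreover have "b \<in> M y x \<phi>3 x" "e \<in> M y x \<phi>3 y" "e \<in> M y x \<phi>3 v"
    using t(2,4,5) b2 e2 e1 \<phi>2(5) neq ne v by auto
  ultimately show False
    using fan_disjoint(1)[OF st_sym[OF t(1)] _ v(1,2)] by (auto simp: M_sym[of x y])
qed

text \<open>Below the degree bound of \<open>fan_disjoint\<close> the three missing sets have at
  least \<open>k + 1\<close> elements in total, so they overlap, and only at \<open>w\<close> since
  \<open>x\<close> and \<open>y\<close> share nothing. If some colour is missing at none of the
  three, only \<open>k - 1\<close> colours are available and the overlap has at least two
  elements.\<close>

lemma card_missing_low:
  assumes st: "st x y \<phi>" and w: "w \<noteq> x" "w \<noteq> y" and low: "deg w + deg x + deg y \<le> 2 * k + 1"
  shows "M x y \<phi> w \<inter> (M x y \<phi> x \<union> M x y \<phi> y) \<noteq> {}"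
    "\<And>c. c < k \<Longrightarrow> c \<notin> M x y \<phi> w \<Longrightarrow> c \<notin> M x y \<phi> x \<Longrightarrow> c \<notin> M x y \<phi> y \<Longrightarrow>
      card (M x y \<phi> w \<inter> (M x y \<phi> x \<union> M x y \<phi> y)) \<ge> 2"
proof -
  let ?A = "M x y \<phi> w" and ?B = "M x y \<phi> x \<union> M x y \<phi> y"
  have B: "card ?B = card (M x y \<phi> x) + card (M x y \<phi> y)"
    using M_disjoint[OF st] by (simp add: card_Un_disjoint)
  have "card ?A + card ?B = card (?A \<union> ?B) + card (?A \<inter> ?B)"
    by (rule card_Un_Int) auto
  then have *: "card (?A \<union> ?B) + card (?A \<inter> ?B) \<ge> k + 1"
    using B card_M(1,2)[OF st] card_M(3)[OF st, of w] w low by linarith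
  have "card (?A \<union> ?B) \<le> card {..<k}"
    using M_subset by (intro card_mono) auto
  then have "card (?A \<inter> ?B) > 0"
    using * by simp
  then show "?A \<inter> ?B \<noteq> {}" by force
  fix c assume c: "c < k" "c \<notin> ?A" "c \<notin> M x y \<phi> x" "c \<notin> M x y \<phi> y"
  then have "?A \<union> ?B \<subseteq> {..<k} - {c}"
    using M_subset by blast
  then have "card (?A \<union> ?B) \<le> card ({..<k} - {c})"
    by (intro card_mono) auto
  then show "card (?A \<inter> ?B) \<ge> 2"
    using * c(1) by simp
qed

text \<open>A relative of Vizing's adjacency lemma. \<open>H\<close> is the fan at \<open>y\<close>:
  the vertices reached from \<open>y\<close> by the colours missing at \<open>x\<close>. The missing
  sets of \<open>x\<close>, \<open>y\<close> and all vertices of \<open>H\<close> are pairwise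
  disjoint, and counting them gives the bound on the sum.\<close>

lemma adjacency:
  assumes xy: "{x, y} \<in> E"
  obtains H where "finite H" "\<And>z. z \<in> H \<Longrightarrow> {y, z} \<in> E \<and> z \<noteq> x" "card H + deg x = k + 1"
    "(\<Sum>z\<in>H. k - deg z) + 2 * (k + 1) \<le> k + deg x + deg y"
    "\<And>z. z \<in> H \<Longrightarrow> deg z + deg x + deg y \<ge> 2 * k + 2"
proof -
  obtain \<phi> where st: "st x y \<phi>"
    using coloring_minus[OF xy] xy unfolding st_def by auto
  have "\<exists>w. {y, w} \<in> E \<and> w \<noteq> x \<and> \<phi> {y, w} = a" if a: "a \<in> M x y \<phi> x" for a
  proof -
    have "a \<notin> M x y \<phi> y"
      using a M_disjoint[OF st] by auto
    then obtain w where "{y, w} \<in> E" "{y, w} \<noteq> {x, y}" "\<phi> {y, w} = a"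
      using not_M_obtain[OF M_less[OF a]] by metis
    then show ?thesis
      by (auto simp: insert_commute)
  qed
  then obtain f where f: "\<And>a. a \<in> M x y \<phi> x \<Longrightarrow> {y, f a} \<in> E \<and> f a \<noteq> x \<and> \<phi> {y, f a} = a"
    by metis
  let ?H = "f ` M x y \<phi> x"
  have inj: "inj_on f (M x y \<phi> x)"
    using f by (metis inj_onI)
  have cardM: "card (M x y \<phi> z) = k - deg z" if "z \<in> ?H" for z
  proof -
    have "z \<noteq> x" "z \<noteq> y"
      using that f edge_neq by auto
    then show ?thesis
      using card_M(3)[OF st, of z] by simp
  qed
  let ?U = "\<Union>z\<in>?H. M x y \<phi> z"
  have "card ?U = (\<Sum>z\<in>?H. card (M x y \<phi> z))"
  proof (rule card_UN_disjoint)
    show "\<forall>i\<in>?H. \<forall>j\<in>?H. i \<noteq> j \<longrightarrow> M x y \<phi> i \<inter> M x y \<phi> j = {}"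
    proof (intro ballI impI)
      fix i j assume "i \<in> ?H" "j \<in> ?H" "i \<noteq> j"
      then obtain a b where ab: "a \<in> M x y \<phi> x" "b \<in> M x y \<phi> x" "i = f a" "j = f b" by auto
      show "M x y \<phi> i \<inter> M x y \<phi> j = {}"
        using fan_disjoint_pair[OF st ab(1,2), of "f a" "f b"] f[OF ab(1)] f[OF ab(2)] ab \<open>i \<noteq> j\<close>
        by simp
    qed
  qed auto
  also have "\<dots> = (\<Sum>z\<in>?H. k - deg z)"
    using cardM by (intro sum.cong) auto
  finally have cU: "card ?U = (\<Sum>z\<in>?H. k - deg z)" .
  have disj: "?U \<inter> (M x y \<phi> x \<union> M x y \<phi> y) = {}"
  proof -
    have "M x y \<phi> (f a) \<inter> (M x y \<phi> x \<union> M x y \<phi> y) = {}" if "a \<in> M x y \<phi> x" for a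
      using fan_disjoint(1,2)[OF st that, of "f a"] f[OF that] by blast
    then show ?thesis by blast
  qed
  have "card (?U \<union> (M x y \<phi> x \<union> M x y \<phi> y)) \<le> card {..<k}"
    by (intro card_mono) (auto dest: M_less)
  moreover have "card (?U \<union> (M x y \<phi> x \<union> M x y \<phi> y)) = card ?U + (card (M x y \<phi> x) + card (M x y \<phi> y))"
    using disj M_disjoint[OF st] by (subst card_Un_disjoint; (subst card_Un_disjoint)?) auto
  ultimately have le: "card ?U + (card (M x y \<phi> x) + card (M x y \<phi> y)) \<le> k"
    by simp
  show thesis
  proof (rule that)
    show "card ?H + deg x = k + 1"
      using card_image[OF inj] card_M(1)[OF st] by simp
    show "(\<Sum>z\<in>?H. k - deg z) + 2 * (k + 1) \<le> k + deg x + deg y"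
      using le card_M(1,2)[OF st] unfolding cU[symmetric] by presburger
    show "deg z + deg x + deg y \<ge> 2 * k + 2" if z: "z \<in> ?H" for z
    proof -
      obtain a where a: "a \<in> M x y \<phi> x" "z = f a"
        using z by auto
      then show ?thesis
        using fan_disjoint(3)[OF st a(1), of "f a"] f[OF a(1)] by simp
    qed
  qed (use f in auto)
qed

section \<open>Colours that are bad at two neighbours of \<open>x\<close>\<close>

text \<open>The aim is to give \<open>{y, w}\<close> a colour missing at \<open>x\<close> while
  \<open>{x, y}\<close> is uncoloured, which the low degree of \<open>w\<close> forbids. With
  \<open>{x, y}\<close> uncoloured, \<open>w\<close> can be made to share a missing colour
  \<open>a\<close> with \<open>x\<close>. With \<open>{x, z}\<close> uncoloured, \<open>a\<close>
  and \<open>c'\<close> are missing at its ends, so a swap at \<open>w\<close> turns the colour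
  \<open>c'\<close> of \<open>{y, w}\<close> into \<open>a\<close>. Moving the edge back to
  \<open>{x, y}\<close> gives the contradiction.\<close>

lemma bad_pair_missing:
  assumes st: "st x z \<phi>" and c: "c \<in> M x z \<phi> z" and y: "{x, y} \<in> E" "y \<noteq> z" "\<phi> {x, y} = c"
    and c': "c' \<in> M x z \<phi> z" "c' \<noteq> c"
    and w: "{y, w} \<in> E" "w \<noteq> x" "\<phi> {y, w} = c'" and low: "deg w + deg x + deg y \<le> 2 * k + 1"
  shows False
proof -
  have neq: "x \<noteq> y" "x \<noteq> z" "w \<noteq> y"
    using y st w edge_neq unfolding st_def by auto
  have xyz: "{x, y} \<noteq> {x, z}" "{y, w} \<noteq> {x, z}" "{y, w} \<noteq> {x, y}"
    using y neq w by (auto simp: doubleton_eq_iff)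
  have "w \<noteq> z"
    using M_D[OF c'(1), of y] w xyz(2) insert_commute[of y z "{}"] by metis
  have xz: "{x, z} \<in> E"
    using st unfolding st_def by simp
  define \<phi>0 where "\<phi>0 = \<phi>({x, z} := c)"
  note s = shift[OF st c y, folded \<phi>0_def]
  have w0: "\<phi>0 {y, w} = c'"
    using s(7) xyz w by auto
  have c'0: "c' \<in> M x y \<phi>0 z" "c' \<notin> M x y \<phi>0 x" "c' \<notin> M x y \<phi>0 y"
    using s(2,3) c' M_disjoint[OF st] M_D[of c' x y \<phi>0 y w] w w0 xyz by auto
  have "\<exists>\<phi>1 a. st x y \<phi>1 \<and> a \<in> M x y \<phi>1 x \<and> a \<in> M x y \<phi>1 w \<and> c \<in> M x y \<phi>1 y \<and> \<phi>1 {x, z} = c \<and>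
      c' \<in> M x y \<phi>1 z \<and> \<phi>1 {y, w} = c'"
  proof -
    obtain g where g: "g \<in> M x y \<phi>0 w" "g \<in> M x y \<phi>0 x \<or> g \<in> M x y \<phi>0 y"
      using card_missing_low(1)[OF s(1) w(2) neq(3) low] by auto
    show ?thesis
    proof (cases "g \<in> M x y \<phi>0 x")
      case True
      then show ?thesis
        using s(1,4,6) c'0 w0 g(1) by blast
    next
      case False
      obtain a where a: "a \<in> M x y \<phi>0 x"
        using M_nonempty[OF s(1)] .
      have g': "g \<in> M x y \<phi>0 y" using False g by auto
      obtain \<phi>1 where "kempe_swapped x y a g w \<phi>0 \<phi>1"
      using kempe_swap_away[OF s(1) a g' w(2) neq(3)] g(1) by blast
    note \<phi>1 = kempe_swappedD[OF this]
      have "c' \<noteq> a" "c' \<noteq> g"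
        using c'0 a g' by auto
      then have "c' \<in> M x y \<phi>1 z"
        using \<phi>1(9)[of c' z] c'0(1) by simp
      moreover have "a \<in> M x y \<phi>1 w"
        using \<phi>1(11) g(1) .
      moreover have "\<phi>1 {x, z} = c" "\<phi>1 {y, w} = c'"
        using \<phi>1(3)[of "{x, z}"] \<phi>1(3)[of "{y, w}"] xz w xyz s(6) w0 by auto
      ultimately show ?thesis
        using \<phi>1(1) a[folded \<phi>1(5)] s(4)[folded \<phi>1(6)] by blast
    qed
  qed
  then obtain \<phi>1 a where \<phi>1: "st x y \<phi>1" "a \<in> M x y \<phi>1 x" "a \<in> M x y \<phi>1 w" "c \<in> M x y \<phi>1 y"
    "\<phi>1 {x, z} = c" "c' \<in> M x y \<phi>1 z" "\<phi>1 {y, w} = c'"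
    by blast
  define \<phi>2 where "\<phi>2 = \<phi>1({x, y} := c)"
  note t = shift[OF \<phi>1(1,4) xz y(2)[symmetric] \<phi>1(5), folded \<phi>2_def]
  have 2: "a \<in> M x z \<phi>2 x" "c' \<in> M x z \<phi>2 z" "a \<in> M x z \<phi>2 w" "c \<in> M x z \<phi>2 z" "\<phi>2 {y, w} = c'"
    using t(2,4,5,7) \<phi>1 w neq \<open>w \<noteq> z\<close> xyz by auto
  obtain \<phi>3 where "kempe_swapped x z a c' w \<phi>2 \<phi>3"
      using kempe_swap_away[OF t(1) 2(1) 2(2) w(2) \<open>w \<noteq> z\<close>] 2(3) by blast
    note \<phi>3 = kempe_swappedD[OF this]
  have 3: "\<phi>3 {y, w} = a" "\<phi>3 {x, y} = c" "c \<in> M x z \<phi>3 z"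
    using \<phi>3(3)[of "{x, y}"] \<phi>3(4)[of "{y, w}"] \<phi>3(6) w xyz y 2 t(6) by auto
  define \<phi>4 where "\<phi>4 = \<phi>3({x, z} := c)"
  note r = shift[OF \<phi>3(1) 3(3) y(1,2) 3(2), folded \<phi>4_def]
  have "a \<in> M x y \<phi>4 x" "\<phi>4 {y, w} = a"
    using r(2,7) \<phi>3(5) 2(1) 3(1) xyz by auto
  then show False
    using fan_disjoint(3)[OF r(1) _ w(1,2)] low by auto
qed

text \<open>Recolouring \<open>{z, u}\<close> by \<open>c\<close> frees \<open>c'\<close> at \<open>z\<close>. A Kempe change at \<open>w\<close> then turns the colour
  \<open>c'\<close> of \<open>{y, w}\<close> into \<open>a\<close>, after which \<open>u\<close> can be made to miss \<open>c'\<close> again, \<open>{z, u}\<close> gets back its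
  colour and \<open>c\<close> is free at \<open>z\<close>; now \<open>{y, w}\<close> has a colour missing at \<open>x\<close>, contradicting the fan
  property.\<close>

lemma bad_pair_final:
  assumes st: "st x z \<phi>" and c: "c \<in> M x z \<phi> z" and y: "{x, y} \<in> E" "y \<noteq> z" "\<phi> {x, y} = c"
    and w: "{y, w} \<in> E" "w \<noteq> x" "\<phi> {y, w} = c'" and low: "deg w + deg x + deg y \<le> 2 * k + 1"
    and u: "{z, u} \<in> E" "u \<noteq> x" "\<phi> {z, u} = c'"
    and neq: "w \<noteq> z" "u \<noteq> y" "u \<noteq> w" and c': "c' \<noteq> c" "c' \<notin> M x z \<phi> x"
    and cb: "c \<in> M x z \<phi> u" "b \<in> M x z \<phi> u" "b \<in> M x z \<phi> x"
    and a: "a \<in> M x z \<phi> x" "a \<in> M x z \<phi> w"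
  shows False
proof -
  have neq': "x \<noteq> y" "x \<noteq> z" "w \<noteq> y" "u \<noteq> z"
    using y st w u edge_neq unfolding st_def by auto
  have ed: "{x, y} \<noteq> {x, z}" "{y, w} \<noteq> {x, z}" "{y, w} \<noteq> {x, y}" "{z, u} \<noteq> {x, z}" "{x, y} \<noteq> {z, u}"
    "{y, w} \<noteq> {z, u}"
    using y neq neq' w u by (auto simp: doubleton_eq_iff)
  have bc: "b \<noteq> c"
    using cb c M_disjoint[OF st] by auto
  have abc': "a \<noteq> c'" "b \<noteq> c'"
    using a cb c' by auto
  define \<phi>1 where "\<phi>1 = \<phi>({z, u} := c)"
  note r1 = recolor[OF st u(1) ed(4) c cb(1), folded \<phi>1_def, unfolded u(3)]
  have x1: "M x z \<phi>1 x = M x z \<phi> x"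
    using r1(5)[of x] neq' u by auto
  have w1: "M x z \<phi>1 w = M x z \<phi> w"
    using r1(5)[of w] neq by auto
  have b1: "b \<in> M x z \<phi>1 u"
    using r1(4)[OF cb(2) bc] .
  have e1: "\<phi>1 {y, w} = c'" "\<phi>1 {x, y} = c"
    using r1(7) ed w y by auto
  have a1: "a \<in> M x z \<phi>1 x" "a \<in> M x z \<phi>1 w"
    using a x1 w1 by auto
  obtain \<phi>2 where "kempe_swapped x z a c' w \<phi>1 \<phi>2"
      using kempe_swap_away[OF r1(1) a1(1) r1(2) w(2) neq(1)] a1(2) by blast
    note \<phi>2 = kempe_swappedD[OF this]
  have e2: "\<phi>2 {y, w} = a" "\<phi>2 {x, y} = c" "\<phi>2 {z, u} = c"
    using \<phi>2(4)[of "{y, w}"] \<phi>2(3)[of "{x, y}"] \<phi>2(3)[of "{z, u}"] ed y w u e1 r1(6) by auto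
  \<comment> \<open>The chain of \<open>w\<close> may have passed through \<open>u\<close>. In that
    case \<open>u\<close> has kept \<open>b\<close> as a missing colour, unless
    \<open>b = a\<close>, when \<open>b\<close> has been turned into \<open>c'\<close>.\<close>
  have u2: "c' \<in> M x z \<phi>2 u \<or> b \<in> M x z \<phi>2 u \<and> b \<noteq> a"
  proof (cases "M x z \<phi>2 u = M x z \<phi>1 u")
    case True
    show ?thesis unfolding True using r1(3) by blast
  next
    case False
    then have "M x z \<phi>2 u = transpose a c' ` M x z \<phi>1 u"
      using \<phi>2(8) by blast
    moreover have "transpose a c' b \<in> transpose a c' ` M x z \<phi>1 u"
      using b1 by simp
    ultimately show ?thesis
      using abc' by (cases "b = a") auto
  qed
  have z2: "c' \<in> M x z \<phi>2 z"
    using r1(2) unfolding \<phi>2(6) .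
  have "\<exists>\<phi>3. st x z \<phi>3 \<and> c' \<in> M x z \<phi>3 u \<and> c' \<in> M x z \<phi>3 z \<and> a \<in> M x z \<phi>3 x \<and>
      \<phi>3 {y, w} = a \<and> \<phi>3 {x, y} = c \<and> \<phi>3 {z, u} = c"
  proof (cases "c' \<in> M x z \<phi>2 u")
    case True
    then show ?thesis
      using \<phi>2(1) a1(1)[folded \<phi>2(5)] z2 e2 by blast
  next
    case False
    then have b2: "b \<in> M x z \<phi>2 u" "b \<noteq> a" "b \<in> M x z \<phi>2 x"
      using u2 cb(3) unfolding \<phi>2(5) x1 by blast+
    obtain \<phi>3 where "kempe_swapped x z b c' u \<phi>2 \<phi>3"
      using kempe_swap_away[OF \<phi>2(1) b2(3) z2 u(2) neq'(4)] b2(1) by blast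
    note \<phi>3 = kempe_swappedD[OF this]
    have "c' \<in> M x z \<phi>3 u"
      using \<phi>3(10) b2(1) .
    moreover have "\<phi>3 {y, w} = a"
      using \<phi>3(2)[of "{y, w}"] e2 w ed b2 abc' by auto
    moreover have "\<phi>3 {x, y} = c" "\<phi>3 {z, u} = c"
      using \<phi>3(3)[of "{x, y}"] \<phi>3(3)[of "{z, u}"] e2 y u ed by auto
    ultimately show ?thesis
      using \<phi>3(1) z2[folded \<phi>3(6)] a1(1)[folded \<phi>2(5), folded \<phi>3(5)] by blast
  qed
  then obtain \<phi>3 where \<phi>3: "st x z \<phi>3" "c' \<in> M x z \<phi>3 u" "c' \<in> M x z \<phi>3 z" "a \<in> M x z \<phi>3 x"
      "\<phi>3 {y, w} = a" "\<phi>3 {x, y} = c" "\<phi>3 {z, u} = c"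
    by blast
  define \<phi>4 where "\<phi>4 = \<phi>3({z, u} := c')"
  note r4 = recolor[OF \<phi>3(1) u(1) ed(4) \<phi>3(3,2), folded \<phi>4_def, unfolded \<phi>3(7)]
  have 4: "a \<in> M x z \<phi>4 x" "\<phi>4 {x, y} = c" "\<phi>4 {y, w} = a"
    using r4(4)[OF \<phi>3(4) abc'(1)] r4(7) ed \<phi>3 by auto
  define \<phi>5 where "\<phi>5 = \<phi>4({x, z} := c)"
  note s = shift[OF r4(1,2) y(1,2) 4(2), folded \<phi>5_def]
  have "a \<in> M x y \<phi>5 x" "\<phi>5 {y, w} = a"
    using s(2,7) 4 ed by auto
  then show False
    using fan_disjoint(3)[OF s(1) _ w(1,2)] low by auto
qed

text \<open>For an end \<open>v\<close> of an edge at \<open>x\<close>: a colour below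
  \<open>k\<close> that is not bad at \<open>v\<close> leads from \<open>v\<close> either to
  \<open>x\<close> or to a vertex whose degree meets the bound of
  \<open>fan_disjoint\<close>.\<close>

definition bad :: "'a \<Rightarrow> 'a \<Rightarrow> ('a set \<Rightarrow> nat) \<Rightarrow> 'a \<Rightarrow> 'a \<Rightarrow> nat \<Rightarrow> bool" where
  "bad p q \<phi> x v c \<longleftrightarrow> c \<in> M p q \<phi> v \<or>
     (\<exists>w. {v, w} \<in> E \<and> w \<noteq> x \<and> \<phi> {v, w} = c \<and> deg w + deg x + deg v \<le> 2 * k + 1)"

text \<open>The first two arguments name the uncoloured edge; badness at \<open>v\<close> survives moving that edge
  to another edge at \<open>x\<close>.\<close>

lemma bad_shift:
  assumes st: "st x z \<phi>" and c: "c \<in> M x z \<phi> z" and y: "{x, y} \<in> E" "y \<noteq> z" "\<phi> {x, y} = c"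
    and ne: "c' \<noteq> c"
  shows "bad x z \<phi> x y c' \<Longrightarrow> bad x y (\<phi>({x, z} := c)) x y c'"
    "bad x z \<phi> x z c' \<Longrightarrow> bad x y (\<phi>({x, z} := c)) x z c'"
proof -
  note s = shift[OF st c y]
  have xz: "x \<noteq> z" "x \<noteq> y"
    using st y edge_neq unfolding st_def by auto
  have *: "{v, w} \<noteq> {x, z}" if "w \<noteq> x" "v \<noteq> x" for v w
    using that by (auto simp: doubleton_eq_iff)
  show "bad x z \<phi> x y c' \<Longrightarrow> bad x y (\<phi>({x, z} := c)) x y c'"
    unfolding bad_def s(4) using s(7)[OF *] xz by (metis insertCI)
  show "bad x z \<phi> x z c' \<Longrightarrow> bad x y (\<phi>({x, z} := c)) x z c'"
    unfolding bad_def s(3) using s(7)[OF *] xz ne by (metis Diff_iff singletonD)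
qed

text \<open>As \<open>c'\<close> is missing at none of the three vertices,
  \<open>card_missing_low\<close> provides two shared colours, and at least one of them differs from
  a prescribed \<open>d\<close>.\<close>

lemma low_misses_other:
  assumes st: "st x z \<phi>" and c: "c \<in> M x z \<phi> z"
    and u: "u \<noteq> x" "u \<noteq> z" "deg u + deg x + deg z \<le> 2 * k + 1"
    and c': "c' < k" "c' \<notin> M x z \<phi> u" "c' \<notin> M x z \<phi> x" "c' \<notin> M x z \<phi> z"
  obtains g where "g \<in> M x z \<phi> u" "g \<in> M x z \<phi> x \<or> g \<in> M x z \<phi> z" "g \<noteq> d"
proof -
  let ?S = "M x z \<phi> u \<inter> (M x z \<phi> x \<union> M x z \<phi> z)"
  have "\<not> ?S \<subseteq> {d}"
    using card_missing_low(2)[OF st u c'] card_mono[of "{d}" ?S] by auto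
  then show thesis using that by blast
qed

text \<open>A second colour \<open>h\<close> missing at \<open>z\<close> makes it possible to free
  \<open>c'\<close> there: \<open>u\<close> shares with \<open>z\<close> a missing colour other than
  \<open>c\<close>, if necessary after a swap with \<open>h\<close>, and recolouring
  \<open>{z, u}\<close> with it makes \<open>c'\<close> missing at \<open>z\<close>. This is the
  case excluded by \<open>bad_pair_missing\<close>.\<close>

lemma bad_pair_reduce:
  assumes st: "st x z \<phi>" and c: "c \<in> M x z \<phi> z" and y: "{x, y} \<in> E" "y \<noteq> z" "\<phi> {x, y} = c"
    and w: "{y, w} \<in> E" "w \<noteq> x" "\<phi> {y, w} = c'" and low: "deg w + deg x + deg y \<le> 2 * k + 1"
    and u: "{z, u} \<in> E" "u \<noteq> x" "\<phi> {z, u} = c'" and lowu: "deg u + deg x + deg z \<le> 2 * k + 1"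
    and neq: "u \<noteq> y" and c': "c' \<noteq> c" "c' \<notin> M x z \<phi> x" "c' < k"
    and h: "h \<in> M x z \<phi> z" "h \<noteq> c"
  shows False
proof -
  have neq': "x \<noteq> y" "x \<noteq> z" "w \<noteq> y" "u \<noteq> z"
    using y st w u edge_neq unfolding st_def by auto
  have ed: "{x, y} \<noteq> {x, z}" "{y, w} \<noteq> {x, z}" "{y, w} \<noteq> {x, y}" "{z, u} \<noteq> {x, z}" "{x, y} \<noteq> {z, u}"
    "{y, w} \<noteq> {z, u}"
    using y neq neq' w u by (auto simp: doubleton_eq_iff)
  have c'z: "c' \<notin> M x z \<phi> z"
    using M_D[OF _ u(1) ed(4)] u(3) by blast
  have c'u: "c' \<notin> M x z \<phi> u"
    using M_D2[OF _ u(1) ed(4)] u(3) by blast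
  obtain g where g: "g \<in> M x z \<phi> u" "g \<in> M x z \<phi> x \<or> g \<in> M x z \<phi> z" "g \<noteq> c"
    using low_misses_other[OF st c u(2) neq'(4) lowu c'(3) c'u c'(2) c'z] .
  have xy_u: "{z, u} \<in> E" "{z, u} \<noteq> {x, z}"
    using u ed by auto
  have "\<exists>\<phi>1 f. st x z \<phi>1 \<and> f \<in> M x z \<phi>1 z \<and> f \<in> M x z \<phi>1 u \<and> f \<noteq> c \<and> c \<in> M x z \<phi>1 z \<and>
      \<phi>1 {x, y} = c \<and> \<phi>1 {y, w} = c' \<and> \<phi>1 {z, u} = c'"
  proof (cases "g \<in> M x z \<phi> z")
    case True
    then show ?thesis
      using st g(1,3) c y(3) w(3) u(3) by (intro exI[of _ \<phi>] exI[of _ g]) simp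
  next
    case False
    then have gx: "g \<in> M x z \<phi> x" using g by auto
    obtain \<phi>1 where "kempe_swapped x z g h u \<phi> \<phi>1"
      using kempe_swap_away[OF st gx h(1) u(2) neq'(4)] g(1) by blast
    note \<phi>1 = kempe_swappedD[OF this]
    have "c' \<noteq> g" "c' \<noteq> h"
      using gx h c' c'z by auto
    then have "\<phi>1 {y, w} = c'" "\<phi>1 {z, u} = c'" "\<phi>1 {x, y} = c"
      using \<phi>1(2)[of "{y, w}"] \<phi>1(2)[of "{z, u}"] \<phi>1(3)[of "{x, y}"] w u y ed by auto
    then show ?thesis
      using \<phi>1(1,6) h c \<phi>1(10)[OF g(1)] by (intro exI[of _ \<phi>1] exI[of _ h]) simp
  qed
  then obtain \<phi>1 f where \<phi>1: "st x z \<phi>1" "f \<in> M x z \<phi>1 z" "f \<in> M x z \<phi>1 u" "f \<noteq> c" "c \<in> M x z \<phi>1 z"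
      "\<phi>1 {x, y} = c" "\<phi>1 {y, w} = c'" "\<phi>1 {z, u} = c'"
    by blast
  define \<phi>2 where "\<phi>2 = \<phi>1({z, u} := f)"
  note r = recolor[OF \<phi>1(1) xy_u \<phi>1(2,3), folded \<phi>2_def, unfolded \<phi>1(8)]
  have "\<phi>2 {x, y} = c" "\<phi>2 {y, w} = c'" "c \<in> M x z \<phi>2 z"
    using r(7) ed \<phi>1 r(4)[OF \<phi>1(5) \<phi>1(4)[symmetric]] by auto
  then show False
    using bad_pair_missing[OF r(1) _ y(1,2) _ r(2) c'(1) w(1,2) _ low] by blast
qed

text \<open>By \<open>shift\<close> the situation is symmetric in \<open>y\<close> and
  \<open>z\<close>, so \<open>c'\<close> can be missing at neither of them and leads to vertices
  \<open>w\<close> and \<open>u\<close> of low degree. By \<open>bad_pair_reduce\<close> the end of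
  the uncoloured edge other than \<open>x\<close> misses only \<open>c\<close>. The further missing
  colours that \<open>u\<close> and \<open>w\<close> must share with the ends are therefore missing
  at \<open>x\<close>, and these are the colours \<open>b\<close> and \<open>a\<close> that
  \<open>bad_pair_final\<close> asks for.\<close>

lemma bad_pair:
  assumes st: "st x z \<phi>" and c: "c \<in> M x z \<phi> z" and y: "{x, y} \<in> E" "y \<noteq> z" "\<phi> {x, y} = c"
    and c': "c' < k" "c' \<noteq> c" "c' \<notin> M x z \<phi> x" and bad: "bad x z \<phi> x y c'" "bad x z \<phi> x z c'"
  shows False
proof -
  define \<phi>0 where "\<phi>0 = \<phi>({x, z} := c)"
  note s = shift[OF st c y, folded \<phi>0_def]
  have xz: "{x, z} \<in> E" "\<phi>0 {x, z} = c"
    using st s(6) unfolding st_def by auto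
  have c0: "c \<in> M x y \<phi>0 y"
    using s(4) by simp
  have neq: "x \<noteq> y" "x \<noteq> z"
    using y xz edge_neq by auto
  have bad0: "bad x y \<phi>0 x y c'" "bad x y \<phi>0 x z c'"
    using bad_shift[OF st c y c'(2)] bad unfolding \<phi>0_def by auto
  have miss_z: False if *: "c' \<in> M x z \<phi> z"
  proof (cases "c' \<in> M x z \<phi> y")
    case True
    then show False
      using fan_disjoint(2)[OF st_sym[OF st] _ y(1,2)] c y(3) * unfolding M_sym[of z x] by blast
  next
    case False
    then obtain w where "{y, w} \<in> E" "w \<noteq> x" "\<phi> {y, w} = c'" "deg w + deg x + deg y \<le> 2 * k + 1"
      using bad(1) unfolding bad_def by auto
    then show False
      using bad_pair_missing[OF st c y * c'(2)] by blast
  qed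
  have miss_y: False if *: "c' \<in> M x z \<phi> y"
  proof -
    have **: "c' \<in> M x y \<phi>0 y"
      using * s(4) by auto
    have "c' \<notin> M x y \<phi>0 z"
      using miss_z s(3) by auto
    then obtain u where "{z, u} \<in> E" "u \<noteq> x" "\<phi>0 {z, u} = c'" "deg u + deg x + deg z \<le> 2 * k + 1"
      using bad0(2) unfolding bad_def by auto
    then show False
      using bad_pair_missing[OF s(1) c0 xz(1) y(2)[symmetric] xz(2) ** c'(2)] by blast
  qed
  obtain w where w: "{y, w} \<in> E" "w \<noteq> x" "\<phi> {y, w} = c'" "deg w + deg x + deg y \<le> 2 * k + 1"
    using bad(1) miss_y unfolding bad_def by auto
  obtain u where u: "{z, u} \<in> E" "u \<noteq> x" "\<phi> {z, u} = c'" "deg u + deg x + deg z \<le> 2 * k + 1"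
    using bad(2) miss_z unfolding bad_def by auto
  have neq': "w \<noteq> y" "u \<noteq> z"
    using w u edge_neq by auto
  \<comment> \<open>Seen from \<open>z\<close>, the vertex \<open>y\<close> is in the fan at
    \<open>x\<close>, so the degrees of \<open>x\<close>, \<open>y\<close>, \<open>z\<close> satisfy
    the fan bound. Hence \<open>z\<close> is not the low vertex \<open>w\<close>, and
    \<open>y\<close> is not the low vertex \<open>u\<close>.\<close>
  have high: "deg y + deg z + deg x \<ge> 2 * k + 2"
    using fan_disjoint(3)[OF st_sym[OF st] _ y(1,2)] c y(3) M_sym[of x z] by metis
  have neq2: "w \<noteq> z" "u \<noteq> y"
    using high w(4) u(4) by auto
  have ed: "{y, w} \<noteq> {x, z}" "{z, u} \<noteq> {x, z}" "{y, w} \<noteq> {x, y}" "{z, u} \<noteq> {x, y}"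
    using y neq neq' neq2 w u by (auto simp: doubleton_eq_iff)
  have "u \<noteq> w"
  proof
    assume "u = w"
    moreover have "{y, w} \<noteq> {z, u}"
      using y(2) neq2 by (auto simp: doubleton_eq_iff)
    ultimately show False
      using st_proper[OF st w(1) u(1) ed(1,2), of w] w(3) u(3) by simp
  qed
  have w0: "\<phi>0 {y, w} = c'" "\<phi>0 {z, u} = c'"
    using s(7) ed w u by auto
  have only_z: "g = c" if "g \<in> M x z \<phi> z" for g
    using bad_pair_reduce[OF st c y w u neq2(2) c'(2,3,1) that] by auto
  have c'0: "c' \<notin> M x y \<phi>0 x"
    using s(2) c' by auto
  have only_y: "g = c" if "g \<in> M x y \<phi>0 y" for g
    using bad_pair_reduce[OF s(1) c0 xz(1) y(2)[symmetric] xz(2) u(1,2) w0(2) u(4) w(1,2) w0(1) w(4)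
        neq2(1) c'(2) c'0 c'(1) that] by auto
  have c'u: "c' \<notin> M x z \<phi> u"
    using M_D2[OF _ u(1) ed(2)] u(3) by blast
  have c'z: "c' \<notin> M x z \<phi> z"
    using c' only_z by auto
  \<comment> \<open>\<open>u\<close> shares two missing colours with \<open>x\<close> and
    \<open>z\<close>, and \<open>z\<close> misses only \<open>c\<close>. If \<open>u\<close> does
    not miss \<open>c\<close>, both shared colours are missing at \<open>x\<close>: one is exchanged
    for \<open>c\<close>, the other takes the role of \<open>b\<close>.\<close>
  have "\<exists>\<phi>1 b. st x z \<phi>1 \<and> c \<in> M x z \<phi>1 u \<and> b \<in> M x z \<phi>1 u \<and> b \<in> M x z \<phi>1 x \<and> c \<in> M x z \<phi>1 z \<and>
      M x z \<phi>1 x = M x z \<phi> x \<and> \<phi>1 {x, y} = c \<and> \<phi>1 {y, w} = c' \<and> \<phi>1 {z, u} = c'"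
  proof -
    obtain b where b: "b \<in> M x z \<phi> u" "b \<in> M x z \<phi> x \<or> b \<in> M x z \<phi> z" "b \<noteq> c"
      using low_misses_other[OF st c u(2) neq'(2) u(4) c'(1) c'u c'(3) c'z] .
    then have bx: "b \<in> M x z \<phi> x"
      using only_z by auto
    show ?thesis
    proof (cases "c \<in> M x z \<phi> u")
      case True
      then show ?thesis
        using st c b(1) bx y(3) w(3) u(3) by (intro exI[of _ \<phi>] exI[of _ b]) simp
    next
      case False
      obtain b' where b': "b' \<in> M x z \<phi> u" "b' \<in> M x z \<phi> x \<or> b' \<in> M x z \<phi> z" "b' \<noteq> b"
        using low_misses_other[OF st c u(2) neq'(2) u(4) c'(1) c'u c'(3) c'z] .
      then have b'c: "b' \<noteq> c" "b' \<in> M x z \<phi> x"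
        using False only_z by auto
      obtain \<phi>1 where "kempe_swapped x z b c u \<phi> \<phi>1"
        using kempe_swap_away[OF st bx c u(2) neq'(2)] b(1) by blast
      note \<phi>1 = kempe_swappedD[OF this]
      have "c' \<noteq> b"
        using bx c' by auto
      then have "\<phi>1 {y, w} = c'" "\<phi>1 {z, u} = c'" "\<phi>1 {x, y} = c"
        using \<phi>1(2)[of "{y, w}"] \<phi>1(2)[of "{z, u}"] \<phi>1(3)[of "{x, y}"] w u y ed c'(2) s(1)
        by (auto simp: doubleton_eq_iff)
      then show ?thesis
        using \<phi>1(1,5,6) c \<phi>1(10)[OF b(1)] \<phi>1(9)[OF b'(1) b'(3) b'c(1)] b'c(2)
        by (intro exI[of _ \<phi>1] exI[of _ b']) simp
    qed
  qed
  then obtain \<phi>1 b where \<phi>1: "st x z \<phi>1" "c \<in> M x z \<phi>1 u" "b \<in> M x z \<phi>1 u" "b \<in> M x z \<phi>1 x"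
      "c \<in> M x z \<phi>1 z" "M x z \<phi>1 x = M x z \<phi> x" "\<phi>1 {x, y} = c" "\<phi>1 {y, w} = c'" "\<phi>1 {z, u} = c'"
    by blast
  have c'1: "c' \<notin> M x z \<phi>1 x"
    using \<phi>1(6) c' by simp
  define \<phi>2 where "\<phi>2 = \<phi>1({x, z} := c)"
  note t = shift[OF \<phi>1(1,5) y(1,2) \<phi>1(7), folded \<phi>2_def]
  have c2: "c \<in> M x y \<phi>2 y"
    using t(4) by simp
  have e2: "\<phi>2 {x, z} = c" "\<phi>2 {y, w} = c'" "\<phi>2 {z, u} = c'"
    using t(6,7) \<phi>1 ed by auto
  have c'2: "c' \<notin> M x y \<phi>2 x"
    using t(2) c'1 by simp
  have only_y: "g = c" if "g \<in> M x y \<phi>2 y" for g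
    using bad_pair_reduce[OF t(1) c2 xz(1) y(2)[symmetric] e2(1) u(1,2) e2(3) u(4) w(1,2) e2(2) w(4)
        neq2(1) c'(2) c'2 c'(1) that] by auto
  have c'w: "c' \<notin> M x y \<phi>2 w" "c' \<notin> M x y \<phi>2 y"
    using M_D2[OF _ w(1) ed(3)] e2(2) only_y c'(2) by blast+
  \<comment> \<open>With \<open>{x, y}\<close> uncoloured, \<open>y\<close> misses only
    \<open>c\<close>, so a shared colour other than \<open>c\<close> is missing at
    \<open>x\<close>.\<close>
  obtain a where a: "a \<in> M x y \<phi>2 w" "a \<in> M x y \<phi>2 x \<or> a \<in> M x y \<phi>2 y" "a \<noteq> c"
    using low_misses_other[OF t(1) c2 w(2) neq'(1) w(4) c'(1) c'w(1) c'2 c'w(2)] .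
  then have "a \<in> M x z \<phi>1 x" "a \<in> M x z \<phi>1 w"
    using only_y t(2) t(5)[of w] w(2) neq'(1) neq2(1) by auto
  then show False
    using bad_pair_final[OF \<phi>1(1,5) y(1,2) \<phi>1(7) w(1,2) \<phi>1(8) w(4) u(1,2) \<phi>1(9) neq2 \<open>u \<noteq> w\<close> c'(2)
        c'1 \<phi>1(2,3,4)] by blast
qed

section \<open>An adjacency lemma of Woodall\<close>

definition nbrs :: "'a \<Rightarrow> 'a set" where
  "nbrs v = {u. {v, u} \<in> E}"

lemma finite_nbrs [simp]: "finite (nbrs v)"
proof -
  have "nbrs v \<subseteq> \<Union>E"
    unfolding nbrs_def by auto
  moreover have "finite (\<Union>E)"
    using finite_E card_edge by (metis card.infinite finite_Union zero_neq_numeral)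
  ultimately show ?thesis
    by (rule finite_subset)
qed

lemma card_nbrs: "card (nbrs v) = deg v"
proof -
  have "{e \<in> E. v \<in> e} = (\<lambda>u. {v, u}) ` nbrs v"
  proof (intro equalityI subsetI)
    fix e assume "e \<in> {e \<in> E. v \<in> e}"
    then obtain u where "e = {v, u}" "e \<in> E"
      using card_edge[of e] by (auto simp: card_2_iff) (metis insert_commute)+
    then show "e \<in> (\<lambda>u. {v, u}) ` nbrs v"
      unfolding nbrs_def by auto
  qed (auto simp: nbrs_def)
  moreover have "inj_on (\<lambda>u. {v, u}) (nbrs v)"
    by (auto simp: inj_on_def doubleton_eq_iff)
  ultimately show ?thesis
    unfolding deg_def by (simp add: card_image)
qed

lemma nbrs_sym: "u \<in> nbrs v \<longleftrightarrow> v \<in> nbrs u"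
  unfolding nbrs_def by (simp add: insert_commute)

text \<open>The number $\sigma(x, y)$ of Woodall is \<open>card (high x y)\<close>.\<close>

definition high :: "'a \<Rightarrow> 'a \<Rightarrow> 'a set" where
  "high x y = {w \<in> nbrs y - {x}. deg w + deg x + deg y \<ge> 2 * k + 2}"

lemma finite_high [simp]: "finite (high x y)"
  unfolding high_def by simp

text \<open>After the uncoloured edge is moved to \<open>{x, z}\<close>, different colours lead from
  \<open>z\<close> to different vertices of \<open>high x z\<close>: the colours missing at
  \<open>x\<close> do so by the fan property, and those of \<open>K\<close> other than
  \<open>c\<close> because they are bad at \<open>y\<close> and hence, by \<open>bad_pair\<close>,
  not at \<open>z\<close>. The colour lost with \<open>c\<close> is offset by the extra missing
  colour at \<open>x\<close>.\<close>

lemma high_lower_bound: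
  assumes st: "st x y \<phi>" and c: "c \<in> M x y \<phi> y" and z: "{x, z} \<in> E" "z \<noteq> y" "\<phi> {x, z} = c"
    and K: "finite K" "K \<subseteq> {..<k}" "M x y \<phi> x \<inter> K = {}" "c \<in> K"
    and bad: "\<And>c'. c' \<in> K \<Longrightarrow> c' \<noteq> c \<Longrightarrow> bad x y \<phi> x y c'"
  shows "k + card K \<le> card (high x z) + deg x"
proof -
  define \<phi>' where "\<phi>' = \<phi>({x, y} := c)"
  note s = shift[OF st c z, folded \<phi>'_def]
  have y: "{x, y} \<in> E" "y \<noteq> z" "\<phi>' {x, y} = c"
    using st s(6) z unfolding st_def by auto
  have cz: "c \<in> M x z \<phi>' z"
    using s(4) by simp
  let ?C = "M x y \<phi> x \<union> (K - {c})"
  have ex: "\<exists>u. u \<in> high x z \<and> \<phi>' {z, u} = d" if d: "d \<in> ?C" for d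
  proof -
    have "d \<notin> M x z \<phi>' z \<and> (\<forall>u. {z, u} \<in> E \<longrightarrow> u \<noteq> x \<longrightarrow> \<phi>' {z, u} = d \<longrightarrow> deg u + deg x + deg z \<ge> 2 * k + 2)"
    proof (cases "d \<in> M x y \<phi> x")
      case True
      then have "d \<in> M x z \<phi>' x"
        using s(2) by simp
      then show ?thesis
        using M_disjoint[OF s(1)] fan_disjoint(3)[OF s(1)] by auto
    next
      case False
      then have dK: "d \<in> K" "d \<noteq> c" using d by auto
      have "bad x z \<phi>' x y d"
        using bad_shift(2)[OF st c z dK(2)] bad[OF dK] unfolding \<phi>'_def by auto
      then have "\<not> bad x z \<phi>' x z d"
        using bad_pair[OF s(1) cz y _ dK(2)] dK(1) K(2) False s(2) by auto
      then show ?thesis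
        unfolding bad_def by (metis not_less_eq_eq Suc_eq_plus1 add_2_eq_Suc' )
    qed
    moreover have "d < k"
      using d K(2) M_less by auto
    moreover obtain u where u: "{z, u} \<in> E" "{z, u} \<noteq> {x, z}" "\<phi>' {z, u} = d"
      using not_M_obtain[of d x z \<phi>' z] calculation by blast
    moreover have "u \<noteq> x"
      using u(2) by (auto simp: insert_commute)
    ultimately show ?thesis
      unfolding high_def nbrs_def by blast
  qed
  then obtain f where f: "\<And>d. d \<in> ?C \<Longrightarrow> f d \<in> high x z \<and> \<phi>' {z, f d} = d"
    by metis
  have "inj_on f ?C"
    using f by (metis inj_onI)
  then have "card ?C \<le> card (high x z)"
    using f by (intro card_inj_on_le[of f]) auto
  moreover have "card ?C = card (M x y \<phi> x) + (card K - 1)"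
    using K by (subst card_Un_disjoint) auto
  moreover have "card K \<ge> 1"
    using K by (metis One_nat_def Suc_leI card_gt_0_iff empty_iff)
  ultimately show ?thesis
    using card_M(1)[OF st] by linarith
qed

text \<open>If \<open>c\<close> leads to a vertex \<open>w\<close> of low degree, \<open>w\<close>
  shares a missing colour with \<open>y\<close>, after a swap if necessary, and recolouring
  \<open>{y, w}\<close> with it frees \<open>c\<close>. The colours at \<open>x\<close> and on the
  edges from \<open>y\<close> to \<open>high x y\<close> are preserved so that one set of colours
  serves for every choice of \<open>c\<close>.\<close>

lemma make_missing:
  assumes st: "st x y \<phi>" and c: "c < k" "c \<notin> \<phi> ` (\<lambda>w. {y, w}) ` high x y"
  obtains \<phi>' where "st x y \<phi>'" "c \<in> M x y \<phi>' y" "M x y \<phi>' x = M x y \<phi> x"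
    "\<And>e. e \<in> E \<Longrightarrow> e \<noteq> {x, y} \<Longrightarrow> x \<in> e \<Longrightarrow> \<phi>' e = \<phi> e"
    "\<And>w. w \<in> high x y \<Longrightarrow> \<phi>' {y, w} = \<phi> {y, w}"
proof (cases "c \<in> M x y \<phi> y")
  case True
  then show thesis using that[of \<phi>] st by simp
next
  case False
  then obtain w where w: "{y, w} \<in> E" "{y, w} \<noteq> {x, y}" "\<phi> {y, w} = c"
    using not_M_obtain[OF c(1)] by metis
  have wx: "w \<noteq> x" "w \<noteq> y" "x \<noteq> y"
    using w edge_neq st unfolding st_def by (auto simp: insert_commute)
  have "w \<notin> high x y"
    using w(3) c(2) by auto
  then have low: "deg w + deg x + deg y \<le> 2 * k + 1"
    using w(1) wx(1) unfolding high_def nbrs_def by auto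
  have highE: "{y, v} \<in> E" "{y, v} \<noteq> {x, y}" if "v \<in> high x y" for v
    using that unfolding high_def nbrs_def by (auto simp: doubleton_eq_iff)
  obtain g where g: "g \<in> M x y \<phi> w" "g \<in> M x y \<phi> x \<or> g \<in> M x y \<phi> y"
    using card_missing_low(1)[OF st wx(1,2) low] by blast
  have "\<exists>\<phi>1 h. st x y \<phi>1 \<and> h \<in> M x y \<phi>1 w \<and> h \<in> M x y \<phi>1 y \<and> M x y \<phi>1 x = M x y \<phi> x \<and>
      (\<forall>e\<in>E. e \<noteq> {x, y} \<longrightarrow> x \<in> e \<or> y \<in> e \<longrightarrow> \<phi>1 e = \<phi> e)"
  proof (cases "g \<in> M x y \<phi> y")
    case True
    then show ?thesis using st g(1) by blast
  next
    case False
    then have gx: "g \<in> M x y \<phi> x" using g by auto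
    obtain h where h: "h \<in> M x y \<phi> y"
      using M_nonempty[OF st_sym[OF st]] M_sym by metis
    obtain \<phi>1 where "kempe_swapped x y g h w \<phi> \<phi>1"
      using kempe_swap_away[OF st gx h wx(1,2)] g(1) by blast
    note \<phi>1 = kempe_swappedD[OF this]
    show ?thesis
      using \<phi>1(1,3,5,6) \<phi>1(10)[OF g(1)] h by (intro exI[of _ \<phi>1] exI[of _ h]) simp
  qed
  then obtain \<phi>1 h where \<phi>1: "st x y \<phi>1" "h \<in> M x y \<phi>1 w" "h \<in> M x y \<phi>1 y" "M x y \<phi>1 x = M x y \<phi> x"
      "\<forall>e\<in>E. e \<noteq> {x, y} \<longrightarrow> x \<in> e \<or> y \<in> e \<longrightarrow> \<phi>1 e = \<phi> e"
    by blast
  have e1: "\<phi>1 e = \<phi> e" if "e \<in> E" "e \<noteq> {x, y}" "x \<in> e \<or> y \<in> e" for e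
    using \<phi>1(5) that by blast
  have w1: "\<phi>1 {y, w} = c"
    using e1[OF w(1,2)] w(3) by simp
  note r = recolor[OF \<phi>1(1) w(1,2) \<phi>1(3,2), unfolded w1]
  show thesis
  proof (rule that[OF r(1,2)])
    show "M x y (\<phi>1({y, w} := h)) x = M x y \<phi> x"
      using r(5)[of x] wx \<phi>1(4) by simp
    show "(\<phi>1({y, w} := h)) e = \<phi> e" if "e \<in> E" "e \<noteq> {x, y}" "x \<in> e" for e
      using r(7)[of e] e1[of e] that wx by auto
    show "(\<phi>1({y, w} := h)) {y, v} = \<phi> {y, v}" if "v \<in> high x y" for v
    proof -
      have "{y, v} \<noteq> {y, w}"
        using that \<open>w \<notin> high x y\<close> by (auto simp: doubleton_eq_iff)
      then show ?thesis
        using r(7)[of "{y, v}"] e1[OF highE[OF that]] by simp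
    qed
  qed
qed

text \<open>\<open>K\<close> consists of the colours not leading from \<open>y\<close> to
  \<open>high x y\<close>. Colours missing at \<open>x\<close> do lead there, so each colour of
  \<open>K\<close> occurs at \<open>x\<close>, and \<open>Z\<close> is the set of vertices these
  colours lead to from \<open>x\<close>. For each of them \<open>make_missing\<close> establishes
  the hypothesis of \<open>high_lower_bound\<close>.\<close>

lemma high_adjacency:
  assumes xy: "{x, y} \<in> E"
  obtains Z where "Z \<subseteq> nbrs x - {y}" "card Z + card (high x y) = k"
    "\<And>z. z \<in> Z \<Longrightarrow> k + card Z \<le> card (high x z) + deg x"
proof -
  obtain \<phi> where st: "st x y \<phi>"
    using coloring_minus[OF xy] xy unfolding st_def by auto
  let ?B = "(\<lambda>w. \<phi> {y, w}) ` high x y"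
  define K where "K = {..<k} - ?B"
  have highE: "{y, v} \<in> E" "{y, v} \<noteq> {x, y}" if "v \<in> high x y" for v
    using that unfolding high_def nbrs_def by (auto simp: doubleton_eq_iff)
  have inj: "inj_on (\<lambda>w. \<phi> {y, w}) (high x y)"
    using st_eq[OF st] highE by (meson inj_onI)
  have "?B \<subseteq> {..<k}"
    using st_color_less[OF st] highE by auto
  then have "card K = k - card ?B" "card ?B \<le> k"
    unfolding K_def using card_mono[of "{..<k}" ?B] by (simp_all add: card_Diff_subset)
  then have cK: "card K + card (high x y) = k"
    using card_image[OF inj] by simp
  have MK: "M x y \<phi> x \<inter> K = {}"
  proof -
    have "a \<in> ?B" if a: "a \<in> M x y \<phi> x" for a
    proof -
      have "a \<notin> M x y \<phi> y"
        using a M_disjoint[OF st] by auto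
      then obtain w where w: "{y, w} \<in> E" "{y, w} \<noteq> {x, y}" "\<phi> {y, w} = a"
        using not_M_obtain[OF M_less[OF a]] by metis
      then have "w \<noteq> x"
        by (auto simp: insert_commute)
      then have "w \<in> high x y"
        using fan_disjoint(3)[OF st a w(1) _ w(3)] w(1) unfolding high_def nbrs_def by auto
      then show ?thesis using w(3) by auto
    qed
    then show ?thesis unfolding K_def by auto
  qed
  have "\<exists>z. {x, z} \<in> E \<and> z \<noteq> y \<and> \<phi> {x, z} = c" if c: "c \<in> K" for c
  proof -
    have "c < k" "c \<notin> M x y \<phi> x"
      using c MK unfolding K_def by auto
    then show ?thesis
      using not_M_obtain[of c x y \<phi> x] by metis
  qed
  then obtain f where f: "\<And>c. c \<in> K \<Longrightarrow> {x, f c} \<in> E \<and> f c \<noteq> y \<and> \<phi> {x, f c} = c"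
    by metis
  have injf: "inj_on f K"
    using f by (metis inj_onI)
  show thesis
  proof (rule that)
    show "f ` K \<subseteq> nbrs x - {y}"
      using f unfolding nbrs_def by auto
    show "card (f ` K) + card (high x y) = k"
      using card_image[OF injf] cK by simp
    fix z assume "z \<in> f ` K"
    then obtain c where c: "c \<in> K" "z = f c" by auto
    note z = f[OF c(1), folded c(2)]
    have ck: "c < k" "c \<notin> \<phi> ` (\<lambda>w. {y, w}) ` high x y"
      using c(1) unfolding K_def by auto
    obtain \<phi>' where \<phi>': "st x y \<phi>'" "c \<in> M x y \<phi>' y" "M x y \<phi>' x = M x y \<phi> x"
      "\<And>e. e \<in> E \<Longrightarrow> e \<noteq> {x, y} \<Longrightarrow> x \<in> e \<Longrightarrow> \<phi>' e = \<phi> e"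
      "\<And>w. w \<in> high x y \<Longrightarrow> \<phi>' {y, w} = \<phi> {y, w}"
      using make_missing[OF st ck] by blast
    have "\<phi>' {x, z} = c"
      using \<phi>'(4)[of "{x, z}"] z by (auto simp: doubleton_eq_iff)
    moreover have "bad x y \<phi>' x y c'" if c': "c' \<in> K" for c'
    proof (cases "c' \<in> M x y \<phi>' y")
      case True
      then show ?thesis unfolding bad_def by simp
    next
      case False
      have "c' < k" using c' unfolding K_def by simp
      then obtain w where w: "{y, w} \<in> E" "{y, w} \<noteq> {x, y}" "\<phi>' {y, w} = c'"
        using not_M_obtain[OF _ False] by metis
      then have "w \<noteq> x"
        by (auto simp: insert_commute)
      moreover have "w \<notin> high x y"
        using \<phi>'(5)[of w] w(3) c' unfolding K_def by auto
      ultimately show ?thesis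
        using w(1,3) unfolding bad_def high_def nbrs_def by fastforce
    qed
    ultimately have "k + card K \<le> card (high x z) + deg x"
      using high_lower_bound[OF \<phi>'(1,2), of z K] z c(1) MK \<phi>'(3) unfolding K_def by auto
    then show "k + card (f ` K) \<le> card (high x z) + deg x"
      using card_image[OF injf] by simp
  qed
qed

text \<open>Write q for the maximal value q(y) and deg x = q + b. The q vertices of \<open>Z\<close>
  have q(z) <= b, and the other b neighbours have q(z) <= q. So the sum is at least q/b + b/q >=
  2.\<close>

lemma sum_inverse_low:
  assumes "nbrs x \<noteq> {}"
  shows "(\<Sum>y\<in>nbrs x. 1 / real (k - card (high x y))) \<ge> 2"
proof -
  let ?q = "\<lambda>y. k - card (high x y)"
  have "Max (?q ` nbrs x) \<in> ?q ` nbrs x"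
    using assms by (intro Max_in) auto
  then obtain y where y: "y \<in> nbrs x" and "Max (?q ` nbrs x) = ?q y"
    by auto
  then have max: "\<And>z. z \<in> nbrs x \<Longrightarrow> ?q z \<le> ?q y"
    by (metis Max_ge finite_imageI finite_nbrs imageI)
  \<comment> \<open>\<open>x\<close> is a neighbour of \<open>z\<close> outside
    \<open>high x z\<close>; thus the subtraction is not truncated and the denominators are
    positive.\<close>
  have q1: "?q z \<ge> 1" if "z \<in> nbrs x" for z
  proof -
    have E: "{x, z} \<in> E"
      using that unfolding nbrs_def by simp
    have "card (high x z) < card (nbrs z)"
      using that nbrs_sym[of x z] by (intro psubset_card_mono) (auto simp: high_def)
    also have "\<dots> \<le> k"
      using degree_le[of z] card_nbrs[of z] unfolding deg_def by simp
    finally show ?thesis by simp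
  qed
  obtain Z where Z: "Z \<subseteq> nbrs x - {y}" "card Z + card (high x y) = k"
    "\<And>z. z \<in> Z \<Longrightarrow> k + card Z \<le> card (high x z) + deg x"
    using high_adjacency[of x y] y unfolding nbrs_def by blast
  define q where "q = ?q y"
  have cZ: "card Z = q"
    using Z(2) unfolding q_def by simp
  have finZ: "finite Z"
    using Z(1) finite_subset[OF _ finite_nbrs] by blast
  define b where "b = deg x - q"
  \<comment> \<open>\<open>y\<close> lies outside \<open>Z\<close>, which yields
    \<open>b \<ge> 1\<close>.\<close>
  have Zx: "card (insert y Z) \<le> deg x"
    unfolding card_nbrs[symmetric] using Z(1) y by (intro card_mono) auto
  have "y \<notin> Z"
    using Z(1) by auto
  then have qd: "q + 1 \<le> deg x"
    using Zx cZ finZ by simp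
  then have b: "b \<ge> 1" "deg x = q + b"
    unfolding b_def by auto
  have qb: "?q z \<le> b" if "z \<in> Z" for z
    using Z(3)[OF that] cZ unfolding b_def by linarith
  have qpos: "q \<ge> 1"
    using q1[OF y] unfolding q_def .
  have "real q * (1 / real b) + real b * (1 / real q) \<le> (\<Sum>z\<in>Z. 1 / real (?q z)) + (\<Sum>z\<in>nbrs x - Z. 1 / real (?q z))"
  proof (rule add_mono)
    have "(\<Sum>z\<in>Z. 1 / real b) \<le> (\<Sum>z\<in>Z. 1 / real (?q z))"
      using qb q1 Z(1) b(1) by (intro sum_mono divide_left_mono) (auto simp: Suc_le_eq intro!: mult_pos_pos)
    then show "real q * (1 / real b) \<le> (\<Sum>z\<in>Z. 1 / real (?q z))"
      using cZ by simp
    have "(\<Sum>z\<in>nbrs x - Z. 1 / real q) \<le> (\<Sum>z\<in>nbrs x - Z. 1 / real (?q z))"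
      using max[folded q_def] q1 qpos
      by (intro sum_mono divide_left_mono) (auto simp del: of_nat_diff simp: Suc_le_eq intro!: mult_pos_pos)
    moreover have "card (nbrs x - Z) = b"
      using Z(1) finZ cZ b card_nbrs[of x] by (subst card_Diff_subset) auto
    ultimately show "real b * (1 / real q) \<le> (\<Sum>z\<in>nbrs x - Z. 1 / real (?q z))"
      by simp
  qed
  also have "\<dots> = (\<Sum>z\<in>nbrs x. 1 / real (?q z))"
    by (subst sum.subset_diff[of Z "nbrs x"]) (use Z(1) in auto)
  finally have *: "real q / real b + real b / real q \<le> (\<Sum>z\<in>nbrs x. 1 / real (?q z))"
    by simp
  have "(real q - real b)\<^sup>2 \<ge> 0"
    by simp
  then have "real q / real b + real b / real q \<ge> 2"
    using qpos b(1) by (simp add: field_simps power2_eq_square)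
  with * show ?thesis by linarith
qed

end

section \<open>Discharging\<close>

text \<open>Over the denominator \<open>k * d\<close>, the left side minus 3 has the numerator
  \<open>(k - 2 * d) * (d - 2) - 4\<close>, which is negative.\<close>

lemma mid_arith:
  fixes k d :: real
  assumes "2 \<le> d" "k \<le> 2 * d" "0 < k"
  shows "2 * (k - d + 1) / k + 2 * (d - 2) / (k * d) + (d - 1) * (2 / d) \<le> 3"
proof -
  have "2 * (k - d + 1) / k + 2 * (d - 2) / (k * d) + (d - 1) * (2 / d) =
      (2 * d * (k - d + 1) + 2 * (d - 2) + 2 * k * (d - 1)) / (k * d)"
    using assms by (simp add: field_simps)
  also have "\<dots> = (3 * (k * d) + ((k - 2 * d) * (d - 2) - 4)) / (k * d)"
    by (simp add: algebra_simps)
  also have "\<dots> \<le> 3 * (k * d) / (k * d)"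
    using assms mult_nonpos_nonneg[of "k - 2 * d" "d - 2"] by (intro divide_right_mono) auto
  finally show ?thesis
    using assms by simp
qed

text \<open>\<open>D\<close> bounds the degrees in \<open>high x y\<close> from below,
  \<open>R\<close> is what the demand bound leaves of 3 after the vertices of
  \<open>high x y\<close>, and at most \<open>q\<close> neighbours are outside it. Of these,
  \<open>m\<close> take at most 4/k each, which by \<open>R \<ge> 4 * q / k\<close> is no more than
  the average R/q; so each of the other \<open>l\<close> can get R/q. The left side is R/q written
  as an affine function of 1/q.\<close>

lemma low_arith:
  fixes k d D q m l dem :: real
  assumes d: "2 \<le> d" "2 * d \<le> k" "D = k - d + 2" and q: "1 \<le> q" "q \<le> d - 1"
    and ml: "0 \<le> m" "1 \<le> l" "m + l \<le> q"
    and dem: "dem \<le> 2 * (k - d + 1) / k + 2 * (d - 2) / (k * D) + (d - 1 - q) * (2 / D) + m * (4 / k)"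
  shows "(1 - 2 * d * (d - 2) / (k * D)) * (1 / q) + 2 / D \<le> (3 - dem) / l"
proof -
  have pos: "k > 0" "D > 0" "d + 2 \<le> D"
    using d by auto
  define R where "R = 1 - 2 * d * (d - 2) / (k * D) + 2 * q / D"
  have R_eq: "R = 3 - (2 * (k - d + 1) / k + 2 * (d - 2) / (k * D) + (d - 1 - q) * (2 / D))"
    unfolding R_def using pos by (simp add: divide_simps) (insert d(3), algebra)
  \<comment> \<open>The numerator is nonnegative: \<open>k - 2 * (d - 1) \<ge> 2\<close> pays for
    the term with \<open>D\<close>, and both factors of the product are nonnegative, the second
    because \<open>k \<le> 2 * D\<close>.\<close>
  have "R - 4 * q / k = (k - 2 * (d - 1) - 2 * (d - 2) / D + (d - 1 - q) * (4 - 2 * k / D)) / k"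
    unfolding R_def using pos by (simp add: divide_simps) (insert d(3), algebra)
  moreover have "2 * k / D \<le> 4"
    using pos d by (simp add: field_simps)
  moreover have "2 * (d - 2) / D \<le> 2"
    using pos d by (simp add: field_simps)
  ultimately have Rq: "R \<ge> 4 * q / k"
    using pos d q mult_nonneg_nonneg[of "d - 1 - q" "4 - 2 * k / D"]
    by (smt (verit) divide_nonneg_pos)
  have "R * l \<le> R * q - R * m"
  proof -
    have "0 \<le> 4 * q / k"
      using pos q by simp
    then have "R * (l + m) \<le> R * q"
      using Rq ml by (intro mult_left_mono) auto
    then show ?thesis by (simp add: algebra_simps)
  qed
  also have "\<dots> \<le> R * q - (4 * q / k) * m"
    using mult_right_mono[OF Rq ml(1)] by simp
  also have "\<dots> = q * (R - m * (4 / k))"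
    by (simp add: algebra_simps)
  also have "\<dots> \<le> q * (3 - dem)"
    using q dem unfolding R_eq by (intro mult_left_mono) auto
  finally have "R / q \<le> (3 - dem) / l"
    using q ml by (simp add: field_simps)
  moreover have "R / q = (1 - 2 * d * (d - 2) / (k * D)) * (1 / q) + 2 / D"
    unfolding R_def using q by (simp add: add_divide_distrib)
  ultimately show ?thesis by simp
qed

context edge_critical
begin

lemma deg_le: "deg v \<le> k"
  using degree_le unfolding deg_def .

lemma degree_sum_ge:
  assumes "{x, y} \<in> E"
  shows "k + 2 \<le> deg x + deg y"
  by (rule adjacency[OF assms]) auto

lemma deg_ge_2:
  assumes "nbrs x \<noteq> {}"
  shows "2 \<le> deg x"
proof -
  obtain y where "{x, y} \<in> E"
    using assms unfolding nbrs_def by auto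
  then show ?thesis
    using degree_sum_ge[of x y] deg_le[of y] by simp
qed

text \<open>Since 2/t = 2/k + 2(k - t)/(kt), vertices of \<open>H\<close> cost as much as vertices
  of degree \<open>k\<close> plus a multiple of their total deficiency, which
  \<open>adjacency\<close> bounds by d(x) - 2. The degree bound \<open>m\<close> is left free: it
  becomes d(x) in \<open>demand_le_3\<close> and \<open>D\<close> in
  \<open>charge_light_ge\<close>.\<close>

lemma demand_bound:
  assumes xy: "{x, y} \<in> E"
  obtains H where "H \<subseteq> high x y" "card H + deg x = k + 1"
    "\<And>S m. S \<subseteq> H \<Longrightarrow> 0 < m \<Longrightarrow> (\<And>z. z \<in> S \<Longrightarrow> m \<le> real (deg z)) \<Longrightarrow>
      (\<Sum>z\<in>S. 2 / real (deg z)) \<le> 2 * (real k - real (deg x) + 1) / real k + 2 * (real (deg x) - 2) / (real k * m)"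
proof -
  obtain H where H: "finite H" "\<And>z. z \<in> H \<Longrightarrow> {y, z} \<in> E \<and> z \<noteq> x" "card H + deg x = k + 1"
    "(\<Sum>z\<in>H. k - deg z) + 2 * (k + 1) \<le> k + deg x + deg y"
    "\<And>z. z \<in> H \<Longrightarrow> deg z + deg x + deg y \<ge> 2 * k + 2"
    using adjacency[OF xy] by metis
  show thesis
  proof (rule that)
    show "H \<subseteq> high x y"
      using H(2,5) unfolding high_def nbrs_def by auto
    show "card H + deg x = k + 1" by (rule H(3))
    fix S and m :: real
    assume S: "S \<subseteq> H" and m: "0 < m" "\<And>z. z \<in> S \<Longrightarrow> m \<le> real (deg z)"
    have k: "k > 0"
      using deg_ge_2[of x] deg_le[of x] xy unfolding nbrs_def by fastforce
    have "2 / real (deg z) \<le> 2 / real k + 2 / (real k * m) * real (k - deg z)" if "z \<in> S" for z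
    proof -
      have z: "0 < real (deg z)" "m \<le> real (deg z)" "deg z \<le> k"
        using m(1) m(2)[of z] that deg_le[of z] by auto
      have "2 / real (deg z) = 2 / real k + 2 * real (k - deg z) / (real k * real (deg z))"
        using z k by (simp add: field_simps of_nat_diff)
      also have "\<dots> \<le> 2 / real k + 2 * real (k - deg z) / (real k * m)"
        using z k m(1) by (intro add_left_mono divide_left_mono mult_left_mono mult_pos_pos) auto
      finally show ?thesis by simp
    qed
    then have "(\<Sum>z\<in>S. 2 / real (deg z)) \<le> (\<Sum>z\<in>S. 2 / real k + 2 / (real k * m) * real (k - deg z))"
      by (rule sum_mono)
    also have "\<dots> \<le> (\<Sum>z\<in>H. 2 / real k + 2 / (real k * m) * real (k - deg z))"
      using S H(1) m(1) by (intro sum_mono2) auto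
    also have "\<dots> = real (card H) * (2 / real k) + 2 / (real k * m) * real (\<Sum>z\<in>H. k - deg z)"
      by (simp add: sum.distrib sum_distrib_left del: of_nat_diff)
    also have "\<dots> \<le> real (card H) * (2 / real k) + 2 / (real k * m) * (real (deg x) - 2)"
    proof -
      have "(\<Sum>z\<in>H. k - deg z) + 2 \<le> deg x"
        using H(4) deg_le[of y] by presburger
      then have "real (\<Sum>z\<in>H. k - deg z) \<le> real (deg x) - 2"
        by linarith
      then show ?thesis
        using m(1) by (intro add_left_mono mult_left_mono) auto
    qed
    also have "real (card H) = real k - real (deg x) + 1"
      using H(3) by linarith
    finally show "(\<Sum>z\<in>S. 2 / real (deg z)) \<le> 2 * (real k - real (deg x) + 1) / real k + 2 * (real (deg x) - 2) / (real k * m)"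
      by (simp add: mult.commute)
  qed
qed

definition heavy :: "'a set \<Rightarrow> 'a \<Rightarrow> 'a set" where
  "heavy I y = {z \<in> nbrs y \<inter> I. k < 2 * deg z}"

definition light :: "'a set \<Rightarrow> 'a \<Rightarrow> 'a set" where
  "light I y = {z \<in> nbrs y \<inter> I. 2 * deg z \<le> k}"

definition demand :: "'a set \<Rightarrow> 'a \<Rightarrow> real" where
  "demand I y = (\<Sum>z\<in>heavy I y. 2 / real (deg z))"

definition charge :: "'a set \<Rightarrow> 'a \<Rightarrow> 'a \<Rightarrow> real" where
  "charge I y z = (if k < 2 * deg z then 2 / real (deg z) else (3 - demand I y) / real (card (light I y)))"

lemma finite_heavy [simp]: "finite (heavy I y)" and finite_light [simp]: "finite (light I y)"
  unfolding heavy_def light_def by auto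

text \<open>Let d be the least degree of a neighbour of \<open>y\<close> in \<open>I\<close>. The
  fan \<open>H\<close> is paid for by \<open>demand_bound\<close>; at most d(y) - |H| <= d - 1
  further neighbours remain, each taking at most 2/d.\<close>

lemma demand_le_3:
  assumes "light I y = {}"
  shows "demand I y \<le> 3"
proof (cases "nbrs y \<inter> I = {}")
  case True
  then show ?thesis unfolding demand_def heavy_def by simp
next
  case False
  have "Min (deg ` (nbrs y \<inter> I)) \<in> deg ` (nbrs y \<inter> I)"
    using False by (intro Min_in) auto
  then obtain x where x: "x \<in> nbrs y \<inter> I" "Min (deg ` (nbrs y \<inter> I)) = deg x"
    by auto
  have min: "deg x \<le> deg z" if "z \<in> nbrs y \<inter> I" for z
    using that x(2) by (metis Min_le finite_Int finite_imageI finite_nbrs imageI)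
  have xy: "{x, y} \<in> E"
    using x(1) unfolding nbrs_def by (simp add: insert_commute)
  have d2: "2 \<le> deg x"
    using deg_ge_2[of x] xy unfolding nbrs_def by auto
  have kd: "k < 2 * deg x"
    using assms x(1) unfolding light_def by auto
  have k0: "k > 0"
    using d2 deg_le[of x] by simp
  obtain H where H: "H \<subseteq> high x y" "card H + deg x = k + 1"
    "\<And>S m. S \<subseteq> H \<Longrightarrow> 0 < m \<Longrightarrow> (\<And>z. z \<in> S \<Longrightarrow> m \<le> real (deg z)) \<Longrightarrow>
      (\<Sum>z\<in>S. 2 / real (deg z)) \<le> 2 * (real k - real (deg x) + 1) / real k + 2 * (real (deg x) - 2) / (real k * m)"
    using demand_bound[OF xy] by blast
  have finH: "finite H"
    using H(1) finite_high finite_subset by blast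
  let ?A = "heavy I y"
  have A: "z \<in> nbrs y \<inter> I" if "z \<in> ?A" for z
    using that unfolding heavy_def by auto
  have "demand I y = (\<Sum>z\<in>?A \<inter> H. 2 / real (deg z)) + (\<Sum>z\<in>?A - H. 2 / real (deg z))"
    unfolding demand_def by (subst sum.union_disjoint[symmetric]) (auto intro!: sum.cong)
  also have "\<dots> \<le> (2 * (real k - real (deg x) + 1) / real k + 2 * (real (deg x) - 2) / (real k * real (deg x))) +
      (real (deg x) - 1) * (2 / real (deg x))"
  proof (rule add_mono)
    show "(\<Sum>z\<in>?A \<inter> H. 2 / real (deg z)) \<le>
        2 * (real k - real (deg x) + 1) / real k + 2 * (real (deg x) - 2) / (real k * real (deg x))"
      using d2 min A by (intro H(3)) auto
    have "(\<Sum>z\<in>?A - H. 2 / real (deg z)) \<le> (\<Sum>z\<in>?A - H. 2 / real (deg x))"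
      using d2 min A by (intro sum_mono divide_left_mono mult_pos_pos) fastforce+
    also have "\<dots> = real (card (?A - H)) * (2 / real (deg x))"
      by simp
    also have "\<dots> \<le> (real (deg x) - 1) * (2 / real (deg x))"
    proof (rule mult_right_mono)
      have "card (?A - H) \<le> card (nbrs y - H)"
        using A by (intro card_mono) auto
      also have "\<dots> = deg y - card H"
        using H(1) finH card_nbrs[of y] by (subst card_Diff_subset) (auto simp: high_def)
      finally have "card (?A - H) + 1 \<le> deg x"
        using H(2) deg_le[of y] deg_le[of x] d2 by linarith
      then show "real (card (?A - H)) \<le> real (deg x) - 1"
        by linarith
    qed simp
    finally show "(\<Sum>z\<in>?A - H. 2 / real (deg z)) \<le> (real (deg x) - 1) * (2 / real (deg x))" .
  qed
  also have "\<dots> \<le> 3"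
    using d2 kd k0 by (intro mid_arith) auto
  finally show ?thesis .
qed

text \<open>If light neighbours exist, the charges add up to exactly 3 whatever the demand is;
  otherwise \<open>demand_le_3\<close> applies.\<close>

lemma sum_charge_le: "(\<Sum>z\<in>nbrs y \<inter> I. charge I y z) \<le> 3"
proof -
  have "nbrs y \<inter> I = heavy I y \<union> light I y" "heavy I y \<inter> light I y = {}"
    unfolding heavy_def light_def by auto
  then have "(\<Sum>z\<in>nbrs y \<inter> I. charge I y z) = (\<Sum>z\<in>heavy I y. charge I y z) + (\<Sum>z\<in>light I y. charge I y z)"
    by (simp add: sum.union_disjoint)
  also have "(\<Sum>z\<in>heavy I y. charge I y z) = demand I y"
    unfolding demand_def by (intro sum.cong) (auto simp: charge_def heavy_def)
  also have "(\<Sum>z\<in>light I y. charge I y z) = (\<Sum>z\<in>light I y. (3 - demand I y) / real (card (light I y)))"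
    by (intro sum.cong) (auto simp: charge_def light_def)
  also have "demand I y + \<dots> \<le> 3"
    using demand_le_3[of I y] by (cases "light I y = {}") auto
  finally show ?thesis .
qed

text \<open>The heavy neighbours of \<open>y\<close> are of three kinds: those in the fan
  \<open>H\<close>, covered by \<open>demand_bound\<close>; those in the rest of
  \<open>high x y\<close>, which has d - 1 - q vertices, at 2/D each; and those outside
  \<open>high x y\<close>, of which only degree above k/2 is known, at 4/k each.\<close>

lemma charge_light_ge:
  assumes xy: "{x, y} \<in> E" and x: "x \<in> I" "2 * deg x \<le> k"
  defines "d \<equiv> real (deg x)"
  defines "D \<equiv> real k - d + 2"
  shows "(1 - 2 * d * (d - 2) / (real k * D)) * (1 / real (k - card (high x y))) + 2 / D \<le> charge I y x"
proof -
  have d2: "2 \<le> deg x"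
    using deg_ge_2[of x] xy unfolding nbrs_def by auto
  have k0: "k > 0"
    using d2 deg_le[of x] by simp
  obtain H where H: "H \<subseteq> high x y" "card H + deg x = k + 1"
    "\<And>S m. S \<subseteq> H \<Longrightarrow> 0 < m \<Longrightarrow> (\<And>z. z \<in> S \<Longrightarrow> m \<le> real (deg z)) \<Longrightarrow>
      (\<Sum>z\<in>S. 2 / real (deg z)) \<le> 2 * (real k - real (deg x) + 1) / real k + 2 * (real (deg x) - 2) / (real k * m)"
    using demand_bound[OF xy] by blast
  have finH: "finite H"
    using H(1) finite_high finite_subset by blast
  let ?A = "heavy I y" and ?h = "high x y"
  define q where "q = k - card ?h"
  have xn: "x \<in> nbrs y"
    using xy unfolding nbrs_def by (simp add: insert_commute)
  have hn: "?h \<subseteq> nbrs y - {x}"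
    unfolding high_def by auto
  have "card ?h < card (nbrs y)"
    using hn xn by (intro psubset_card_mono) auto
  then have hk: "card ?h < k" "card ?h < deg y"
    using deg_le[of y] card_nbrs[of y] by auto
  have Hh: "card H \<le> card ?h"
    using H(1) by (intro card_mono) auto
  \<comment> \<open>The constant \<open>D\<close> comes from the degree condition in
    \<open>high\<close> with \<open>deg y\<close> replaced by its upper bound
    \<open>k\<close>.\<close>
  have degh: "D \<le> real (deg z)" if "z \<in> ?h" for z
    using that deg_le[of y] unfolding high_def D_def d_def by auto
  have D0: "D > 0"
    unfolding D_def d_def using deg_le[of x] by linarith
  let ?m = "card (?A - ?h)" and ?l = "card (light I y)"
  have l1: "?l \<ge> 1"
    using xn x unfolding light_def by (simp add: Suc_le_eq card_gt_0_iff) blast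
  have ml: "?m + ?l \<le> q"
  proof -
    \<comment> \<open>Two vertices of degree at most k/2 together with \<open>y\<close> have degree
      sum at most 2k.\<close>
    have "light I y \<inter> ?h = {}"
      using x(2) deg_le[of y] unfolding light_def high_def by fastforce
    then have "(?A - ?h) \<union> light I y \<subseteq> nbrs y - ?h"
      unfolding heavy_def light_def by auto
    then have "card ((?A - ?h) \<union> light I y) \<le> card (nbrs y - ?h)"
      by (intro card_mono) auto
    moreover have "card ((?A - ?h) \<union> light I y) = ?m + ?l"
      by (intro card_Un_disjoint) (auto simp: heavy_def light_def)
    moreover have "card (nbrs y - ?h) = deg y - card ?h"
      using hn card_nbrs[of y] by (subst card_Diff_subset) auto
    ultimately show ?thesis
      using deg_le[of y] unfolding q_def by linarith
  qed
  have "demand I y = (\<Sum>z\<in>?A \<inter> H. 2 / real (deg z)) + (\<Sum>z\<in>?A \<inter> (?h - H). 2 / real (deg z)) +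
      (\<Sum>z\<in>?A - ?h. 2 / real (deg z))"
  proof -
    have "?A = (?A \<inter> H) \<union> (?A \<inter> (?h - H)) \<union> (?A - ?h)"
      using H(1) by auto
    then have "demand I y = (\<Sum>z\<in>(?A \<inter> H) \<union> (?A \<inter> (?h - H)) \<union> (?A - ?h). 2 / real (deg z))"
      unfolding demand_def by simp
    also have "\<dots> = (\<Sum>z\<in>(?A \<inter> H) \<union> (?A \<inter> (?h - H)). 2 / real (deg z)) + (\<Sum>z\<in>?A - ?h. 2 / real (deg z))"
      using H(1) by (intro sum.union_disjoint) auto
    also have "(\<Sum>z\<in>(?A \<inter> H) \<union> (?A \<inter> (?h - H)). 2 / real (deg z)) =
        (\<Sum>z\<in>?A \<inter> H. 2 / real (deg z)) + (\<Sum>z\<in>?A \<inter> (?h - H). 2 / real (deg z))"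
      by (intro sum.union_disjoint) auto
    finally show ?thesis .
  qed
  also have "\<dots> \<le> (2 * (real k - d + 1) / real k + 2 * (d - 2) / (real k * D)) + (d - 1 - real q) * (2 / D) +
      real ?m * (4 / real k)"
  proof (intro add_mono)
    show "(\<Sum>z\<in>?A \<inter> H. 2 / real (deg z)) \<le> 2 * (real k - d + 1) / real k + 2 * (d - 2) / (real k * D)"
      unfolding d_def using D0 degh H(1) by (intro H(3)) auto
    have "(\<Sum>z\<in>?A \<inter> (?h - H). 2 / real (deg z)) \<le> (\<Sum>z\<in>?h - H. 2 / real (deg z))"
      by (intro sum_mono2) auto
    also have "\<dots> \<le> (\<Sum>z\<in>?h - H. 2 / D)"
      using D0 degh by (intro sum_mono divide_left_mono mult_pos_pos) fastforce+
    also have "\<dots> = real (card (?h - H)) * (2 / D)"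
      by simp
    also have "card (?h - H) = card ?h - card H"
      using H(1) finH by (intro card_Diff_subset) auto
    also have "real (card ?h - card H) = d - 1 - real q"
      using Hh H(2) hk unfolding q_def d_def by linarith
    finally show "(\<Sum>z\<in>?A \<inter> (?h - H). 2 / real (deg z)) \<le> (d - 1 - real q) * (2 / D)" .
    have "2 / real (deg z) \<le> 4 / real k" if "z \<in> ?A - ?h" for z
    proof -
      have "real k \<le> 2 * real (deg z)"
        using that unfolding heavy_def by auto
      then show ?thesis
        using k0 by (simp add: field_simps)
    qed
    then have "(\<Sum>z\<in>?A - ?h. 2 / real (deg z)) \<le> (\<Sum>z\<in>?A - ?h. 4 / real k)"
      by (intro sum_mono) auto
    then show "(\<Sum>z\<in>?A - ?h. 2 / real (deg z)) \<le> real ?m * (4 / real k)"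
      by simp
  qed
  finally have dem: "demand I y \<le> 2 * (real k - d + 1) / real k + 2 * (d - 2) / (real k * D) +
      (d - 1 - real q) * (2 / D) + real ?m * (4 / real k)" .
  have q: "1 \<le> q" "q + 1 \<le> deg x"
    using hk Hh H(2) unfolding q_def by linarith+
  have "(1 - 2 * d * (d - 2) / (real k * D)) * (1 / real q) + 2 / D \<le> (3 - demand I y) / real ?l"
  proof (rule low_arith[OF _ _ _ _ _ _ _ _ dem])
    show "D = real k - d + 2" by (simp only: D_def)
    show "real q \<le> d - 1" "2 \<le> d" "2 * d \<le> real k"
      using q d2 x(2) unfolding d_def by linarith+
    show "real ?m + real ?l \<le> real q"
      using ml by linarith
  qed (use q l1 in auto)
  then show ?thesis
    unfolding charge_def q_def using x(2) by simp
qed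

text \<open>For a light \<open>x\<close>, adding the bounds of \<open>charge_light_ge\<close> and
  using \<open>sum_inverse_low\<close> gives 2A + 2d/D = 2 + (2d/D)(1 - 2(d - 2)/k), which is at
  least 2 as 2d <= k.\<close>

lemma sum_charge_ge:
  assumes x: "x \<in> I" "nbrs x \<noteq> {}"
  shows "2 \<le> (\<Sum>y\<in>nbrs x. charge I y x)"
proof (cases "k < 2 * deg x")
  case True
  then have "(\<Sum>y\<in>nbrs x. charge I y x) = real (deg x) * (2 / real (deg x))"
    unfolding charge_def by (simp add: card_nbrs)
  then show ?thesis
    using deg_ge_2[OF x(2)] by simp
next
  case False
  define d where "d = real (deg x)"
  define D where "D = real k - d + 2"
  define A where "A = 1 - 2 * d * (d - 2) / (real k * D)"
  have d: "2 \<le> d" "2 * d \<le> real k"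
    using deg_ge_2[OF x(2)] False unfolding d_def by auto
  have D: "d + 2 \<le> D" "0 < D" "real k > 0"
    using d unfolding D_def by auto
  have "(d - 2) * (2 * d) \<le> D * real k"
    using d D by (intro mult_mono) auto
  then have A: "0 \<le> A"
    unfolding A_def using D by (simp add: field_simps)
  have "2 = 2 * A + 4 * (d - 2) * d / (real k * D)"
    unfolding A_def by simp
  also have "\<dots> \<le> 2 * A + 2 * d / D"
  proof -
    have "4 * (d - 2) * d \<le> 2 * d * real k"
      using d mult_right_mono[of "2 * (d - 2)" "real k" "2 * d"] by (simp add: algebra_simps)
    then have "4 * (d - 2) * d / (real k * D) \<le> 2 * d * real k / (real k * D)"
      using D by (intro divide_right_mono) auto
    also have "\<dots> = 2 * d / D"
      using D by (simp add: divide_simps)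
    finally show ?thesis by simp
  qed
  also have "\<dots> \<le> A * (\<Sum>y\<in>nbrs x. 1 / real (k - card (high x y))) + d * (2 / D)"
    using mult_left_mono[OF sum_inverse_low[OF x(2)] A] by (simp add: mult.commute)
  also have "\<dots> = (\<Sum>y\<in>nbrs x. A * (1 / real (k - card (high x y))) + 2 / D)"
    unfolding d_def by (simp add: sum.distrib sum_distrib_left card_nbrs)
  also have "\<dots> \<le> (\<Sum>y\<in>nbrs x. charge I y x)"
  proof (rule sum_mono)
    fix y assume "y \<in> nbrs x"
    then have "{x, y} \<in> E"
      unfolding nbrs_def by simp
    then show "A * (1 / real (k - card (high x y))) + 2 / D \<le> charge I y x"
      unfolding A_def D_def d_def using charge_light_ge[of x y I] x(1) False by simp
  qed
  finally show ?thesis .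
qed

theorem neighbourhood_lower_bound:
  assumes I: "finite I" "\<And>x. x \<in> I \<Longrightarrow> nbrs x \<noteq> {}"
  shows "2 * card I \<le> 3 * card (\<Union>x\<in>I. nbrs x)"
proof -
  let ?N = "\<Union>x\<in>I. nbrs x"
  have fN: "finite ?N"
    using I(1) by auto
  have "real (2 * card I) = (\<Sum>x\<in>I. 2)"
    by simp
  also have "\<dots> \<le> (\<Sum>x\<in>I. \<Sum>y\<in>nbrs x. charge I y x)"
    using I(2) by (intro sum_mono sum_charge_ge) auto
  also have "\<dots> = (\<Sum>x\<in>I. \<Sum>y\<in>{y \<in> ?N. y \<in> nbrs x}. charge I y x)"
    by (intro sum.cong) auto
  also have "\<dots> = (\<Sum>y\<in>?N. \<Sum>x\<in>{x \<in> I. y \<in> nbrs x}. charge I y x)"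
    using I(1) fN by (rule sum.swap_restrict)
  also have "\<dots> = (\<Sum>y\<in>?N. \<Sum>x\<in>nbrs y \<inter> I. charge I y x)"
    using nbrs_sym by (intro sum.cong) auto
  also have "\<dots> \<le> (\<Sum>y\<in>?N. 3)"
    by (intro sum_mono sum_charge_le)
  also have "\<dots> = real (3 * card ?N)"
    by simp
  finally show ?thesis
    by linarith
qed

end

section \<open>Components and fractional matchings\<close>

text \<open>The induction of Halmos and Vaughan. A proper nonempty \<open>X\<close> with equality in
  Hall's condition is matched by itself, and the condition survives for the rest outside the targets
  of \<open>X\<close>. If there is no such \<open>X\<close>, proper nonempty sets have a target to
  spare, so any one pair may be removed.\<close>

lemma hall_marriage:
  assumes "finite A" "\<And>x. x \<in> A \<Longrightarrow> finite (T x)" "\<And>X. X \<subseteq> A \<Longrightarrow> card X \<le> card (\<Union>x\<in>X. T x)"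
  shows "\<exists>f. inj_on f A \<and> (\<forall>x\<in>A. f x \<in> T x)"
  using assms
proof (induction "card A" arbitrary: A T rule: less_induct)
  case less
  note finA = less.prems(1) and finT = less.prems(2) and hall = less.prems(3)
  have finU: "finite (\<Union>x\<in>X. T x)" if "X \<subseteq> A" for X
    using that finA finT finite_subset by (intro finite_UN_I) auto
  show ?case
  proof (cases "\<exists>X. X \<noteq> {} \<and> X \<subset> A \<and> card X = card (\<Union>x\<in>X. T x)")
    case True
    then obtain X where X: "X \<noteq> {}" "X \<subset> A" "card X = card (\<Union>x\<in>X. T x)" by blast
    let ?TX = "\<Union>x\<in>X. T x"
    have fX: "finite X" using X finA finite_subset by blast
    have "\<exists>f. inj_on f X \<and> (\<forall>x\<in>X. f x \<in> T x)"
      using X finT hall fX psubset_card_mono[OF finA X(2)] by (intro less.hyps) auto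
    then obtain f where f: "inj_on f X" "\<And>x. x \<in> X \<Longrightarrow> f x \<in> T x" by blast
    have "\<exists>g. inj_on g (A - X) \<and> (\<forall>x\<in>A - X. g x \<in> T x - ?TX)"
    proof (rule less.hyps)
      show "card (A - X) < card A"
        using X finA by (intro psubset_card_mono) auto
      fix Y assume Y: "Y \<subseteq> A - X"
      then have fY: "finite Y" using finA finite_subset by blast
      have "card X + card Y = card (X \<union> Y)"
        using Y fX fY by (subst card_Un_disjoint) auto
      also have "\<dots> \<le> card (\<Union>x\<in>X \<union> Y. T x)"
        using Y X by (intro hall) auto
      also have "(\<Union>x\<in>X \<union> Y. T x) = ?TX \<union> (\<Union>x\<in>Y. T x - ?TX)"
        by auto
      also have "card \<dots> = card ?TX + card (\<Union>x\<in>Y. T x - ?TX)"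
        using finU[of X] finU[of Y] X Y by (intro card_Un_disjoint) (auto intro: finite_subset)
      finally show "card Y \<le> card (\<Union>x\<in>Y. T x - ?TX)"
        using X(3) by simp
    qed (use finA finT in auto)
    then obtain g where g: "inj_on g (A - X)" "\<And>x. x \<in> A - X \<Longrightarrow> g x \<in> T x - ?TX" by blast
    define h where "h x = (if x \<in> X then f x else g x)" for x
    have "h x \<in> T x" if "x \<in> A" for x
      using f(2)[of x] g(2)[of x] that unfolding h_def by auto
    moreover have "inj_on h A"
    proof (rule inj_onI)
      fix x y assume xy: "x \<in> A" "y \<in> A" "h x = h y"
      have cross: "f u \<noteq> g v" if "u \<in> X" "v \<in> A - X" for u v
        using f(2)[OF that(1)] g(2)[OF that(2)] that by auto
      show "x = y"
        using xy cross[of x y] cross[of y x] inj_onD[OF f(1), of x y] inj_onD[OF g(1), of x y]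
        unfolding h_def by (auto split: if_splits)
    qed
    ultimately show ?thesis by blast
  next
    case tight: False
    show ?thesis
    proof (cases "A = {}")
      case False
      then obtain a where a: "a \<in> A" by blast
      have "card (T a) \<ge> 1"
        using hall[of "{a}"] a by simp
      then obtain t where t: "t \<in> T a" by fastforce
      have "\<exists>g. inj_on g (A - {a}) \<and> (\<forall>x\<in>A - {a}. g x \<in> T x - {t})"
      proof (rule less.hyps)
        show "card (A - {a}) < card A"
          using a finA by (intro psubset_card_mono) auto
        fix Y assume Y: "Y \<subseteq> A - {a}"
        show "card Y \<le> card (\<Union>x\<in>Y. T x - {t})"
        proof (cases "Y = {}")
          case False
          have "Y \<subset> A" "Y \<subseteq> A"
            using Y a by auto
          then have "card Y < card (\<Union>x\<in>Y. T x)"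
            using False tight hall[of Y] by (metis le_neq_implies_less)
          moreover have "(\<Union>x\<in>Y. T x - {t}) = (\<Union>x\<in>Y. T x) - {t}"
            by auto
          ultimately show ?thesis
            by (auto simp: card_Diff_singleton_if)
        qed simp
      qed (use finA finT in auto)
      then obtain g where g: "inj_on g (A - {a})" "\<And>x. x \<in> A - {a} \<Longrightarrow> g x \<in> T x - {t}" by blast
      have "inj_on (g(a := t)) A"
      proof (rule inj_onI)
        fix x y assume xy: "x \<in> A" "y \<in> A" "(g(a := t)) x = (g(a := t)) y"
        show "x = y"
          using xy g(2)[of x] g(2)[of y] inj_onD[OF g(1), of x y] by (auto split: if_splits)
      qed
      moreover have "(g(a := t)) x \<in> T x" if "x \<in> A" for x
        using that t g(2)[of x] by auto
      ultimately show ?thesis by blast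
    qed auto
  qed
qed

section \<open>Neighbourhoods, components and their isomorphism types\<close>

definition neighbours :: "'a graph \<Rightarrow> 'a \<Rightarrow> 'a set" where
  "neighbours G v = {u. {v, u} \<in> edges G}"

lemma neighbours_sym: "u \<in> neighbours G v \<longleftrightarrow> v \<in> neighbours G u"
  unfolding neighbours_def by (simp add: insert_commute)

lemma sgraph_edgeD:
  assumes "sgraph G" "{u, v} \<in> edges G"
  shows "u \<in> verts G" "v \<in> verts G" "u \<noteq> v"
proof -
  have "{u, v} \<subseteq> verts G" "card {u, v} = 2"
    using assms unfolding sgraph_def by blast+
  then show "u \<in> verts G" "v \<in> verts G" "u \<noteq> v"
    by auto
qed

lemma sgraph_edge_cases:
  assumes "sgraph G" "e \<in> edges G" "v \<in> e"
  obtains u where "e = {v, u}" "u \<noteq> v" "u \<in> neighbours G v"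
proof -
  have "card e = 2"
    using assms unfolding sgraph_def by blast
  then obtain a b where "e = {a, b}" "a \<noteq> b"
    by (auto simp: card_2_iff)
  then show thesis
    using that[of a] that[of b] assms unfolding neighbours_def by (auto simp: insert_commute)
qed

lemma finite_verts: "sgraph G \<Longrightarrow> finite (verts G)"
  unfolding sgraph_def by blast

lemma finite_edges: "sgraph G \<Longrightarrow> finite (edges G)"
  unfolding sgraph_def by (rule finite_subset[of _ "Pow (verts G)"]) auto

lemma neighbours_subset: "sgraph G \<Longrightarrow> neighbours G v \<subseteq> verts G - {v}"
  using sgraph_edgeD unfolding neighbours_def by fast

lemma finite_neighbours: "sgraph G \<Longrightarrow> finite (neighbours G v)"
  using neighbours_subset[of G v] finite_verts[of G] finite_subset by blast

lemma incident_edges_eq: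
  assumes "sgraph G"
  shows "{e \<in> edges G. v \<in> e} = (\<lambda>u. {v, u}) ` neighbours G v"
  by (auto elim: sgraph_edge_cases[OF assms] simp: neighbours_def)

lemma inj_on_pair: "inj_on (\<lambda>u. {v, u}) A"
  by (auto simp: inj_on_def doubleton_eq_iff)

lemma degree_eq_card_neighbours: "sgraph G \<Longrightarrow> degree G v = card (neighbours G v)"
  unfolding degree_def by (simp add: incident_edges_eq card_image inj_on_pair)

lemma sum_incident:
  fixes f :: "'a set \<Rightarrow> real"
  assumes "sgraph G"
  shows "(\<Sum>e\<in>{e \<in> edges G. v \<in> e}. f e) = (\<Sum>u\<in>neighbours G v. f {v, u})"
  unfolding incident_edges_eq[OF assms] by (simp add: sum.reindex[OF inj_on_pair])

definition reach_set :: "'a graph \<Rightarrow> 'a \<Rightarrow> 'a set" where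
  "reach_set G v = {w \<in> verts G. reachable G v w}"

lemma reach_set_iff: "u \<in> reach_set G v \<longleftrightarrow> u \<in> verts G \<and> reachable G v u"
  unfolding reach_set_def by simp

abbreviation component :: "'a graph \<Rightarrow> 'a \<Rightarrow> 'a graph" where
  "component G v \<equiv> induced_subgraph G (reach_set G v)"

lemma components_eq: "components G = component G ` verts G"
  unfolding components_def reach_set_def ..

lemma verts_induced_subgraph [simp]: "verts (induced_subgraph G S) = S"
  unfolding induced_subgraph_def by simp

lemma reachable_refl [simp]: "reachable G v v"
  unfolding reachable_def by simp

lemma reachable_trans: "reachable G u v \<Longrightarrow> reachable G v w \<Longrightarrow> reachable G u w"
  unfolding reachable_def by simp

lemma reachable_sym: "reachable G u v \<Longrightarrow> reachable G v u"
  unfolding reachable_def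
proof (induction rule: rtranclp_induct)
  case (step y z)
  then have "{z, y} \<in> edges G"
    by (simp add: insert_commute)
  then show ?case
    using step.IH by (rule converse_rtranclp_into_rtranclp)
qed simp

lemma reachable_edge: "{u, v} \<in> edges G \<Longrightarrow> reachable G u v"
  unfolding reachable_def by auto

lemma reach_set_closed:
  assumes "sgraph G" "u \<in> reach_set G v" "{u, w} \<in> edges G"
  shows "w \<in> reach_set G v"
  using assms sgraph_edgeD[OF assms(1,3)] reachable_edge[OF assms(3)] unfolding reach_set_def
  by (auto intro: reachable_trans)

lemma reach_set_eq: "u \<in> reach_set G v \<Longrightarrow> reach_set G u = reach_set G v"
  unfolding reach_set_def by (auto intro: reachable_trans reachable_sym)

lemma neighbours_component:
  assumes "sgraph G" "u \<in> reach_set G v"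
  shows "neighbours (component G v) u = neighbours G u"
  using reach_set_closed[OF assms] assms(2) unfolding neighbours_def induced_subgraph_def by auto

lemma reach_set_eqI:
  assumes v: "v \<in> B" and B: "B \<subseteq> verts G" and closed: "\<And>u w. u \<in> B \<Longrightarrow> {u, w} \<in> edges G \<Longrightarrow> w \<in> B"
    and conn: "\<And>u. u \<in> B \<Longrightarrow> reachable G v u"
  shows "reach_set G v = B"
proof -
  have "w \<in> B" if "reachable G v w" for w
    using that unfolding reachable_def by (induction rule: rtranclp_induct) (use v closed in auto)
  then show ?thesis
    using B conn unfolding reach_set_def by auto
qed

lemma sgraph_component: "sgraph G \<Longrightarrow> sgraph (component G v)"
  unfolding sgraph_def induced_subgraph_def reach_set_def by auto

lemma connected_component:
  assumes "sgraph G" "v \<in> verts G"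
  shows "connected_graph (component G v)"
proof -
  have from_v: "reachable (component G v) v w" if "reachable G v w" for w
    using that unfolding reachable_def
  proof (induction rule: rtranclp_induct)
    case (step u w)
    have u: "u \<in> reach_set G v"
      using step.hyps sgraph_edgeD[OF assms(1) step.hyps(2)] unfolding reach_set_def reachable_def by auto
    then have "w \<in> reach_set G v"
      using reach_set_closed[OF assms(1)] step.hyps(2) by blast
    then have "{u, w} \<in> edges (component G v)"
      using u step.hyps(2) unfolding induced_subgraph_def by simp
    then show ?case
      using step.IH by (rule rtranclp.rtrancl_into_rtrancl[rotated])
  qed simp
  show ?thesis
    unfolding connected_graph_def
  proof (intro conjI ballI)
    show "verts (component G v) \<noteq> {}"
      using assms(2) reach_set_iff[of v G v] by auto
    fix u w assume "u \<in> verts (component G v)" "w \<in> verts (component G v)"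
    then show "reachable (component G v) u w"
      using from_v unfolding verts_induced_subgraph reach_set_iff by (blast intro: reachable_trans reachable_sym)
  qed
qed

text \<open>\<open>components\<close> is an image, so each component arises from all of its
  vertices; knowing these fibres allows sums over vertices to be grouped by components.\<close>

lemma component_fibre:
  assumes "v \<in> verts G"
  shows "{u \<in> verts G. component G u = component G v} = reach_set G v"
proof -
  have "u \<in> reach_set G v" if "u \<in> verts G" "component G u = component G v" for u
  proof -
    have "u \<in> reach_set G u"
      using that(1) unfolding reach_set_def by simp
    also have "reach_set G u = reach_set G v"
      using arg_cong[OF that(2), of verts] by simp
    finally show ?thesis .
  qed
  moreover have "component G u = component G v" if "u \<in> reach_set G v" for u
    using reach_set_eq[OF that] by simp
  ultimately show ?thesis
    unfolding reach_set_def by auto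
qed

lemma sum_verts_induced_subgraphs:
  fixes f :: "'a \<Rightarrow> real"
  assumes "sgraph G"
  shows "(\<Sum>v\<in>verts G. f v) = (\<Sum>C\<in>components G. \<Sum>v\<in>verts C. f v)"
proof -
  have "(\<Sum>v\<in>verts G. f v) = (\<Sum>C\<in>component G ` verts G. \<Sum>v\<in>{v \<in> verts G. component G v = C}. f v)"
    using finite_verts[OF assms] by (rule sum.image_gen)
  also have "\<dots> = (\<Sum>C\<in>components G. \<Sum>v\<in>verts C. f v)"
    unfolding components_eq by (intro sum.cong refl) (force simp: component_fibre)
  finally show ?thesis .
qed

lemma isomorphic_star1_iff:
  assumes "sgraph C"
  shows "isomorphic C (star 1) \<longleftrightarrow> (\<exists>a b. a \<noteq> b \<and> verts C = {a, b} \<and> {a, b} \<in> edges C)"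
proof
  assume "isomorphic C (star 1)"
  then obtain \<phi> where \<phi>: "bij_betw \<phi> (verts C) {0..1}"
    "\<And>u v. u \<in> verts C \<Longrightarrow> v \<in> verts C \<Longrightarrow> {u, v} \<in> edges C \<longleftrightarrow> {\<phi> u, \<phi> v} \<in> edges (star 1)"
    unfolding isomorphic_def star_def by auto
  obtain a b where ab: "a \<in> verts C" "b \<in> verts C" "\<phi> a = 0" "\<phi> b = 1"
    using \<phi>(1) unfolding bij_betw_def by (metis One_nat_def atLeastAtMost_iff imageE le0 order_refl)
  have "verts C = {a, b}"
  proof (intro equalityI subsetI)
    fix x assume x: "x \<in> verts C"
    then have "\<phi> x \<in> {0..1}"
      using \<phi>(1) unfolding bij_betw_def by blast
    then have "\<phi> x = \<phi> a \<or> \<phi> x = \<phi> b"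
      using ab by auto
    then show "x \<in> {a, b}"
      using x ab \<phi>(1) unfolding bij_betw_def inj_on_def by blast
  qed (use ab in auto)
  moreover have "{a, b} \<in> edges C"
    using \<phi>(2)[of a b] ab unfolding star_def by auto
  ultimately show "\<exists>a b. a \<noteq> b \<and> verts C = {a, b} \<and> {a, b} \<in> edges C"
    using ab(3,4) by (intro exI[of _ a] exI[of _ b]) auto
next
  assume "\<exists>a b. a \<noteq> b \<and> verts C = {a, b} \<and> {a, b} \<in> edges C"
  then obtain a b where ab: "a \<noteq> b" "verts C = {a, b}" "{a, b} \<in> edges C" by blast
  define \<phi> where "\<phi> x = (if x = a then 0 else 1 :: nat)" for x
  have \<phi>: "\<phi> a = 0" "\<phi> b = 1"
    unfolding \<phi>_def using ab(1) by auto
  have "{0..1::nat} = {0, 1}"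
    by auto
  then have bij: "bij_betw \<phi> (verts C) (verts (star 1))"
    unfolding bij_betw_def inj_on_def ab(2) star_def using \<phi> by auto
  have no_loop: "{x} \<notin> edges C" for x
    using assms unfolding sgraph_def by fastforce
  have edges: "edges (star 1) = {{0, 1}}"
    unfolding star_def by auto
  have "{u, v} \<in> edges C \<longleftrightarrow> {\<phi> u, \<phi> v} \<in> edges (star 1)" if "u \<in> {a, b}" "v \<in> {a, b}" for u v
    using that \<phi> ab(3) no_loop unfolding edges by (auto simp: insert_commute doubleton_eq_iff)
  then show "isomorphic C (star 1)"
    unfolding isomorphic_def using bij ab(2) by auto
qed

text \<open>The non-edge \<open>{a, b}\<close> separates the star from the triangle, which is a
  permitted component of the other kind.\<close>

lemma isomorphic_star2_iff:
  assumes "sgraph C"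
  shows "isomorphic C (star 2) \<longleftrightarrow> (\<exists>s a b. s \<noteq> a \<and> s \<noteq> b \<and> a \<noteq> b \<and> verts C = {s, a, b} \<and>
    {s, a} \<in> edges C \<and> {s, b} \<in> edges C \<and> {a, b} \<notin> edges C)"
    (is "_ \<longleftrightarrow> (\<exists>s a b. ?P s a b)")
proof
  assume "isomorphic C (star 2)"
  then obtain \<phi> where \<phi>: "bij_betw \<phi> (verts C) {0..2}"
    "\<And>u v. u \<in> verts C \<Longrightarrow> v \<in> verts C \<Longrightarrow> {u, v} \<in> edges C \<longleftrightarrow> {\<phi> u, \<phi> v} \<in> edges (star 2)"
    unfolding isomorphic_def star_def by auto
  have ex: "\<exists>x\<in>verts C. \<phi> x = n" if "n \<le> 2" for n
    using \<phi>(1) that unfolding bij_betw_def by (metis atLeastAtMost_iff imageE le0)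
  obtain s a b where sab: "s \<in> verts C" "a \<in> verts C" "b \<in> verts C" "\<phi> s = 0" "\<phi> a = 1" "\<phi> b = 2"
    using ex[of 0] ex[of 1] ex[of 2] by auto
  have "verts C = {s, a, b}"
  proof (intro equalityI subsetI)
    fix x assume x: "x \<in> verts C"
    then have "\<phi> x \<in> {0..2}"
      using \<phi>(1) unfolding bij_betw_def by blast
    then have "\<phi> x = \<phi> s \<or> \<phi> x = \<phi> a \<or> \<phi> x = \<phi> b"
      using sab by auto
    then show "x \<in> {s, a, b}"
      using x sab \<phi>(1) unfolding bij_betw_def inj_on_def by blast
  qed (use sab in auto)
  moreover have "{s, a} \<in> edges C" "{s, b} \<in> edges C" "{a, b} \<notin> edges C"
    using \<phi>(2)[of s a] \<phi>(2)[of s b] \<phi>(2)[of a b] sab unfolding star_def by (auto simp: doubleton_eq_iff)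
  ultimately show "\<exists>s a b. ?P s a b"
    using sab by (intro exI[of _ s] exI[of _ a] exI[of _ b]) auto
next
  assume "\<exists>s a b. ?P s a b"
  then obtain s a b where sab: "s \<noteq> a" "s \<noteq> b" "a \<noteq> b" "verts C = {s, a, b}"
    "{s, a} \<in> edges C" "{s, b} \<in> edges C" "{a, b} \<notin> edges C" by blast
  define \<phi> where "\<phi> x = (if x = s then 0 else if x = a then 1 else 2 :: nat)" for x
  have \<phi>: "\<phi> s = 0" "\<phi> a = 1" "\<phi> b = 2"
    unfolding \<phi>_def using sab by auto
  have "{0..2::nat} = {0, 1, 2}" "{1..2::nat} = {1, 2}"
    by auto
  then have bij: "bij_betw \<phi> (verts C) (verts (star 2))" and edges: "edges (star 2) = {{0, 1}, {0, 2}}"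
    unfolding bij_betw_def inj_on_def sab(4) star_def using \<phi> by auto
  have no_loop: "{x} \<notin> edges C" for x
    using assms unfolding sgraph_def by fastforce
  have comm: "{a, s} \<in> edges C" "{b, s} \<in> edges C" "{b, a} \<notin> edges C"
    using sab(5-7) by (simp_all add: insert_commute)
  have "{u, v} \<in> edges C \<longleftrightarrow> {\<phi> u, \<phi> v} \<in> edges (star 2)" if "u \<in> {s, a, b}" "v \<in> {s, a, b}" for u v
    using that \<phi> sab(5-7) comm no_loop unfolding edges by (auto simp: doubleton_eq_iff)
  then show "isomorphic C (star 2)"
    unfolding isomorphic_def using bij sab(4) by auto
qed

lemma circuit_not_star2:
  assumes "circuit m C"
  shows "\<not> isomorphic C (star 2)"
proof
  assume iso: "isomorphic C (star 2)"
  have sg: "sgraph C" and deg: "\<And>v. v \<in> verts C \<Longrightarrow> degree C v = 2"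
    using assms unfolding circuit_def by auto
  obtain s a b where sab: "s \<noteq> a" "verts C = {s, a, b}" "{a, b} \<notin> edges C"
    using iso isomorphic_star2_iff[OF sg] by blast
  have "neighbours C a \<subseteq> {s}"
    using neighbours_subset[OF sg, of a] sab(2,3) unfolding neighbours_def by auto
  then have "card (neighbours C a) \<le> 1"
    using card_mono[of "{s}"] by fastforce
  then show False
    using deg[of a] sab(2) degree_eq_card_neighbours[OF sg, of a] by simp
qed

section \<open>Fractional matchings and vertex covers\<close>

text \<open>Double counting of incidences with vertex weights: \<open>c\<close> is a fractional
  cover in the upper bound for matchings and constantly 1 in the lower bound from a factor.\<close>

lemma sum_edges_eq_sum_verts:
  fixes f :: "'a set \<Rightarrow> real" and c :: "'a \<Rightarrow> real"
  assumes "sgraph G"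
  shows "(\<Sum>e\<in>edges G. f e * (\<Sum>v\<in>e. c v)) = (\<Sum>v\<in>verts G. c v * (\<Sum>e\<in>{e \<in> edges G. v \<in> e}. f e))"
proof -
  have "(\<Sum>e\<in>edges G. f e * (\<Sum>v\<in>e. c v)) = (\<Sum>e\<in>edges G. \<Sum>v\<in>{v \<in> verts G. v \<in> e}. f e * c v)"
  proof (rule sum.cong)
    fix e assume "e \<in> edges G"
    then have "{v \<in> verts G. v \<in> e} = e"
      using assms unfolding sgraph_def by blast
    then show "f e * (\<Sum>v\<in>e. c v) = (\<Sum>v\<in>{v \<in> verts G. v \<in> e}. f e * c v)"
      by (simp add: sum_distrib_left)
  qed simp
  also have "\<dots> = (\<Sum>v\<in>verts G. \<Sum>e\<in>{e \<in> edges G. v \<in> e}. f e * c v)"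
    using finite_edges[OF assms] finite_verts[OF assms] by (rule sum.swap_restrict)
  also have "\<dots> = (\<Sum>v\<in>verts G. c v * (\<Sum>e\<in>{e \<in> edges G. v \<in> e}. f e))"
    by (simp add: sum_distrib_left mult.commute)
  finally show ?thesis .
qed

text \<open>Weak duality. The weights cover every edge: an edge with an end in \<open>I\<close> has
  its other end in \<open>S\<close>, and the ends of any other edge have weight at least
  1/2.\<close>

lemma fractional_matching_bound:
  assumes G: "sgraph G" and f: "fractional_matching G f"
    and I: "independent_set G I"
  defines "S \<equiv> \<Union>x\<in>I. neighbours G x"
  shows "2 * (\<Sum>e\<in>edges G. f e) \<le> real (card (verts G)) - (real (card I) - real (card S))"
proof -
  define c where "c v = (if v \<in> I then 0 else if v \<in> S then 1 else 1 / 2 :: real)" for v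
  have IV: "I \<subseteq> verts G" and ind: "\<And>u v. u \<in> I \<Longrightarrow> v \<in> I \<Longrightarrow> {u, v} \<notin> edges G"
    using I unfolding independent_set_def by auto
  have SV: "S \<subseteq> verts G"
    using neighbours_subset[OF G] unfolding S_def by blast
  have IS: "I \<inter> S = {}"
    using ind unfolding S_def neighbours_def by auto
  note fin = finite_verts[OF G]
  have finIS: "finite I" "finite S"
    using IV SV fin finite_subset by blast+
  have cover: "1 \<le> (\<Sum>v\<in>e. c v)" if e: "e \<in> edges G" for e
  proof -
    have "card e = 2" using G e unfolding sgraph_def by blast
    then obtain u v where uv: "e = {u, v}" "u \<noteq> v" by (auto simp: card_2_iff)
    have "u \<in> S" if "v \<in> I"
      using that e uv unfolding S_def neighbours_def by (auto simp: insert_commute)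
    moreover have "v \<in> S" if "u \<in> I"
      using that e uv unfolding S_def neighbours_def by auto
    ultimately have "1 \<le> c u + c v"
      using IS unfolding c_def by auto
    then show ?thesis using uv by simp
  qed
  have "(\<Sum>e\<in>edges G. f e) \<le> (\<Sum>e\<in>edges G. f e * (\<Sum>v\<in>e. c v))"
    using f cover unfolding fractional_matching_def
    by (intro sum_mono) (metis mult.right_neutral mult_left_mono)
  also have "\<dots> = (\<Sum>v\<in>verts G. c v * (\<Sum>e\<in>{e \<in> edges G. v \<in> e}. f e))"
    by (rule sum_edges_eq_sum_verts[OF G])
  also have "\<dots> \<le> (\<Sum>v\<in>verts G. c v)"
  proof (rule sum_mono)
    fix v assume "v \<in> verts G"
    then have "(\<Sum>e\<in>{e \<in> edges G. v \<in> e}. f e) \<le> 1" "0 \<le> c v"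
      using f unfolding fractional_matching_def c_def by auto
    then show "c v * (\<Sum>e\<in>{e \<in> edges G. v \<in> e}. f e) \<le> c v"
      using mult_left_mono by fastforce
  qed
  also have "\<dots> = (\<Sum>v\<in>verts G. 1 / 2 + (if v \<in> S then 1 / 2 else 0) - (if v \<in> I then 1 / 2 else 0))"
    using IS unfolding c_def by (intro sum.cong) auto
  also have "\<dots> = real (card (verts G)) / 2 + real (card S) / 2 - real (card I) / 2"
    using fin IV SV by (simp add: sum.distrib sum_subtractf sum.If_cases Int_absorb1)
  finally show ?thesis by simp
qed

lemma fractional_matching_le_number:
  assumes G: "sgraph G" and f: "fractional_matching G f"
  shows "(\<Sum>e\<in>edges G. f e) \<le> fractional_matching_number G"
  unfolding fractional_matching_number_def
proof (rule cSUP_upper)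
  show "f \<in> Collect (fractional_matching G)"
    using f by simp
  \<comment> \<open>The empty independent set gives the uniform bound |V|/2, without which the
    supremum would not be an upper bound.\<close>
  have "2 * (\<Sum>e\<in>edges G. g e) \<le> real (card (verts G))" if "fractional_matching G g" for g
    using fractional_matching_bound[OF G that, of "{}"] unfolding independent_set_def by simp
  then show "bdd_above ((\<lambda>f. \<Sum>e\<in>edges G. f e) ` Collect (fractional_matching G))"
    by (intro bdd_aboveI2[of _ _ "real (card (verts G)) / 2"]) fastforce
qed

lemma fractional_matching_number_le:
  assumes "\<And>f. fractional_matching G f \<Longrightarrow> (\<Sum>e\<in>edges G. f e) \<le> b"
  shows "fractional_matching_number G \<le> b"
  unfolding fractional_matching_number_def
proof (rule cSUP_least)
  have "fractional_matching G (\<lambda>_. 0)"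
    unfolding fractional_matching_def by simp
  then show "Collect (fractional_matching G) \<noteq> {}"
    by auto
qed (use assms in auto)

text \<open>A factor gives the fractional matching with weight \<open>1\<close> on its $K_{1,1}$ components and
  \<open>1/2\<close> on all its other edges; only the two leaves of each $K_{1,2}$ are not saturated.\<close>

lemma factor_lower_bound:
  assumes G: "sgraph G" and F: "star_circuit_factor F G"
  shows "real (card (verts G)) - 2 * fractional_matching_number G \<le>
    real (card {C \<in> components F. isomorphic C (star 2)})"
proof -
  have FG: "subgraph F G" "verts F = verts G"
    and comps: "\<And>C. C \<in> components F \<Longrightarrow> isomorphic C (star 1) \<or> isomorphic C (star 2) \<or> (\<exists>m\<ge>3. circuit m C)"
    using F unfolding star_circuit_factor_def by auto
  have sF: "sgraph F" and EF: "edges F \<subseteq> edges G"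
    using FG unfolding subgraph_def by auto
  note finF = finite_edges[OF sF]
  define f :: "'a set \<Rightarrow> real" where
    "f e = (if e \<in> edges F then if \<forall>v\<in>e. degree F v = 1 then 1 else 1 / 2 else 0)" for e
  define val where "val v = (\<Sum>u\<in>neighbours F v. f {v, u})" for v
  have val_eq: "(\<Sum>e\<in>{e \<in> edges G. v \<in> e}. f e) = val v" for v
  proof -
    have "(\<Sum>e\<in>{e \<in> edges G. v \<in> e}. f e) = (\<Sum>e\<in>{e \<in> edges F. v \<in> e}. f e)"
      using EF finite_edges[OF G] by (intro sum.mono_neutral_right) (auto simp: f_def)
    then show ?thesis
      unfolding val_def sum_incident[OF sF] .
  qed
  have two: "val v = 1" if "degree F v = 2" for v
  proof -
    have "val v = (\<Sum>u\<in>neighbours F v. 1 / 2)"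
      unfolding val_def using that by (intro sum.cong) (auto simp: f_def neighbours_def)
    then show ?thesis
      using that degree_eq_card_neighbours[OF sF, of v] by simp
  qed
  have one: "val v = f {v, u}" if "neighbours F v = {u}" for v u
    unfolding val_def that by simp
  have fval: "f {v, u} = (if degree F v = 1 \<and> degree F u = 1 then 1 else 1 / 2)" if "{v, u} \<in> edges F" for v u
    using that unfolding f_def by auto
  \<comment> \<open>The \<open>1\<close> for a star with two edges is its loss 3 - (1 + 1/2 +
    1/2).\<close>
  have comp: "(\<forall>v\<in>verts C. val v \<le> 1) \<and>
      real (card (verts C)) \<le> (\<Sum>v\<in>verts C. val v) + (if isomorphic C (star 2) then 1 else 0)"
    if C: "C \<in> components F" for C
  proof -
    obtain v0 where v0: "v0 \<in> verts F" "C = component F v0"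
      using C unfolding components_eq by auto
    have sC: "sgraph C"
      using sgraph_component[OF sF] v0 by simp
    have nb: "neighbours F v = neighbours C v" if "v \<in> verts C" for v
      using neighbours_component[OF sF, of v v0] that v0 by simp
    have degF: "degree F v = card (neighbours C v)" if "v \<in> verts C" for v
      using nb[OF that] degree_eq_card_neighbours[OF sF] by simp
    have mem: "u \<in> verts C" "u \<noteq> v" if "u \<in> neighbours C v" for u v
      using neighbours_subset[OF sC, of v] that by auto
    consider "isomorphic C (star 1)" | "isomorphic C (star 2)" | m where "circuit m C"
      using comps[OF C] by blast
    then show ?thesis
    proof cases
      case 1
      then obtain a b where ab: "a \<noteq> b" "verts C = {a, b}" "{a, b} \<in> edges C"
        using isomorphic_star1_iff[OF sC] by blast
      have n: "neighbours C a = {b}" "neighbours C b = {a}"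
        using mem ab by (auto simp: neighbours_def insert_commute)
      then have "val a = 1" "val b = 1"
        using one[of a b] one[of b a] nb[of a] nb[of b] degF[of a] degF[of b] ab fval[of a b] fval[of b a]
        by (auto simp: neighbours_def)
      then show ?thesis
        using ab by auto
    next
      case 2
      then obtain s a b where sab: "s \<noteq> a" "s \<noteq> b" "a \<noteq> b" "verts C = {s, a, b}"
        "{s, a} \<in> edges C" "{s, b} \<in> edges C" "{a, b} \<notin> edges C"
        using isomorphic_star2_iff[OF sC] by blast
      have n: "neighbours C a = {s}" "neighbours C b = {s}" "neighbours C s = {a, b}"
      proof -
        have N: "neighbours C v = {u \<in> {s, a, b}. {v, u} \<in> edges C}" for v
          using neighbours_subset[OF sC, of v] sab(4) unfolding neighbours_def by auto
        have "{a, s} \<in> edges C" "{b, s} \<in> edges C" "{b, a} \<notin> edges C" "{x} \<notin> edges C" for x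
          using sab(5-7) sC unfolding sgraph_def by (auto simp: insert_commute)
        then show "neighbours C a = {s}" "neighbours C b = {s}" "neighbours C s = {a, b}"
          unfolding N using sab by auto
      qed
      have ds: "degree F s = 2"
        using degF[of s] n sab by simp
      have "val a = 1 / 2" "val b = 1 / 2"
        using one[of a s] one[of b s] nb[of a] nb[of b] n ds sab(4) fval[of a s] fval[of b s]
        by (auto simp: neighbours_def)
      moreover have "val s = 1"
        by (rule two[OF ds])
      ultimately show ?thesis
        using sab 2 by auto
    next
      case 3
      then have "val v = 1" if "v \<in> verts C" for v
        using that two[of v] degF[OF that] degree_eq_card_neighbours[OF sC] unfolding circuit_def by simp
      then show ?thesis by simp
    qed
  qed
  have fm: "fractional_matching G f"
    unfolding fractional_matching_def
  proof (intro conjI ballI)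
    fix v assume "v \<in> verts G"
    then have "component F v \<in> components F" "v \<in> verts (component F v)"
      using FG unfolding components_eq by (auto simp: reach_set_iff)
    then show "(\<Sum>e\<in>{e \<in> edges G. v \<in> e}. f e) \<le> 1"
      unfolding val_eq using comp by blast
  qed (auto simp: f_def)
  have "real (card (verts G)) = (\<Sum>v\<in>verts F. 1)"
    using FG by simp
  also have "\<dots> = (\<Sum>C\<in>components F. real (card (verts C)))"
    by (simp only: sum_verts_induced_subgraphs[OF sF]) simp
  also have "\<dots> \<le> (\<Sum>C\<in>components F. (\<Sum>v\<in>verts C. val v) + (if isomorphic C (star 2) then 1 else 0))"
    using comp by (intro sum_mono) auto
  also have "\<dots> = (\<Sum>v\<in>verts F. val v) + real (card {C \<in> components F. isomorphic C (star 2)})"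
    using finite_verts[OF sF] unfolding sum_verts_induced_subgraphs[OF sF, of val]
    by (simp add: sum.distrib sum.If_cases components_eq Int_def)
  also have "(\<Sum>v\<in>verts F. val v) = 2 * (\<Sum>e\<in>edges G. f e)"
  proof -
    have "2 * (\<Sum>e\<in>edges G. f e) = (\<Sum>e\<in>edges G. f e * (\<Sum>v\<in>e. 1))"
      unfolding sum_distrib_left using G by (intro sum.cong) (auto simp: sgraph_def)
    also have "\<dots> = (\<Sum>v\<in>verts G. val v)"
      unfolding sum_edges_eq_sum_verts[OF G] val_eq by simp
    finally show ?thesis using FG by simp
  qed
  also have "(\<Sum>e\<in>edges G. f e) \<le> fractional_matching_number G"
    by (rule fractional_matching_le_number[OF G fm])
  finally show ?thesis by simp
qed

section \<open>Factors from Hall's theorem\<close>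

abbreviation nbhd :: "'a graph \<Rightarrow> 'a set \<Rightarrow> 'a set" where
  "nbhd G X \<equiv> \<Union>x\<in>X. neighbours G x"

lemma nbhd_subset: "sgraph G \<Longrightarrow> nbhd G X \<subseteq> verts G"
  using neighbours_subset[of G] by blast

lemma finite_nbhd: "sgraph G \<Longrightarrow> finite (nbhd G X)"
  using nbhd_subset[of G X] finite_verts[of G] finite_subset by blast

text \<open>Removing from a set its elements having a neighbour in it does not decrease the deficiency,
  so the maximum deficiency is attained at an independent set.\<close>

lemma max_deficiency_independent:
  assumes G: "sgraph G"
  obtains I where "independent_set G I"
    "\<And>X. X \<subseteq> verts G \<Longrightarrow> card X + card (nbhd G I) \<le> card I + card (nbhd G X)"
proof -
  let ?def = "\<lambda>X. int (card X) - int (card (nbhd G X))"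
  note fin = finite_verts[OF G]
  have "Max (?def ` Pow (verts G)) \<in> ?def ` Pow (verts G)"
    using fin by (intro Max_in) auto
  then obtain X0 where X0: "X0 \<subseteq> verts G" "Max (?def ` Pow (verts G)) = ?def X0"
    by blast
  have max: "?def X \<le> ?def X0" if "X \<subseteq> verts G" for X
    using that fin unfolding X0(2)[symmetric] by (intro Max_ge) auto
  define I where "I = X0 - nbhd G X0"
  have fX0: "finite X0"
    using X0(1) fin finite_subset by blast
  have "nbhd G I \<subseteq> nbhd G X0 - X0"
    using neighbours_sym[of _ G] unfolding I_def by blast
  then have "card (nbhd G I) \<le> card (nbhd G X0 - X0)"
    using finite_nbhd[OF G] by (intro card_mono) auto
  also have "\<dots> = card (nbhd G X0) - card (nbhd G X0 \<inter> X0)"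
    using finite_nbhd[OF G] by (intro card_Diff_subset_Int) auto
  finally have "card (nbhd G I) + card (nbhd G X0 \<inter> X0) \<le> card (nbhd G X0)"
    using card_mono[of "nbhd G X0" "nbhd G X0 \<inter> X0"] finite_nbhd[OF G] by simp
  moreover have "card I + card (nbhd G X0 \<inter> X0) = card X0"
    unfolding I_def using card_Diff_subset_Int[of X0 "nbhd G X0"] fX0
      card_mono[of X0 "X0 \<inter> nbhd G X0"] by (simp add: Int_commute)
  ultimately have I0: "?def X0 \<le> ?def I"
    by linarith
  show thesis
  proof (rule that)
    show "independent_set G I"
      using X0(1) unfolding independent_set_def I_def neighbours_def by auto
    fix X assume "X \<subseteq> verts G"
    then show "card X + card (nbhd G I) \<le> card I + card (nbhd G X)"
      using max[of X] I0 by linarith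
  qed
qed

text \<open>Doubling the elements of \<open>nbhd G I\<close> keeps fibres to at most two elements.
  They are nonempty because source and target have equal size, so that Hall's injection is onto, and
  the copies marked \<open>False\<close> can only be hit from \<open>I\<close>. Hall's condition
  holds by \<open>twice\<close> for sets inside \<open>I\<close> and by the maximal deficiency for
  all others.\<close>

lemma surjective_assignment:
  assumes G: "sgraph G" and I: "I \<subseteq> verts G"
    and max: "\<And>X. X \<subseteq> verts G \<Longrightarrow> card X + card (nbhd G I) \<le> card I + card (nbhd G X)"
    and twice: "\<And>X. X \<subseteq> verts G \<Longrightarrow> card X \<le> 2 * card (nbhd G X)"
  obtains h where "\<And>i. i \<in> I \<Longrightarrow> h i \<in> neighbours G i"
    "\<And>s. s \<in> nbhd G I \<Longrightarrow> card {i \<in> I. h i = s} = 1 \<or> card {i \<in> I. h i = s} = 2"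
proof -
  let ?S = "nbhd G I"
  (* The elements of Inr are dummies that use up the second copies of the elements of S left free
     by I; without them the first copies need not all be hit. *)
  define n where "n = 2 * card ?S - card I"
  define A :: "('a + nat) set" where "A = Inl ` I \<union> Inr ` {..<n}"
  define T :: "'a + nat \<Rightarrow> ('a \<times> bool) set" where
    "T v = (case v of Inl i \<Rightarrow> neighbours G i \<times> UNIV | Inr _ \<Rightarrow> ?S \<times> {True})" for v
  have finI: "finite I" and finS: "finite ?S"
    using I finite_verts[OF G] finite_subset finite_nbhd[OF G] by blast+
  have cI: "card I \<le> 2 * card ?S"
    using twice[OF I] .
  have finA: "finite A"
    unfolding A_def using finI by simp
  have cA: "card A = 2 * card ?S"
    unfolding A_def using finI cI by (subst card_Un_disjoint) (auto simp: card_image n_def)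
  have "\<exists>f. inj_on f A \<and> (\<forall>x\<in>A. f x \<in> T x)"
  proof (rule hall_marriage[OF finA])
    show "finite (T x)" if "x \<in> A" for x
      unfolding T_def using finite_neighbours[OF G] finS by (cases x) auto
    fix Y assume Y: "Y \<subseteq> A"
    define X where "X = {i. Inl i \<in> Y}"
    have XI: "X \<subseteq> I"
      using Y unfolding X_def A_def by auto
    have finX: "finite X"
      using XI finI finite_subset by blast
    have XV: "X \<subseteq> verts G"
      using XI I by auto
    have UX: "nbhd G X \<times> UNIV \<subseteq> (\<Union>x\<in>Y. T x)"
      unfolding X_def T_def by force
    have finT: "finite (\<Union>x\<in>Y. T x)"
    proof (rule finite_subset)
      show "(\<Union>x\<in>Y. T x) \<subseteq> ?S \<times> UNIV"
        using Y unfolding T_def A_def by (fastforce split: sum.splits)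
    qed (use finS in simp)
    show "card Y \<le> card (\<Union>x\<in>Y. T x)"
    proof (cases "Y \<subseteq> Inl ` I")
      case True
      then have "Y = Inl ` X"
        unfolding X_def by auto
      then have "card Y \<le> 2 * card (nbhd G X)"
        using twice[OF XV] by (simp add: card_image)
      also have "\<dots> = card (nbhd G X \<times> (UNIV :: bool set))"
        by (simp add: card_cartesian_product)
      also have "\<dots> \<le> card (\<Union>x\<in>Y. T x)"
        by (rule card_mono[OF finT UX])
      finally show ?thesis .
    next
      case False
      then obtain j where "Inr j \<in> Y"
        using Y unfolding A_def by blast
      then have "?S \<times> {True} \<subseteq> (\<Union>x\<in>Y. T x)"
        unfolding T_def by force
      then have sub: "nbhd G X \<times> {False} \<union> ?S \<times> {True} \<subseteq> (\<Union>x\<in>Y. T x)"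
        using UX by auto
      have "Y \<subseteq> Inl ` X \<union> Inr ` {..<n}"
        using Y unfolding X_def A_def by auto
      then have "card Y \<le> card (Inl ` X \<union> Inr ` {..<n} :: ('a + nat) set)"
        using finX by (intro card_mono) auto
      also have "\<dots> = card X + n"
        using finX by (subst card_Un_disjoint) (auto simp: card_image)
      also have "\<dots> \<le> card (nbhd G X) + card ?S"
        using max[OF XV] cI unfolding n_def by linarith
      also have "\<dots> = card (nbhd G X \<times> {False} \<union> ?S \<times> {True})"
        using finite_nbhd[OF G] finS by (subst card_Un_disjoint) (auto simp: card_cartesian_product)
      also have "\<dots> \<le> card (\<Union>x\<in>Y. T x)"
        by (rule card_mono[OF finT sub])
      finally show ?thesis .
    qed
  qed
  then obtain f where f: "inj_on f A" "\<And>x. x \<in> A \<Longrightarrow> f x \<in> T x" by blast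
  have "f ` A = ?S \<times> UNIV"
  proof (rule card_subset_eq)
    show "f ` A \<subseteq> ?S \<times> UNIV"
      using f(2) unfolding A_def T_def by force
    show "card (f ` A) = card (?S \<times> (UNIV :: bool set))"
      using card_image[OF f(1)] cA by (simp add: card_cartesian_product)
  qed (use finS in simp)
  define h where "h i = fst (f (Inl i))" for i
  show thesis
  proof (rule that)
    show "h i \<in> neighbours G i" if "i \<in> I" for i
      using f(2)[of "Inl i"] that unfolding A_def T_def h_def by auto
    fix s assume s: "s \<in> ?S"
    then have "(s, False) \<in> f ` A"
      using \<open>f ` A = ?S \<times> UNIV\<close> by simp
    then obtain x where x: "x \<in> A" "f x = (s, False)"
      by (metis imageE)
    have "x \<in> Inl ` I"
      using x f(2)[OF x(1)] unfolding A_def T_def by auto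
    then obtain i where "i \<in> I" "f (Inl i) = (s, False)"
      using x by auto
    then have "i \<in> {i \<in> I. h i = s}"
      unfolding h_def by simp
    then have pos: "card {i \<in> I. h i = s} \<ge> 1"
      using finI by (metis (mono_tags, lifting) One_nat_def Suc_leI card_gt_0_iff empty_iff finite_Collect_conjI finite_subset mem_Collect_eq subsetI)
    have "card {i \<in> I. h i = s} = card ((\<lambda>i. f (Inl i)) ` {i \<in> I. h i = s})"
      using f(1) unfolding A_def by (intro card_image[symmetric]) (auto simp: inj_on_def)
    also have "\<dots> \<le> card ({s} \<times> (UNIV :: bool set))"
      unfolding h_def by (intro card_mono) (auto, metis fst_conv)
    finally have "card {i \<in> I. h i = s} \<le> 2"
      by (simp add: card_cartesian_product)
    then show "card {i \<in> I. h i = s} = 1 \<or> card {i \<in> I. h i = s} = 2"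
      using pos by linarith
  qed
qed

text \<open>A subset of \<open>W\<close> with too few neighbours in \<open>W\<close> could be added
  to \<open>I\<close>, raising the deficiency above its maximum. Hall's injection of the finite set
  \<open>W\<close> into itself is then a permutation.\<close>

lemma remaining_permutation:
  assumes G: "sgraph G" and I: "independent_set G I"
    and max: "\<And>X. X \<subseteq> verts G \<Longrightarrow> card X + card (nbhd G I) \<le> card I + card (nbhd G X)"
  defines "W \<equiv> verts G - I - nbhd G I"
  obtains g where "bij_betw g W W" "\<And>w. w \<in> W \<Longrightarrow> g w \<in> neighbours G w"
proof -
  have IV: "I \<subseteq> verts G"
    using I unfolding independent_set_def by auto
  have finW: "finite W" and finI: "finite I"
    using finite_verts[OF G] IV finite_subset unfolding W_def by auto
  have "\<exists>g. inj_on g W \<and> (\<forall>w\<in>W. g w \<in> neighbours G w \<inter> W)"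
  proof (rule hall_marriage[OF finW])
    fix X assume X: "X \<subseteq> W"
    then have finX: "finite X" using finW finite_subset by blast
    have "card (I \<union> X) + card (nbhd G I) \<le> card I + card (nbhd G (I \<union> X))"
      using X IV unfolding W_def by (intro max) auto
    moreover have "card (I \<union> X) = card I + card X"
      using X finX finI unfolding W_def by (intro card_Un_disjoint) auto
    moreover have "nbhd G (I \<union> X) \<subseteq> nbhd G I \<union> (\<Union>x\<in>X. neighbours G x \<inter> W)"
    proof
      fix u assume u: "u \<in> nbhd G (I \<union> X)"
      \<comment> \<open>\<open>W\<close> avoids \<open>nbhd G I\<close>, so no vertex of
        \<open>X\<close> is adjacent to \<open>I\<close>.\<close>
      have "u \<notin> I" if "u \<in> nbhd G X"
        using that X neighbours_sym[of u G] unfolding W_def by blast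
      then show "u \<in> nbhd G I \<union> (\<Union>x\<in>X. neighbours G x \<inter> W)"
        using u nbhd_subset[OF G] unfolding W_def by blast
    qed
    then have "card (nbhd G (I \<union> X)) \<le> card (nbhd G I) + card (\<Union>x\<in>X. neighbours G x \<inter> W)"
      using finite_nbhd[OF G] finX finite_neighbours[OF G]
      by (meson card_Un_le card_mono finite_Int finite_UN_I finite_UnI le_trans)
    ultimately show "card X \<le> card (\<Union>x\<in>X. neighbours G x \<inter> W)"
      by linarith
  qed (use finW in auto)
  then obtain g where g: "inj_on g W" "\<And>w. w \<in> W \<Longrightarrow> g w \<in> neighbours G w \<inter> W" by blast
  have "g ` W = W"
    using g finW by (intro card_subset_eq) (auto simp: card_image)
  then show thesis
    using that[of g] g unfolding bij_betw_def by auto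
qed

text \<open>Each element of \<open>nbhd G I\<close> with its fibre is a star with one or two edges.
  A cycle of \<open>g\<close> has length at least 2, since no vertex is its own neighbour; it is a
  single edge for length 2 and a circuit otherwise. As the fibres are disjoint and nonempty, each
  fibre of size 2 accounts for one of the surplus elements of \<open>I\<close>.\<close>

lemma factor_of_assignments:
  assumes G: "sgraph G" and I: "independent_set G I"
    and h: "\<And>i. i \<in> I \<Longrightarrow> h i \<in> neighbours G i"
    and fibre: "\<And>s. s \<in> nbhd G I \<Longrightarrow> card {i \<in> I. h i = s} = 1 \<or> card {i \<in> I. h i = s} = 2"
  defines "W \<equiv> verts G - I - nbhd G I"
  assumes g: "bij_betw g W W" "\<And>w. w \<in> W \<Longrightarrow> g w \<in> neighbours G w"
  shows "\<exists>F. star_circuit_factor F G \<and>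
    card {C \<in> components F. isomorphic C (star 2)} + card (nbhd G I) \<le> card I"
proof -
  let ?S = "nbhd G I"
  define F where "F = \<lparr>verts = verts G, edges = {{i, h i} |i. i \<in> I} \<union> {{w, g w} |w. w \<in> W}\<rparr>"
  have VF: "verts F = verts G" and EF: "edges F = {{i, h i} |i. i \<in> I} \<union> {{w, g w} |w. w \<in> W}"
    unfolding F_def by simp_all
  have IV: "I \<subseteq> verts G" and ind: "\<And>u v. u \<in> I \<Longrightarrow> v \<in> I \<Longrightarrow> {u, v} \<notin> edges G"
    using I unfolding independent_set_def by auto
  note fin = finite_verts[OF G]
  have finI: "finite I" using IV fin finite_subset by blast
  have IS: "I \<inter> ?S = {}"
    using ind unfolding neighbours_def by auto
  have hS: "h i \<in> ?S" if "i \<in> I" for i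
    using h[OF that] that by auto
  have gW: "g w \<in> W" if "w \<in> W" for w
    using g(1) that unfolding bij_betw_def by auto
  have ginj: "g u = g w \<longleftrightarrow> u = w" if "u \<in> W" "w \<in> W" for u w
    using g(1) that unfolding bij_betw_def inj_on_def by auto
  have WIS: "W \<inter> I = {}" "W \<inter> ?S = {}"
    unfolding W_def by auto
  have EFG: "edges F \<subseteq> edges G"
    unfolding EF using h g(2) unfolding neighbours_def by auto
  have sF: "sgraph F"
    using G EFG unfolding sgraph_def VF by auto
  have sub: "subgraph F G"
    using sF EFG unfolding subgraph_def VF by simp
  have edge_iff: "{u, v} \<in> edges F \<longleftrightarrow> u \<in> I \<and> v = h u \<or> v \<in> I \<and> u = h v \<or> u \<in> W \<and> v = g u \<or> v \<in> W \<and> u = g v" for u v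
    unfolding EF by (auto simp: doubleton_eq_iff)
  have star_comp: "reach_set F v = insert s {i \<in> I. h i = s}"
    if s: "s \<in> ?S" and v: "v \<in> insert s {i \<in> I. h i = s}" for s v
  proof -
    let ?B = "insert s {i \<in> I. h i = s}"
    have sV: "s \<in> verts F"
      using s nbhd_subset[OF G] unfolding VF by auto
    have "reach_set F s = ?B"
    proof (rule reach_set_eqI)
      show "?B \<subseteq> verts F"
        using sV IV unfolding VF by auto
      show "w \<in> ?B" if "u \<in> ?B" "{u, w} \<in> edges F" for u w
        using that s hS IS WIS gW unfolding edge_iff by blast
      show "reachable F s u" if "u \<in> ?B" for u
        using that reachable_edge[of s u F] unfolding edge_iff by auto
    qed simp
    then show ?thesis
      using reach_set_eq[of v F s] v by simp
  qed
  have perm_comp: "isomorphic (component F w) (star 1) \<or> (\<exists>m\<ge>3. circuit m (component F w))"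
    if w: "w \<in> W" for w
  proof -
    have wV: "w \<in> verts F"
      using w unfolding W_def VF by auto
    have gne: "g u \<noteq> u" if "u \<in> W" for u
      using g(2)[OF that] neighbours_subset[OF G, of u] by auto
    show ?thesis
    proof (cases "g (g w) = w")
      case True
      have "reach_set F w = {w, g w}"
      proof (rule reach_set_eqI)
        show "{w, g w} \<subseteq> verts F"
          using w gW[OF w] unfolding W_def VF by auto
        show "v \<in> {w, g w}" if "u \<in> {w, g w}" "{u, v} \<in> edges F" for u v
        proof -
          have uW: "u \<in> W"
            using that(1) w gW by auto
          then have "v = g u \<or> v \<in> W \<and> u = g v"
            using that(2) WIS hS unfolding edge_iff by blast
          then show ?thesis
            using that(1) True ginj[of v w] ginj[of v "g w"] w gW[OF w] by auto
        qed
        show "reachable F w u" if "u \<in> {w, g w}" for u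
          using that reachable_edge[of w "g w" F] w unfolding edge_iff by auto
      qed simp
      moreover have "{w, g w} \<in> edges F"
        using w unfolding edge_iff by auto
      ultimately have "isomorphic (component F w) (star 1)"
        using gne[OF w] unfolding isomorphic_star1_iff[OF sgraph_component[OF sF]]
        by (intro exI[of _ w] exI[of _ "g w"]) (auto simp: induced_subgraph_def)
      then show ?thesis by blast
    next
      case False
      \<comment> \<open>The property spreads along edges. It keeps the successor and the predecessor
        of \<open>u\<close> under \<open>g\<close> distinct, so that every degree in the component
        is 2.\<close>
      have inv: "u \<in> W \<and> g (g u) \<noteq> u" if "u \<in> reach_set F w" for u
      proof -
        have "reachable F w u"
          using that unfolding reach_set_iff by simp
        then show ?thesis
          unfolding reachable_def
        proof (induction rule: rtranclp_induct)
          case (step u v)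
          then have uW: "u \<in> W" "g (g u) \<noteq> u" by auto
          have "v = g u \<or> v \<in> W \<and> u = g v"
            using step.hyps(2) uW WIS hS unfolding edge_iff by blast
          then show ?case
            using uW gW ginj[of "g (g u)" u] by metis
        qed (use w False in auto)
      qed
      have nb: "card (neighbours F u) = 2" if u: "u \<in> reach_set F w" for u
      proof -
        have uW: "u \<in> W" "g (g u) \<noteq> u"
          using inv[OF u] by auto
        obtain p where p: "p \<in> W" "g p = u"
          using g(1) uW(1) unfolding bij_betw_def by (metis imageE)
        have uI: "u \<notin> I" "\<not> (v \<in> I \<and> u = h v)" for v
          using uW(1) WIS hS by blast+
        have "v \<in> W \<and> u = g v \<longleftrightarrow> v = p" for v
          using p ginj[of v p] by metis
        then have "v \<in> neighbours F u \<longleftrightarrow> v = g u \<or> v = p" for v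
          unfolding neighbours_def edge_iff mem_Collect_eq using uI uW(1) by blast
        then have "neighbours F u = {g u, p}"
          by blast
        moreover have "g u \<noteq> p"
          using p uW by auto
        ultimately show ?thesis by simp
      qed
      have "circuit (card (reach_set F w)) (component F w)"
        unfolding circuit_def
        using sgraph_component[OF sF] connected_component[OF sF wV]
          degree_eq_card_neighbours[OF sgraph_component[OF sF]] neighbours_component[OF sF] nb by auto
      moreover have "3 \<le> card (reach_set F w)"
      proof -
        have w1: "w \<in> reach_set F w"
          using wV unfolding reach_set_iff by simp
        then have w2: "g w \<in> reach_set F w"
          using reach_set_closed[OF sF] w unfolding edge_iff by blast
        then have "g (g w) \<in> reach_set F w"
          using reach_set_closed[OF sF w2] gW[OF w] unfolding edge_iff by blast
        then have "{w, g w, g (g w)} \<subseteq> reach_set F w"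
          using w1 w2 by simp
        moreover have "finite (reach_set F w)"
          using finite_verts[OF sF] unfolding reach_set_def by simp
        moreover have "card {w, g w, g (g w)} = 3"
          using gne[OF w] gne[OF gW[OF w]] False by auto
        ultimately show ?thesis
          by (metis card_mono)
      qed
      ultimately show ?thesis by blast
    qed
  qed
  have cases: "v \<in> W \<or> (\<exists>s\<in>?S. v \<in> insert s {i \<in> I. h i = s})" if "v \<in> verts F" for v
    using that hS unfolding W_def VF by auto
  have star_iso: "card {i \<in> I. h i = s} = 1 \<and> isomorphic (component F v) (star 1) \<or>
      card {i \<in> I. h i = s} = 2 \<and> isomorphic (component F v) (star 2)"
    if s: "s \<in> ?S" and v: "v \<in> insert s {i \<in> I. h i = s}" for s v
  proof -
    note B = star_comp[OF s v]
    have edge: "{s, i} \<in> edges (component F v)" if "i \<in> I" "h i = s" for i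
      using that edge_iff[of s i] unfolding induced_subgraph_def B by auto
    have sI: "s \<notin> I"
      using s IS by auto
    show ?thesis
      using fibre[OF s]
    proof
      assume one: "card {i \<in> I. h i = s} = 1"
      then obtain a where a: "{i \<in> I. h i = s} = {a}"
        by (meson card_1_singletonE)
      then have "a \<in> I" "h a = s"
        by blast+
      moreover have "verts (component F v) = {s, a}"
        by (simp only: verts_induced_subgraph B a)
      ultimately have "isomorphic (component F v) (star 1)"
        using edge[of a] sI
        by (intro isomorphic_star1_iff[OF sgraph_component[OF sF], THEN iffD2] exI[of _ s] exI[of _ a]) auto
      then show ?thesis using one by simp
    next
      assume two: "card {i \<in> I. h i = s} = 2"
      then obtain a b where ab: "{i \<in> I. h i = s} = {a, b}" "a \<noteq> b"
        by (meson card_2_iff)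
      then have abI: "a \<in> I" "b \<in> I" "h a = s" "h b = s"
        by blast+
      have "{a, b} \<notin> edges (component F v)"
        using ind[OF abI(1,2)] EFG unfolding induced_subgraph_def by auto
      moreover have "verts (component F v) = {s, a, b}"
        by (simp only: verts_induced_subgraph B ab(1))
      ultimately have "isomorphic (component F v) (star 2)"
        using edge[OF abI(1,3)] edge[OF abI(2,4)] sI abI(1,2) ab(2)
        by (intro isomorphic_star2_iff[OF sgraph_component[OF sF], THEN iffD2]
            exI[of _ s] exI[of _ a] exI[of _ b]) auto
      then show ?thesis using two by simp
    qed
  qed
  have factor: "star_circuit_factor F G"
    unfolding star_circuit_factor_def
  proof (intro conjI ballI)
    fix C assume "C \<in> components F"
    then obtain v where "v \<in> verts F" "C = component F v"
      unfolding components_eq by auto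
    then show "isomorphic C (star 1) \<or> isomorphic C (star 2) \<or> (\<exists>m\<ge>3. circuit m C)"
      using cases[of v] star_iso perm_comp by blast
  qed (use sub VF in auto)
  have not_star1: "\<not> isomorphic C (star 2)" if C: "sgraph C" "isomorphic C (star 1)" for C :: "'a graph"
  proof
    assume "isomorphic C (star 2)"
    then obtain s a b where "s \<noteq> a" "s \<noteq> b" "a \<noteq> b" "verts C = {s, a, b}"
      using isomorphic_star2_iff[OF C(1)] by blast
    moreover obtain c d where "verts C = {c, d}"
      using C isomorphic_star1_iff by blast
    ultimately show False
      by (metis insertCI insertE singletonD)
  qed
  let ?S2 = "{s \<in> ?S. card {i \<in> I. h i = s} = 2}"
  have finS: "finite ?S"
    by (rule finite_nbhd[OF G])
  have finS2: "finite ?S2"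
    by (rule finite_subset[OF _ finS]) blast
  have "{C \<in> components F. isomorphic C (star 2)} \<subseteq> component F ` ?S2"
  proof
    fix C assume "C \<in> {C \<in> components F. isomorphic C (star 2)}"
    then obtain v where v: "v \<in> verts F" "C = component F v" "isomorphic C (star 2)"
      unfolding components_eq by auto
    have "v \<notin> W"
      using perm_comp[of v] v(2,3) not_star1[OF sgraph_component[OF sF, of v]] circuit_not_star2 by blast
    then obtain s where s: "s \<in> ?S" "v \<in> insert s {i \<in> I. h i = s}"
      using cases[OF v(1)] by blast
    then have "card {i \<in> I. h i = s} = 2"
      using star_iso[OF s] v not_star1[OF sgraph_component[OF sF, of v]] by blast
    moreover have "C = component F s"
      using star_comp[OF s] star_comp[OF s(1), of s] v(2) by simp
    ultimately show "C \<in> component F ` ?S2"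
      using s by blast
  qed
  then have "card {C \<in> components F. isomorphic C (star 2)} \<le> card (component F ` ?S2)"
    using finS2 by (intro card_mono finite_imageI)
  also have "\<dots> \<le> card ?S2"
    using finS2 by (rule card_image_le)
  also have "card ?S2 + card ?S \<le> card I"
  proof -
    have "card ?S2 + card ?S = (\<Sum>s\<in>?S. (if card {i \<in> I. h i = s} = 2 then 1 else 0) + 1)"
      by (simp only: card_eq_sum sum.distrib sum.inter_filter[OF finS])
    also have "\<dots> \<le> (\<Sum>s\<in>?S. card {i \<in> I. h i = s})"
      using fibre by (intro sum_mono) fastforce
    also have "\<dots> = card (\<Union>s\<in>?S. {i \<in> I. h i = s})"
      using finS finI by (intro card_UN_disjoint[symmetric]) auto
    also have "\<dots> \<le> card I"
      using finI by (intro card_mono) auto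
    finally show ?thesis .
  qed
  finally have "card {C \<in> components F. isomorphic C (star 2)} + card ?S \<le> card I"
    by simp
  then show ?thesis
    using factor by blast
qed

theorem star_circuit_factor_exists:
  assumes G: "sgraph G" and twice: "\<And>X. X \<subseteq> verts G \<Longrightarrow> card X \<le> 2 * card (nbhd G X)"
  obtains F I where "star_circuit_factor F G" "independent_set G I"
    "card {C \<in> components F. isomorphic C (star 2)} + card (nbhd G I) \<le> card I"
proof -
  obtain I where I: "independent_set G I"
    "\<And>X. X \<subseteq> verts G \<Longrightarrow> card X + card (nbhd G I) \<le> card I + card (nbhd G X)"
    using max_deficiency_independent[OF G] by blast
  have IV: "I \<subseteq> verts G"
    using I(1) unfolding independent_set_def by auto
  obtain h where h: "\<And>i. i \<in> I \<Longrightarrow> h i \<in> neighbours G i"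
    "\<And>s. s \<in> nbhd G I \<Longrightarrow> card {i \<in> I. h i = s} = 1 \<or> card {i \<in> I. h i = s} = 2"
    using surjective_assignment[OF G IV I(2) twice] by blast
  obtain g where g: "bij_betw g (verts G - I - nbhd G I) (verts G - I - nbhd G I)"
    "\<And>w. w \<in> verts G - I - nbhd G I \<Longrightarrow> g w \<in> neighbours G w"
    using remaining_permutation[OF G I] by blast
  show thesis
    using factor_of_assignments[OF G I(1) h g] that I(1) by blast
qed

section \<open>Critical graphs\<close>

text \<open>The colour classes are the matchings; empty classes coincide as sets, so their number
  may be smaller than \<open>k\<close>.\<close>

lemma chromatic_index_le:
  assumes "edge_coloring k (edges G) \<phi>"
  shows "chromatic_index G \<le> k"
proof -
  let ?M = "(\<lambda>c. {e \<in> edges G. \<phi> e = c}) ` {..<k}"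
  have "finite ?M" "edges G \<subseteq> \<Union>?M"
    using assms unfolding edge_coloring_def by auto
  moreover have "matching G M" if "M \<in> ?M" for M
    using that assms unfolding edge_coloring_def matching_def by blast
  ultimately have "chromatic_index G \<le> card ?M"
    unfolding chromatic_index_def by (intro Least_le exI[of _ ?M]) blast
  also have "\<dots> \<le> k"
    using card_image_le[of "{..<k}"] by simp
  finally show ?thesis .
qed

text \<open>Single edges are matchings, so the least number is attained. The matchings of a cover
  may overlap; for each edge one matching containing it is selected, and its index is the
  colour.\<close>

lemma edge_coloring_of_chromatic_index:
  assumes G: "sgraph G" and le: "chromatic_index G \<le> k"
  shows "\<exists>\<phi>. edge_coloring k (edges G) \<phi>"
proof -
  let ?P = "\<lambda>j. \<exists>\<M>. finite \<M> \<and> card \<M> = j \<and> (\<forall>M\<in>\<M>. matching G M) \<and> edges G \<subseteq> \<Union>\<M>"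
  let ?S = "(\<lambda>e. {e}) ` edges G"
  have "finite ?S" "\<forall>M\<in>?S. matching G M" "edges G \<subseteq> \<Union>?S"
    using finite_edges[OF G] by (auto simp: matching_def)
  then have "?P (card ?S)"
    by (intro exI[of _ ?S] conjI refl)
  then have "?P (chromatic_index G)"
    unfolding chromatic_index_def by (rule LeastI)
  then obtain \<M> where M: "finite \<M>" "card \<M> = chromatic_index G" "\<And>M. M \<in> \<M> \<Longrightarrow> matching G M"
    "edges G \<subseteq> \<Union>\<M>" by blast
  obtain b where b: "bij_betw b \<M> {..<card \<M>}"
    using ex_bij_betw_finite_nat[OF M(1)] by (auto simp: atLeast0LessThan)
  have "\<forall>e\<in>edges G. \<exists>m. m \<in> \<M> \<and> e \<in> m"
    using M(4) by auto
  from bchoice[OF this] obtain m where m: "\<And>e. e \<in> edges G \<Longrightarrow> m e \<in> \<M> \<and> e \<in> m e"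
    by auto
  have "edge_coloring k (edges G) (\<lambda>e. b (m e))"
    unfolding edge_coloring_def
  proof (intro conjI ballI impI)
    fix e assume "e \<in> edges G"
    then have "b (m e) \<in> {..<card \<M>}"
      using m b unfolding bij_betw_def by blast
    then show "b (m e) < k"
      using M(2) le by simp
  next
    fix e f assume ef: "e \<in> edges G" "f \<in> edges G" "e \<noteq> f" "e \<inter> f \<noteq> {}"
    have "m e \<noteq> m f"
      using M(3)[of "m e"] m[OF ef(1)] m[OF ef(2)] ef(3,4) unfolding matching_def by metis
    then show "b (m e) \<noteq> b (m f)"
      using b m[OF ef(1)] m[OF ef(2)] unfolding bij_betw_def inj_on_def by blast
  qed
  then show ?thesis by blast
qed

lemma degree_le_max_degree:
  assumes "sgraph G"
  shows "degree G v \<le> max_degree G"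
proof (cases "v \<in> verts G")
  case True
  then show ?thesis
    using finite_verts[OF assms] unfolding max_degree_def by (intro Max_ge) auto
next
  case False
  then have none: "{e \<in> edges G. v \<in> e} = {}"
    using assms unfolding sgraph_def by blast
  show ?thesis
    unfolding degree_def none by simp
qed

lemma k_critical_edge_critical:
  assumes "k_critical k G"
  shows "edge_critical (edges G) k"
proof
  have G: "sgraph G" and idx: "chromatic_index G = k + 1" and deg: "max_degree G = k"
    and sub: "\<And>H. subgraph H G \<Longrightarrow> H \<noteq> G \<Longrightarrow> chromatic_index H \<le> k"
    using assms unfolding k_critical_def by auto
  show "finite (edges G)"
    by (rule finite_edges[OF G])
  show "card e = 2" if "e \<in> edges G" for e
    using G that unfolding sgraph_def by blast
  show "\<not> edge_coloring k (edges G) \<phi>" for \<phi>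
    using chromatic_index_le[of k G \<phi>] idx by auto
  show "\<exists>\<phi>. edge_coloring k (edges G - {e}) \<phi>" if e: "e \<in> edges G" for e
  proof -
    let ?H = "\<lparr>verts = verts G, edges = edges G - {e}\<rparr>"
    have "sgraph ?H"
      using G unfolding sgraph_def by auto
    moreover have "?H \<noteq> G"
      using e by (metis Diff_iff graph.select_convs(2) singletonI)
    ultimately show ?thesis
      using edge_coloring_of_chromatic_index[of ?H k] sub[of ?H] unfolding subgraph_def by auto
  qed
  show "card {e \<in> edges G. v \<in> e} \<le> k" for v
    using degree_le_max_degree[OF G, of v] deg unfolding degree_def by simp
qed

text \<open>Deleting an isolated vertex would give a proper subgraph with the same edges, hence with
  the same colourings.\<close>

lemma k_critical_no_isolated:
  assumes "k_critical k G" "v \<in> verts G"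
  shows "neighbours G v \<noteq> {}"
proof
  assume empty: "neighbours G v = {}"
  have G: "sgraph G" and idx: "chromatic_index G = k + 1"
    and sub: "\<And>H. subgraph H G \<Longrightarrow> H \<noteq> G \<Longrightarrow> chromatic_index H \<le> k"
    using assms unfolding k_critical_def by auto
  let ?H = "\<lparr>verts = verts G - {v}, edges = edges G\<rparr>"
  have "v \<notin> e" if "e \<in> edges G" for e
    using incident_edges_eq[OF G, of v] that empty by auto
  then have H: "sgraph ?H"
    using G unfolding sgraph_def by auto
  moreover have "?H \<noteq> G"
    using assms(2) by (metis Diff_iff graph.select_convs(1) singletonI)
  ultimately have "chromatic_index ?H \<le> k"
    using sub[of ?H] unfolding subgraph_def by auto
  then show False
    using edge_coloring_of_chromatic_index[OF H] chromatic_index_le[of k G] idx by fastforce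
qed

lemma independence_number_le:
  assumes G: "sgraph G" and "\<And>I. independent_set G I \<Longrightarrow> real (card I) \<le> b"
  shows "real (independence_number G) \<le> b"
proof -
  have "finite (Collect (independent_set G))"
    by (rule finite_subset[of _ "Pow (verts G)"]) (auto simp: independent_set_def finite_verts[OF G])
  moreover have "independent_set G {}"
    unfolding independent_set_def by simp
  ultimately have "independence_number G \<in> card ` Collect (independent_set G)"
    unfolding independence_number_def by (intro Max_in) auto
  then show ?thesis
    using assms(2) by auto
qed

theorem theorem3p4:
  fixes G :: "'a graph"
  assumes "critical G"
  shows "(\<exists>F. star_circuit_factor F G) \<and>
         real (min_K12 G) = real (card (verts G)) - 2 * fractional_matching_number G \<and>
         real (min_K12 G) \<le> 1 / 5 * real (card (verts G)) \<and>
         real (independence_number G) \<le> 3 / 5 * real (card (verts G))"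
proof -
  obtain k where k: "k_critical k G"
    using assms unfolding critical_def by blast
  have G: "sgraph G"
    using k unfolding k_critical_def by simp
  interpret edge_critical "edges G" k
    using k by (rule k_critical_edge_critical)
  have nbrs_eq: "nbrs v = neighbours G v" for v
    unfolding nbrs_def neighbours_def ..
  have expand: "2 * card X \<le> 3 * card (nbhd G X)" if "X \<subseteq> verts G" for X
    using neighbourhood_lower_bound[of X] that finite_verts[OF G] k_critical_no_isolated[OF k]
    unfolding nbrs_eq by (meson finite_subset subsetD)
  have small: "card I + card (nbhd G I) \<le> card (verts G)" if I: "independent_set G I" for I
  proof -
    have "I \<subseteq> verts G" "I \<inter> nbhd G I = {}"
      using I unfolding independent_set_def neighbours_def by auto
    then have "card I + card (nbhd G I) = card (I \<union> nbhd G I)"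
      using finite_verts[OF G] finite_nbhd[OF G] finite_subset by (metis card_Un_disjoint)
    also have "\<dots> \<le> card (verts G)"
      using \<open>I \<subseteq> verts G\<close> nbhd_subset[OF G] finite_verts[OF G] by (intro card_mono) auto
    finally show ?thesis .
  qed
  have "card X \<le> 2 * card (nbhd G X)" if "X \<subseteq> verts G" for X
    using expand[OF that] by linarith
  then obtain F I where F: "star_circuit_factor F G" and I: "independent_set G I"
    and cF: "card {C \<in> components F. isomorphic C (star 2)} + card (nbhd G I) \<le> card I"
    using star_circuit_factor_exists[OF G] by blast
  let ?n = "card (verts G)" and ?\<mu> = "fractional_matching_number G"
    and ?c = "\<lambda>F. card {C \<in> components F. isomorphic C (star 2)}"
  have "?\<mu> \<le> (real ?n - (real (card I) - real (card (nbhd G I)))) / 2"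
  proof (rule fractional_matching_number_le)
    fix f assume "fractional_matching G f"
    then show "(\<Sum>e\<in>edges G. f e) \<le> (real ?n - (real (card I) - real (card (nbhd G I)))) / 2"
      using fractional_matching_bound[OF G _ I, of f] by simp
  qed
  moreover have "real (?c F) + real (card (nbhd G I)) \<le> real (card I)"
    using cF by (simp flip: of_nat_add)
  \<comment> \<open>All terms of c(F) <= |I| - |N(I)| <= |V| - 2 mu <= c(F) are equal, where c(F)
    counts the two-edge stars of \<open>F\<close> and mu is the fractional matching number.\<close>
  ultimately have eq: "real (?c F) = real ?n - 2 * ?\<mu>"
    using factor_lower_bound[OF G F] by (intro antisym) (simp_all add: field_simps)
  have "min_K12 G = ?c F"
    unfolding min_K12_def
  proof (rule Least_equality)
    show "\<exists>F'. star_circuit_factor F' G \<and> ?c F = ?c F'"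
      using F by blast
    show "?c F \<le> j" if "\<exists>F'. star_circuit_factor F' G \<and> j = ?c F'" for j
      using that factor_lower_bound[OF G] eq by force
  qed
  moreover have "I \<subseteq> verts G"
    using I unfolding independent_set_def by simp
  then have "5 * ?c F \<le> ?n"
    using cF expand[of I] small[OF I] by linarith
  moreover have "real (independence_number G) \<le> 3 / 5 * real ?n"
  proof (rule independence_number_le[OF G])
    fix J assume J: "independent_set G J"
    then have "J \<subseteq> verts G"
      unfolding independent_set_def by simp
    then show "real (card J) \<le> 3 / 5 * real ?n"
      using expand[of J] small[OF J] by linarith
  qed
  ultimately show ?thesis
    using F eq by auto
qed

end
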